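(* Let $\nu\in\mathbb N[I]$ and let $Y_\nu$ be the (Lagrangian quiver) variety of type $\mathbf D_{m+2}$, with strata $Y_{\nu,\underline c}$, defined in the context. The irreducible components of $Y_\nu$ are the closures $\overline{Y_{\nu,\underline c}}$ of the nonempty sets $Y_{\nu,\underline c}$, where $\underline c=(c_m,\dots,c_1)$ runs over the sequences of non-decreasing and non-negative integers (that is, $0\le c_m\le\cdots\le c_1$) such that $c_1\le\min\{\nu_i,\nu_k\}$.
   Context: $\mathbb N=\{0,1,2,\dots\}$. Fix an integer $m\ge1$, and let $I=\{i,k,j_1,\dots,j_m\}$ be the vertex set of the Dynkin graph of type $\mathbf D_{m+2}$ with edges $i-j_1$, $k-j_1$, $j_\beta-j_{\beta+1}$ ($1\le\beta\le m-1$). Let $\mathbb F$ be an algebraic closure of a finite field and $D$ a $d$-dimensional $\mathbb F$-vector space. $X$ is the variety of ramified flags of subspaces of $D$: $0\subseteq V_{j_m}\subseteq\cdots\subseteq V_{j_1}\subseteq U_i,U_k\subseteq U_{j_1}\subseteq\cdots\subseteq U_{j_m}\subseteq D$ (both $U_i$ and $U_k$ lie between $V_{j_1}$ and $U_{j_1}$). Conventions: $U_{j_{m+1}}=D$, $V_{j_{m+1}}=0$. For $\nu\in\mathbb N[I]$ and $\underline c=(c_m,\dots,c_1)$, $X_{\nu,\underline c}\subseteq X$ consists of the flags with $\dim U_i=\nu_i$, $\dim U_k=\nu_k$, $\dim V_{j_\beta}=c_\beta$, $\dim U_{j_\beta}=\nu_{j_\beta}-c_\beta$ for $1\le\beta\le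 m$. $Y$ is the variety of tuples $(U_i,U_k,\mathcal V_{j_1},\dots,\mathcal V_{j_m})$, where $U_i,U_k\subseteq D$ and $\mathcal V_{j_\beta}\subseteq D\oplus D$ are subspaces such that, with $\pi_1,\pi_2:D\oplus D\to D$ the two projections: - $\pi_2(\mathcal V_{j_1})\subseteq U_i$, $\pi_2(\mathcal V_{j_1})\subseteq U_k$, $U_i\oplus0\subseteq\mathcal V_{j_1}$, $U_k\oplus0\subseteq\mathcal V_{j_1}$; - for $1\le\beta\le m-1$: $\pi_1(\mathcal V_{j_\beta})\oplus0\subseteq\mathcal V_{j_{\beta+1}}$ and $0\oplus\pi_2(\mathcal V_{j_{\beta+1}})\subseteq\mathcal V_{j_\beta}$. (It is a closed subvariety of a product of Grassmannians, and is Nakajima's Lagrangian quiver variety of type $\mathbf D_{m+2}$ with framing $D$ at the vertex $j_m$.) $Y_\nu\subseteq Y$ is the subvariety where $\dim U_i=\nu_i$, $\dim U_k=\nu_k$, $\dim\mathcal V_{j_\beta}=\nu_{j_\beta}$ for all $\beta$. The set-theoretic map $\Psi_2:Y\to X$ sends $(U_i,U_k,\mathcal V_{j_\beta})$ to the flag with the same $U_i,U_k$ and with $U_{j_\beta}=\{x\in D:(x,0)\in\mathcal V_{j_\beta}\}$, $V_{j_\beta}=\pi_2(\mathcal V_{j_\beta})$. Put $Y_{\nu,\underline c}=\Psi_2^{-1}(X_{\nu,\underline c})$, a locally closed subset of $Y_\nu$; closures are taken in $Y_\nu$. *)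

theory Defs
  imports "HOL-Analysis.Analysis" "Jordan_Normal_Form.Determinant"
begin

subsection \<open>Ground field\<close>

definition subfield_of_type :: "'a::field set \<Rightarrow> bool" where
  "subfield_of_type K \<longleftrightarrow> 0 \<in> K \<and> 1 \<in> K \<and>
     (\<forall>x\<in>K. \<forall>y\<in>K. x + y \<in> K \<and> x * y \<in> K) \<and> (\<forall>x\<in>K. - x \<in> K \<and> inverse x \<in> K)"

text \<open>Together with the class \<^class>\<open>alg_closed_field\<close>, this says that the field
  is an algebraic closure of a finite field.\<close>

definition algebraic_over_finite_subfield :: "'a::field itself \<Rightarrow> bool" where
  "algebraic_over_finite_subfield _ \<longleftrightarrow>
     (\<exists>K::'a set. finite K \<and> subfield_of_type K \<and>
        (\<forall>x. \<exists>p. p \<noteq> 0 \<and> set (coeffs p) \<subseteq> K \<and> poly p x = 0))"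

subsection \<open>Irreducible components of a topological space\<close>

definition irreducible_in :: "'p topology \<Rightarrow> 'p set \<Rightarrow> bool" where
  "irreducible_in X S \<longleftrightarrow> S \<subseteq> topspace X \<and> S \<noteq> {} \<and>
     (\<forall>C1 C2. closedin X C1 \<and> closedin X C2 \<and> S \<subseteq> C1 \<union> C2 \<longrightarrow> S \<subseteq> C1 \<or> S \<subseteq> C2)"

definition irreducible_components :: "'p topology \<Rightarrow> 'p set set" where
  "irreducible_components X =
     {S. irreducible_in X S \<and> (\<forall>T. irreducible_in X T \<and> S \<subseteq> T \<longrightarrow> T = S)}"

subsection \<open>The Dynkin graph and the varieties \<open>X\<close>, \<open>Y\<close>\<close>

text \<open>Vertices of the graph of type \<open>D\<^bsub>m+2\<^esub>\<close>: \<open>i\<close>, \<open>k\<close> and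
  \<open>j\<^bsub>\<beta>\<^esub>\<close>, of which only \<open>1 \<le> \<beta> \<le> m\<close> are used.  A dimension vector is a function
  \<open>vertex \<Rightarrow> nat\<close>; its values elsewhere are irrelevant.\<close>

datatype vertex = Vi | Vk | Vj nat

text \<open>The scalar multiplication of \<open>D\<close> is an explicit parameter \<open>s\<close>; \<open>D\<close> is the whole type \<open>'v\<close>
  and \<open>D \<oplus> D\<close> is the type \<open>'v \<times> 'v\<close>.\<close>

abbreviation scale2 :: "('a::field \<Rightarrow> 'v::ab_group_add \<Rightarrow> 'v) \<Rightarrow> 'a \<Rightarrow> 'v \<times> 'v \<Rightarrow> 'v \<times> 'v" where
  "scale2 s \<equiv> module_prod.scale s s"

text \<open>Families indexed by \<open>{1..m}\<close> are required to be extensional, so that points are not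
  counted with irrelevant values outside the index range.\<close>

type_synonym 'v flag = "'v set \<times> 'v set \<times> (nat \<Rightarrow> 'v set) \<times> (nat \<Rightarrow> 'v set)"
type_synonym 'v point = "'v set \<times> 'v set \<times> (nat \<Rightarrow> ('v \<times> 'v) set)"

text \<open>Flags \<open>(U\<^bsub>i\<^esub>, U\<^bsub>k\<^esub>, (U\<^bsub>j\<^bsub>\<beta>\<^esub>\<^esub>), (V\<^bsub>j\<^bsub>\<beta>\<^esub>\<^esub>))\<close>.\<close>

definition X_flags :: "('a::field \<Rightarrow> 'v::ab_group_add \<Rightarrow> 'v) \<Rightarrow> nat \<Rightarrow> 'v flag set" where
  "X_flags s m = {(Ui, Uk, U, V).
     module.subspace s Ui \<and> module.subspace s Uk \<and>
     U \<in> extensional {1..m} \<and> V \<in> extensional {1..m} \<and>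
     (\<forall>\<beta>\<in>{1..m}. module.subspace s (U \<beta>) \<and> module.subspace s (V \<beta>)) \<and>
     V 1 \<subseteq> Ui \<and> V 1 \<subseteq> Uk \<and> Ui \<subseteq> U 1 \<and> Uk \<subseteq> U 1 \<and>
     (\<forall>\<beta>\<in>{1..<m}. V (\<beta> + 1) \<subseteq> V \<beta> \<and> U \<beta> \<subseteq> U (\<beta> + 1))}"

text \<open>The condition \<open>dim U\<^bsub>j\<^bsub>\<beta>\<^esub>\<^esub> = \<nu>\<^bsub>j\<^bsub>\<beta>\<^esub>\<^esub> - c\<^bsub>\<beta>\<^esub>\<close> is written additively, to avoid truncated
  subtraction.\<close>

definition X_stratum ::
  "('a::field \<Rightarrow> 'v::ab_group_add \<Rightarrow> 'v) \<Rightarrow> nat \<Rightarrow> (vertex \<Rightarrow> nat) \<Rightarrow> (nat \<Rightarrow> nat) \<Rightarrow> 'v flag set" where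
  "X_stratum s m \<nu> c = {(Ui, Uk, U, V) \<in> X_flags s m.
     vector_space.dim s Ui = \<nu> Vi \<and> vector_space.dim s Uk = \<nu> Vk \<and>
     (\<forall>\<beta>\<in>{1..m}. vector_space.dim s (V \<beta>) = c \<beta> \<and>
                   vector_space.dim s (U \<beta>) + c \<beta> = \<nu> (Vj \<beta>))}"

definition Y_variety :: "('a::field \<Rightarrow> 'v::ab_group_add \<Rightarrow> 'v) \<Rightarrow> nat \<Rightarrow> 'v point set" where
  "Y_variety s m = {(Ui, Uk, W).
     module.subspace s Ui \<and> module.subspace s Uk \<and>
     W \<in> extensional {1..m} \<and> (\<forall>\<beta>\<in>{1..m}. module.subspace (scale2 s) (W \<beta>)) \<and>
     snd ` W 1 \<subseteq> Ui \<and> snd ` W 1 \<subseteq> Uk \<and> Ui \<times> {0} \<subseteq> W 1 \<and> Uk \<times> {0} \<subseteq> W 1 \<and>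
     (\<forall>\<beta>\<in>{1..<m}. (fst ` W \<beta>) \<times> {0} \<subseteq> W (\<beta> + 1) \<and> {0} \<times> (snd ` W (\<beta> + 1)) \<subseteq> W \<beta>)}"

text \<open>The product of Grassmannians
  \<open>Gr(\<nu>\<^bsub>i\<^esub>, D) \<times> Gr(\<nu>\<^bsub>k\<^esub>, D) \<times> \<Prod>\<^bsub>\<beta>\<^esub> Gr(\<nu>\<^bsub>j\<^bsub>\<beta>\<^esub>\<^esub>, D \<oplus> D)\<close>.\<close>

definition Gr_product ::
  "('a::field \<Rightarrow> 'v::ab_group_add \<Rightarrow> 'v) \<Rightarrow> nat \<Rightarrow> (vertex \<Rightarrow> nat) \<Rightarrow> 'v point set" where
  "Gr_product s m \<nu> = {(Ui, Uk, W).
     module.subspace s Ui \<and> vector_space.dim s Ui = \<nu> Vi \<and>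
     module.subspace s Uk \<and> vector_space.dim s Uk = \<nu> Vk \<and>
     W \<in> extensional {1..m} \<and>
     (\<forall>\<beta>\<in>{1..m}. module.subspace (scale2 s) (W \<beta>) \<and>
                   vector_space.dim (scale2 s) (W \<beta>) = \<nu> (Vj \<beta>))}"

definition Y_nu ::
  "('a::field \<Rightarrow> 'v::ab_group_add \<Rightarrow> 'v) \<Rightarrow> nat \<Rightarrow> (vertex \<Rightarrow> nat) \<Rightarrow> 'v point set" where
  "Y_nu s m \<nu> = Y_variety s m \<inter> Gr_product s m \<nu>"

fun Psi2 :: "nat \<Rightarrow> 'v::zero point \<Rightarrow> 'v flag" where
  "Psi2 m (Ui, Uk, W) = (Ui, Uk, \<lambda>\<beta>\<in>{1..m}. {x. (x, 0) \<in> W \<beta>}, \<lambda>\<beta>\<in>{1..m}. snd ` W \<beta>)"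

definition Y_stratum ::
  "('a::field \<Rightarrow> 'v::ab_group_add \<Rightarrow> 'v) \<Rightarrow> nat \<Rightarrow> (vertex \<Rightarrow> nat) \<Rightarrow> (nat \<Rightarrow> nat) \<Rightarrow> 'v point set" where
  "Y_stratum s m \<nu> c = {y \<in> Y_variety s m. Psi2 m y \<in> X_stratum s m \<nu> c}"

subsection \<open>The Zariski topology\<close>

text \<open>Polynomial functions in variables \<open>'x\<close> that are homogeneous of degree \<open>e b\<close> in each block
  \<open>{x. blk x = b}\<close> of variables.\<close>

inductive multihomogeneous ::
  "('x \<Rightarrow> 'b) \<Rightarrow> ('b \<Rightarrow> nat) \<Rightarrow> (('x \<Rightarrow> 'a::field) \<Rightarrow> 'a) \<Rightarrow> bool" for blk where
  zero: "multihomogeneous blk e (\<lambda>_. 0)"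
| const: "multihomogeneous blk (\<lambda>_. 0) (\<lambda>_. a)"
| var: "multihomogeneous blk (\<lambda>b. if b = blk x then 1 else 0) (\<lambda>z. z x)"
| add: "multihomogeneous blk e f \<Longrightarrow> multihomogeneous blk e g \<Longrightarrow>
        multihomogeneous blk e (\<lambda>z. f z + g z)"
| mult: "multihomogeneous blk e f \<Longrightarrow> multihomogeneous blk e' g \<Longrightarrow>
        multihomogeneous blk (\<lambda>b. e b + e' b) (\<lambda>z. f z * g z)"

definition ordered_basis ::
  "('a::field \<Rightarrow> 'w::ab_group_add \<Rightarrow> 'w) \<Rightarrow> 'w set \<Rightarrow> 'w list \<Rightarrow> bool" where
  "ordered_basis s L bs \<longleftrightarrow>
     distinct bs \<and> \<not> module.dependent s (set bs) \<and> module.span s (set bs) = L"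

text \<open>Pluecker coordinates, with respect to a basis \<open>B\<close> of the ambient space, of the subspace with
  ordered basis \<open>bs\<close>.  They are indexed by all lists \<open>es\<close> of \<open>length bs\<close> basis vectors: permuting
  \<open>es\<close> only changes the sign and a repetition gives \<open>0\<close>, so this is the usual coordinate vector
  indexed by subsets of \<open>B\<close>, with redundant entries.\<close>

definition pluecker ::
  "('a::field \<Rightarrow> 'w::ab_group_add \<Rightarrow> 'w) \<Rightarrow> 'w set \<Rightarrow> 'w list \<Rightarrow> 'w list \<Rightarrow> 'a" where
  "pluecker s B bs es =
     (if length es = length bs \<and> set es \<subseteq> B
      then Determinant.det (mat (length bs) (length bs)
             (\<lambda>(p, q). module.representation s B (bs ! p) (es ! q)))
      else 0)"

text \<open>Homogeneous coordinates on the product of Grassmannians: one block for each vertex.\<close>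

datatype 'v coord = Ci "'v list" | Ck "'v list" | Cj nat "('v \<times> 'v) list"

fun coord_vertex :: "'v coord \<Rightarrow> vertex" where
  "coord_vertex (Ci _) = Vi"
| "coord_vertex (Ck _) = Vk"
| "coord_vertex (Cj \<beta> _) = Vj \<beta>"

type_synonym 'v frame = "'v list \<times> 'v list \<times> (nat \<Rightarrow> ('v \<times> 'v) list)"

fun is_frame ::
  "('a::field \<Rightarrow> 'v::ab_group_add \<Rightarrow> 'v) \<Rightarrow> nat \<Rightarrow> 'v point \<Rightarrow> 'v frame \<Rightarrow> bool" where
  "is_frame s m (Ui, Uk, W) (bi, bk, bj) \<longleftrightarrow>
     ordered_basis s Ui bi \<and> ordered_basis s Uk bk \<and>
     (\<forall>\<beta>\<in>{1..m}. ordered_basis (scale2 s) (W \<beta>) (bj \<beta>))"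

fun hcoords ::
  "('a::field \<Rightarrow> 'v::ab_group_add \<Rightarrow> 'v) \<Rightarrow> 'v set \<Rightarrow> nat \<Rightarrow> 'v frame \<Rightarrow> 'v coord \<Rightarrow> 'a" where
  "hcoords s B m (bi, bk, bj) (Ci es) = pluecker s B bi es"
| "hcoords s B m (bi, bk, bj) (Ck es) = pluecker s B bk es"
| "hcoords s B m (bi, bk, bj) (Cj \<beta> es) =
     (if \<beta> \<in> {1..m}
      then pluecker (scale2 s) (finite_dimensional_vector_space_prod.Basis_pair B B) (bj \<beta>) es
      else 0)"

text \<open>The principal open set where a multihomogeneous polynomial in the Pluecker coordinates does not
  vanish.  Changing the frame rescales each block of coordinates, so the condition
  does not depend on the frame.\<close>

definition principal_open ::
  "('a::field \<Rightarrow> 'v::ab_group_add \<Rightarrow> 'v) \<Rightarrow> 'v set \<Rightarrow> nat \<Rightarrow> (vertex \<Rightarrow> nat) \<Rightarrow>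
     (('v coord \<Rightarrow> 'a) \<Rightarrow> 'a) \<Rightarrow> 'v point set" where
  "principal_open s B m \<nu> f =
     {y \<in> Gr_product s m \<nu>. \<exists>fr. is_frame s m y fr \<and> f (hcoords s B m fr) \<noteq> 0}"

text \<open>The Zariski topology which the product of Grassmannians inherits from the product of the
  projective spaces of the Pluecker embeddings.  The principal open sets are closed under binary
  intersection, hence are a basis of it.\<close>

definition Gr_zariski ::
  "('a::field \<Rightarrow> 'v::ab_group_add \<Rightarrow> 'v) \<Rightarrow> 'v set \<Rightarrow> nat \<Rightarrow> (vertex \<Rightarrow> nat) \<Rightarrow> 'v point topology" where
  "Gr_zariski s B m \<nu> =
     topology_generated_by
       {principal_open s B m \<nu> f | f e. multihomogeneous coord_vertex e f}"

definition Y_zariski ::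
  "('a::field \<Rightarrow> 'v::ab_group_add \<Rightarrow> 'v) \<Rightarrow> 'v set \<Rightarrow> nat \<Rightarrow> (vertex \<Rightarrow> nat) \<Rightarrow> 'v point topology" where
  "Y_zariski s B m \<nu> = subtopology (Gr_zariski s B m \<nu>) (Y_nu s m \<nu>)"

end

theory Submission
  imports Defs
begin

text \<open>
  Write \<open>U\<^sub>\<beta> = {x. (x, 0) \<in> W \<beta>}\<close> and \<open>V\<^sub>\<beta> = snd ` W \<beta>\<close>, and let \<open>Y\<^sub>c\<close> be the stratum
  \<open>dim V\<^sub>\<beta> = c \<beta>\<close>.  The nonempty strata are finitely many and cover \<open>Y\<^sub>\<nu>\<close>.  So it is enough that each is
  irreducible and that none lies in the closure of another one
  (\<open>irreducible_components_eq_closures\<close>).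

  A set is irreducible as soon as any two of its points lie on a common irreducible subset, and
  rational curves will do.  A point of \<open>Y\<^sub>c\<close> is a flag \<open>V\<^sub>m \<subseteq> \<dots> \<subseteq> V\<^sub>1 \<subseteq> U\<^sub>1 \<subseteq> \<dots> \<subseteq> U\<^sub>m\<close>, two subspaces between
  \<open>V\<^sub>1\<close> and \<open>U\<^sub>1\<close>, and for each \<open>\<beta>\<close> a linear map \<open>V\<^sub>\<beta>/V\<^bsub>\<beta>+1\<^esub> \<rightarrow> U\<^bsub>\<beta>+1\<^esub>/U\<^sub>\<beta>\<close> of which \<open>W \<beta>\<close> is the graph.
  Given two points, choose an automorphism \<open>g\<close> that moves one flag to the other, automorphisms \<open>h\<close>, \<open>k\<close>
  that fix \<open>V\<^sub>1\<close> and preserve \<open>U\<^sub>1\<close> and move the two subspaces, and differences \<open>\<psi>\<^sub>\<beta>\<close> of the linear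
  maps.  Replacing \<open>g\<close> by \<open>(1 - t) id + t g\<close>, likewise \<open>h\<close> and \<open>k\<close>, and \<open>\<psi>\<^sub>\<beta>\<close> by \<open>t \<psi>\<^sub>\<beta>\<close> gives a curve that stays
  in \<open>Y\<^sub>c\<close> for all but finitely many \<open>t\<close> and has polynomial Pluecker coordinates.  Since the field is
  infinite, such a curve is irreducible (\<open>irreducible_in_polynomial_curve\<close>, \<open>irreducible_in_Y_stratum\<close>).

  For the second step there are three lower semicontinuous functions: \<open>dim V\<^sub>\<beta>\<close>, which is \<open>c \<beta>\<close> on \<open>Y\<^sub>c\<close>;
  the dimension of \<open>fst ` W \<beta>\<close>, which is at most \<open>min \<nu>\<^sub>\<beta> \<nu>\<^bsub>\<beta>+1\<^esub> - c (\<beta> + 1)\<close> on \<open>Y\<^sub>c\<close>; and the dimension of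
  \<open>U\<^sub>i + U\<^sub>k\<close>, which is at most \<open>min (\<nu>\<^sub>i + \<nu>\<^sub>k) \<nu>\<^sub>1 - c 1\<close> on \<open>Y\<^sub>c\<close>.  Both bounds are attained.  The point is that
  apart from \<open>c\<close> they only involve \<open>\<nu>\<close>: if \<open>Y\<^sub>c\<close> lies in the closure of \<open>Y\<^bsub>c'\<^esub>\<close>, the first function gives
  \<open>c \<le> c'\<close> and the other two give \<open>c' \<le> c\<close> (\<open>Y_stratum_separated\<close>).  Semicontinuity holds because a
  subspace is spanned by vectors whose entries are Pluecker coordinates (\<open>span_pluecker_vectors\<close>), so that
  the minors of these vectors are multihomogeneous (\<open>openin_dim_ge\<close>).
\<close>

section \<open>Independent lists and Pluecker coordinates\<close>

unbundle no vec_syntax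
no_notation vector_scalar_mult (infixl \<open>*s\<close> 70)
hide_const (open) Finite_Cartesian_Product.vec Determinants.det

lemma (in vector_space) independent_Un_disjoint_spans:
  assumes ind: "independent (A \<union> B)" and disj: "A \<inter> B = {}" and x: "x \<in> span A" "x \<in> span B"
  shows "x = 0"
proof -
  have A: "representation (A \<union> B) x = representation A x"
    by (rule representation_extend[OF ind x(1)]) simp
  have B: "representation (A \<union> B) x = representation B x"
    by (rule representation_extend[OF ind x(2)]) simp
  have "representation (A \<union> B) x b = 0" for b
    using representation_ne_zero[of A x b] representation_ne_zero[of B x b] A B disj by auto
  moreover have "x \<in> span (A \<union> B)" using x(1) span_mono[of A "A \<union> B"] by auto
  ultimately show ?thesis using sum_nonzero_representation_eq[OF ind] by force
qed

lemma (in vector_space) extend_to_basis: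
  assumes "independent B" "B \<subseteq> S" "subspace S"
  obtains C where "B \<subseteq> C" "C \<subseteq> S" "independent C" "span C = S"
proof -
  obtain C where "B \<subseteq> C" "C \<subseteq> S" "independent C" "S \<subseteq> span C"
    using maximal_independent_subset_extend[OF assms(2,1)] .
  then show thesis using that span_subspace[OF _ _ assms(3)] by metis
qed

text \<open>The vectors of Cramer's rule: \<open>z\<close> is meant to be the vector of Pluecker coordinates of a subspace \<open>L\<close>, and
  if \<open>z es \<noteq> 0\<close> then \<open>pluecker_vector s B z es q\<close>, divided by \<open>z es\<close>, is the vector of \<open>L\<close> that has coordinate
  \<open>1\<close> at \<open>es ! q\<close> and \<open>0\<close> at the other entries of \<open>es\<close>.\<close>

definition pluecker_vector ::
  "('a::field \<Rightarrow> 'w::ab_group_add \<Rightarrow> 'w) \<Rightarrow> 'w set \<Rightarrow> ('w list \<Rightarrow> 'a) \<Rightarrow> 'w list \<Rightarrow> nat \<Rightarrow> 'w" where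
  "pluecker_vector s B z es q = (\<Sum>b\<in>B. s (z (es[q := b])) b)"

context finite_dimensional_vector_space
begin

lemma distinct_independent_list_iff:
  "distinct vs \<and> independent (set vs) \<longleftrightarrow>
   (\<forall>c. (\<Sum>p<length vs. c p *s vs ! p) = 0 \<longrightarrow> (\<forall>p<length vs. c p = 0))" (is "?L \<longleftrightarrow> ?R")
proof
  assume L: ?L
  show ?R
  proof (intro allI impI)
    fix c p assume eq: "(\<Sum>p<length vs. c p *s vs ! p) = 0" and p: "p < length vs"
    have bij: "bij_betw ((!) vs) {..<length vs} (set vs)"
      using L by (auto intro!: bij_betw_nth)
    define u where "u v = c (the_inv_into {..<length vs} ((!) vs) v)" for v
    have u: "u (vs ! q) = c q" if "q < length vs" for q
      unfolding u_def using bij that by (subst the_inv_into_f_f) (auto simp: bij_betw_def)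
    have "(\<Sum>v\<in>set vs. u v *s v) = (\<Sum>q<length vs. u (vs ! q) *s vs ! q)"
      by (rule sum.reindex_bij_betw[OF bij, symmetric])
    also have "\<dots> = 0" using eq u by simp
    finally have "u (vs ! p) = 0"
      using L p independentD[of "set vs" "set vs" u "vs ! p"] by auto
    then show "c p = 0" using u p by simp
  qed
next
  assume R: ?R
  have dist: "distinct vs"
    unfolding distinct_conv_nth
  proof (intro allI impI)
    fix i j assume ij: "i < length vs" "j < length vs" "i \<noteq> j"
    show "vs ! i \<noteq> vs ! j"
    proof
      assume eq: "vs ! i = vs ! j"
      define c :: "nat \<Rightarrow> 'a" where "c q = (if q = i then 1 else 0) - (if q = j then 1 else 0)" for q
      have "(\<Sum>p<length vs. c p *s vs ! p) = vs ! i - vs ! j"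
        unfolding c_def scale_left_diff_distrib sum_subtractf
        using ij by (simp add: if_distrib[of "\<lambda>a. a *s _"] cong: if_cong)
      then have "c i = 0" using R eq ij by auto
      then show False using ij by (simp add: c_def)
    qed
  qed
  have bij: "bij_betw ((!) vs) {..<length vs} (set vs)"
    using dist by (auto intro!: bij_betw_nth)
  have "independent (set vs)"
  proof (rule independent_if_scalars_zero)
    show "finite (set vs)" by simp
    fix f x assume s: "(\<Sum>x\<in>set vs. f x *s x) = 0" and x: "x \<in> set vs"
    have "(\<Sum>q<length vs. f (vs ! q) *s vs ! q) = 0"
      using s sum.reindex_bij_betw[OF bij, of "\<lambda>x. f x *s x"] by simp
    then have "\<forall>q<length vs. f (vs ! q) = 0" using R[rule_format, of "\<lambda>q. f (vs ! q)"] by blast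
    then show "f x = 0" using x by (auto simp: in_set_conv_nth)
  qed
  with dist show ?L by blast
qed

lemma rep_sum: "(\<Sum>b\<in>Basis. representation Basis v b *s b) = v"
  using sum_representation_eq[OF independent_Basis _ finite_Basis] by (simp add: span_Basis)

lemma rep_add: "representation Basis (u + v) b = representation Basis u b + representation Basis v b"
  using representation_add[OF independent_Basis, of v u] by (simp add: span_Basis add.commute)

lemma rep_scale: "representation Basis (r *s v) b = r * representation Basis v b"
  using representation_scale[OF independent_Basis, of v r] by (simp add: span_Basis)

lemma rep_lincomb:
  "representation Basis (\<Sum>i\<in>I. c i *s v i) b = (\<Sum>i\<in>I. c i * representation Basis (v i) b)"
  using representation_sum[OF independent_Basis, of I "\<lambda>i. c i *s v i"]
  by (simp add: span_Basis rep_scale)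

lemma pluecker_nonzero_imp_independent:
  assumes "pluecker scale Basis vs es \<noteq> 0"
  shows "distinct vs \<and> independent (set vs)"
  unfolding distinct_independent_list_iff
proof (intro allI impI)
  fix c p assume eq: "(\<Sum>p<length vs. c p *s vs ! p) = 0" and p: "p < length vs"
  define n where "n = length vs"
  define M where "M = mat n n (\<lambda>(p, q). representation Basis (vs ! p) (es ! q))"
  have len: "length es = n" and det: "det M \<noteq> 0"
    using assms by (auto simp: pluecker_def n_def M_def split: if_splits)
  have "M\<^sup>T *\<^sub>v vec n c = 0\<^sub>v n"
  proof (rule eq_vecI)
    fix q assume "q < dim_vec (0\<^sub>v n :: 'a vec)"
    then have q: "q < n" by simp
    have "(M\<^sup>T *\<^sub>v vec n c) $ q = (\<Sum>p<n. representation Basis (vs ! p) (es ! q) * c p)"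
      using q by (simp add: M_def scalar_prod_def lessThan_atLeast0)
    also have "\<dots> = representation Basis (\<Sum>p<n. c p *s vs ! p) (es ! q)"
      by (simp add: rep_lincomb mult.commute)
    also have "\<dots> = 0" using eq by (simp add: n_def representation_zero)
    finally show "(M\<^sup>T *\<^sub>v vec n c) $ q = 0\<^sub>v n $ q" using q by simp
  qed (simp add: M_def)
  moreover have "det M\<^sup>T \<noteq> 0"
    using det det_transpose[of M n] by (simp add: M_def)
  moreover have "M\<^sup>T \<in> carrier_mat n n" "vec n c \<in> carrier_vec n" by (auto simp: M_def)
  ultimately have "vec n c = 0\<^sub>v n"
    using det_0_iff_vec_prod_zero_field[of "M\<^sup>T" n] by blast
  then have "vec n c $ p = 0\<^sub>v n $ p" by simp
  then show "c p = 0" using p by (simp add: n_def)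
qed

text \<open>Exchange: extend the list by basis vectors \<open>F\<close> to a basis of the whole space.  The minor whose columns
  are the remaining basis vectors is nonzero, since a combination of the list that vanishes there lies
  in the span of \<open>F\<close>.\<close>

lemma independent_imp_pluecker_nonzero:
  assumes dist: "distinct vs" and ind: "independent (set vs)"
  obtains es where "length es = length vs" "set es \<subseteq> Basis" "pluecker scale Basis vs es \<noteq> 0"
proof -
  obtain C where C: "set vs \<subseteq> C" "C \<subseteq> set vs \<union> Basis" "independent C" "set vs \<union> Basis \<subseteq> span C"
    using maximal_independent_subset_extend[of "set vs" "set vs \<union> Basis"] ind by auto
  have "span C = UNIV"
    using C(4) span_minimal[of Basis "span C"] span_Basis by auto
  then have cardC: "card C = card Basis"
    using dim_span_eq_card_independent[OF C(3)] by simp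
  have finC: "finite C" using C(3) finiteI_independent by blast
  define F where "F = C - set vs"
  have FB: "F \<subseteq> Basis" using C F_def by auto
  have cardF: "card F = card Basis - length vs" "length vs \<le> card Basis"
    using C(1) finC cardC dist distinct_card[OF dist] card_mono[OF finC C(1)]
    by (auto simp: F_def card_Diff_subset)
  have "card (Basis - F) = length vs"
    using cardF FB finite_Basis by (simp add: card_Diff_subset finite_subset[OF FB])
  then obtain es where es: "set es = Basis - F" "distinct es" "length es = length vs"
    using finite_distinct_list[of "Basis - F"] finite_Basis by (metis distinct_card finite_Diff)
  define n where "n = length vs"
  define M where "M = mat n n (\<lambda>(p, q). representation Basis (vs ! p) (es ! q))"
  have MT: "M\<^sup>T \<in> carrier_mat n n" by (simp add: M_def)
  have "det M\<^sup>T \<noteq> 0"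
  proof
    assume "det M\<^sup>T = 0"
    then obtain x where x: "x \<in> carrier_vec n" "x \<noteq> 0\<^sub>v n" "M\<^sup>T *\<^sub>v x = 0\<^sub>v n"
      using det_0_iff_vec_prod_zero_field[OF MT] by blast
    define w where "w = (\<Sum>p<n. x $ p *s vs ! p)"
    have w0: "representation Basis w b = 0" if b: "b \<in> Basis - F" for b
    proof -
      obtain q where q: "q < n" "b = es ! q" using b es n_def by (metis in_set_conv_nth)
      have "(M\<^sup>T *\<^sub>v x) $ q = (\<Sum>p<n. representation Basis (vs ! p) (es ! q) * x $ p)"
        using q x(1) by (simp add: M_def scalar_prod_def lessThan_atLeast0)
      then show ?thesis using x(3) q by (simp add: w_def rep_lincomb mult.commute)
    qed
    have "w = (\<Sum>b\<in>F. representation Basis w b *s b)"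
      by (subst rep_sum[of w, symmetric], rule sum.mono_neutral_right)
        (use FB finite_Basis w0 in auto)
    then have wF: "w \<in> span F"
      by (metis (mono_tags, lifting) span_base span_scale span_sum)
    have wV: "w \<in> span (set vs)"
      unfolding w_def n_def by (intro span_sum span_scale span_base) auto
    have "set vs \<union> F = C" "set vs \<inter> F = {}" using C(1) by (auto simp: F_def)
    then have "w = 0" using independent_Un_disjoint_spans[of "set vs" F w] C(3) wV wF by simp
    then have "\<forall>p<n. x $ p = 0"
      using distinct_independent_list_iff[of vs] dist ind by (simp add: w_def n_def)
    then have "x = 0\<^sub>v n" using x(1) by (intro eq_vecI) auto
    then show False using x(2) by blast
  qed
  then have "det M \<noteq> 0" using det_transpose[of M n] by (simp add: M_def)
  then have "pluecker scale Basis vs es \<noteq> 0"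
    using es by (auto simp: pluecker_def M_def n_def)
  then show thesis using that es by blast
qed

lemma ordered_basis_length: "ordered_basis scale L bs \<Longrightarrow> length bs = dim L"
  unfolding ordered_basis_def
  by (metis dim_eq_card_independent dim_span distinct_card)

lemma ordered_basis_exists:
  assumes "subspace L"
  obtains bs where "ordered_basis scale L bs"
proof -
  obtain C where C: "C \<subseteq> L" "independent C" "L \<subseteq> span C"
    using maximal_independent_subset[of L] by blast
  then have "span C = L" using assms by (simp add: span_subspace)
  moreover obtain bs where "set bs = C" "distinct bs"
    using finite_distinct_list[OF finiteI_independent[OF C(2)]] by blast
  ultimately have "ordered_basis scale L bs" using C by (simp add: ordered_basis_def)
  then show thesis using that by blast
qed

lemma in_span_set_conv_sum:
  assumes "v \<in> span (set vs)"
  obtains c where "v = (\<Sum>p<length vs. c p *s vs ! p)"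
proof -
  have "\<exists>c. v = (\<Sum>p<length vs. c p *s vs ! p)"
    using assms
  proof (induction rule: span_induct_alt)
    case base
    show ?case by (rule exI[of _ "\<lambda>_. 0"]) simp
  next
    case (step a x y)
    then obtain c where c: "y = (\<Sum>p<length vs. c p *s vs ! p)" by blast
    obtain r where r: "r < length vs" "vs ! r = x" using step by (auto simp: in_set_conv_nth)
    have "(\<Sum>p<length vs. (c p + (if p = r then a else 0)) *s vs ! p) =
      y + (\<Sum>p<length vs. (if p = r then a else 0) *s vs ! p)"
      by (simp add: c scale_left_distrib sum.distrib)
    also have "(\<Sum>p<length vs. (if p = r then a else 0) *s vs ! p) = a *s x"
      using r by (simp add: if_distrib[of "\<lambda>a. a *s _"] cong: if_cong)
    finally have "a *s x + y = (\<Sum>p<length vs. (c p + (if p = r then a else 0)) *s vs ! p)"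
      by (simp add: add.commute)
    then show ?case by (intro exI[of _ "\<lambda>p. c p + (if p = r then a else 0)"])
  qed
  then show thesis using that by blast
qed

text \<open>The factor is the determinant of the change of basis matrix.  It is nonzero because the second list has
  some nonzero Pluecker coordinate.\<close>

lemma pluecker_change_of_basis:
  assumes bs: "ordered_basis scale L bs" and bs': "ordered_basis scale L bs'"
  obtains l where "l \<noteq> 0" "\<And>es. pluecker scale Basis bs' es = l * pluecker scale Basis bs es"
proof -
  define n where "n = length bs"
  have n': "length bs' = n" using ordered_basis_length[OF bs] ordered_basis_length[OF bs'] n_def by simp
  have "\<exists>c. bs' ! p = (\<Sum>r<n. c r *s bs ! r)" if "p < n" for p
  proof -
    have "bs' ! p \<in> span (set bs)"
      using bs bs' that n' span_base[of "bs' ! p" "set bs'"] by (auto simp: ordered_basis_def)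
    then show ?thesis using in_span_set_conv_sum n_def by metis
  qed
  then obtain P where P: "\<And>p. p < n \<Longrightarrow> bs' ! p = (\<Sum>r<n. P p r *s bs ! r)" by metis
  define A where "A = mat n n (\<lambda>(p, r). P p r)"
  have eq: "pluecker scale Basis bs' es = det A * pluecker scale Basis bs es" for es
  proof (cases "length es = n \<and> set es \<subseteq> Basis")
    case True
    define M where "M = mat n n (\<lambda>(p, q). representation Basis (bs ! p) (es ! q))"
    have "mat n n (\<lambda>(p, q). representation Basis (bs' ! p) (es ! q)) = A * M"
      by (rule eq_matI) (auto simp: A_def M_def scalar_prod_def P rep_lincomb lessThan_atLeast0)
    then show ?thesis using True n' det_mult[of A n M]
      by (simp add: pluecker_def n_def[symmetric] M_def[symmetric]) (simp add: A_def M_def)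
  qed (use n' n_def in \<open>auto simp: pluecker_def\<close>)
  obtain es where "pluecker scale Basis bs' es \<noteq> 0"
    using independent_imp_pluecker_nonzero bs' unfolding ordered_basis_def by metis
  then have "det A \<noteq> 0" using eq by auto
  then show thesis using eq that by blast
qed

text \<open>Expanding the minors along column \<open>q\<close> shows that each of these vectors is a combination of \<open>bs\<close> with cofactors
  as coefficients.  At a nonvanishing minor the adjugate matrix inverts this relation.\<close>

lemma span_pluecker_vectors:
  assumes bs: "ordered_basis scale L bs"
  shows "span {pluecker_vector scale Basis (pluecker scale Basis bs) es q | es q.
    length es = dim L \<and> set es \<subseteq> Basis \<and> q < dim L} = L" (is "span ?P = L")
proof -
  define n where "n = dim L"
  have len: "length bs = n" using ordered_basis_length[OF bs] by (simp add: n_def)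
  define M where "M es = mat n n (\<lambda>(p, q). representation Basis (bs ! p) (es ! q))" for es
  have M[simp]: "M es \<in> carrier_mat n n" for es by (simp add: M_def)
  have pv: "pluecker_vector scale Basis (pluecker scale Basis bs) es q = (\<Sum>p<n. cofactor (M es) p q *s bs ! p)"
    if es: "length es = n" "set es \<subseteq> Basis" and q: "q < n" for es q
  proof -
    have "pluecker scale Basis bs (es[q := b]) =
        (\<Sum>p<n. representation Basis (bs ! p) b * cofactor (M es) p q)" if b: "b \<in> Basis" for b
    proof -
      have "pluecker scale Basis bs (es[q := b]) = det (M (es[q := b]))"
        using es b set_update_subset_insert[of es q b] len by (auto simp: pluecker_def M_def)
      also have "\<dots> = (\<Sum>p<n. M (es[q := b]) $$ (p, q) * cofactor (M (es[q := b])) p q)"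
        by (rule laplace_expansion_column) (use q in auto)
      also have "\<dots> = (\<Sum>p<n. representation Basis (bs ! p) b * cofactor (M es) p q)"
      proof (rule sum.cong[OF refl])
        fix p assume p: "p \<in> {..<n}"
        have "mat_delete (M (es[q := b])) p q = mat_delete (M es) p q"
          by (rule eq_matI) (use es q in \<open>auto simp: M_def mat_delete_def\<close>)
        then show "M (es[q := b]) $$ (p, q) * cofactor (M (es[q := b])) p q =
            representation Basis (bs ! p) b * cofactor (M es) p q"
          using p q es by (simp add: cofactor_def) (simp add: M_def)
      qed
      finally show ?thesis .
    qed
    then have "pluecker_vector scale Basis (pluecker scale Basis bs) es q =
        (\<Sum>b\<in>Basis. (\<Sum>p<n. representation Basis (bs ! p) b * cofactor (M es) p q) *s b)"
      by (simp add: pluecker_vector_def)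
    also have "\<dots> = (\<Sum>p<n. \<Sum>b\<in>Basis. cofactor (M es) p q *s representation Basis (bs ! p) b *s b)"
      by (simp add: scale_sum_left mult.commute) (rule sum.swap)
    also have "\<dots> = (\<Sum>p<n. cofactor (M es) p q *s bs ! p)"
      by (simp only: scale_sum_right[symmetric] rep_sum)
    finally show ?thesis .
  qed
  have L: "L = span (set bs)" using bs by (simp add: ordered_basis_def)
  show ?thesis
  proof
    have "?P \<subseteq> span (set bs)"
    proof clarify
      fix es q assume es: "length es = dim L" "set es \<subseteq> Basis" "q < dim L"
      then show "pluecker_vector scale Basis (pluecker scale Basis bs) es q \<in> span (set bs)"
        using len by (subst pv) (auto simp: n_def intro!: span_sum span_scale span_base[OF nth_mem])
    qed
    then show "span ?P \<subseteq> L" unfolding L by (intro span_minimal) auto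
    obtain es where es: "length es = n" "set es \<subseteq> Basis" "pluecker scale Basis bs es \<noteq> 0"
      using independent_imp_pluecker_nonzero bs len unfolding ordered_basis_def by metis
    then have det: "det (M es) \<noteq> 0" by (simp add: pluecker_def M_def len)
    have "bs ! p \<in> span ?P" if p: "p < n" for p
    proof -
      have *: "(\<Sum>q<n. M es $$ (p, q) * cofactor (M es) p' q) = (if p = p' then det (M es) else 0)"
        if p': "p' < n" for p'
      proof -
        have "(M es * adj_mat (M es)) $$ (p, p') = (\<Sum>q<n. M es $$ (p, q) * cofactor (M es) p' q)"
          using p p' by (auto simp: adj_mat_def scalar_prod_def lessThan_atLeast0 M_def intro!: sum.cong)
        then show ?thesis using adj_mat(2)[OF M, of es] p p' by (cases "p = p'") simp_all
      qed
      have "(\<Sum>q<n. M es $$ (p, q) *s pluecker_vector scale Basis (pluecker scale Basis bs) es q) =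
          (\<Sum>q<n. \<Sum>p'<n. (M es $$ (p, q) * cofactor (M es) p' q) *s bs ! p')"
        using es by (simp add: pv scale_sum_right)
      also have "\<dots> = (\<Sum>p'<n. (\<Sum>q<n. M es $$ (p, q) * cofactor (M es) p' q) *s bs ! p')"
        by (subst sum.swap) (simp add: scale_sum_left)
      also have "\<dots> = (\<Sum>p'<n. (if p = p' then det (M es) else 0) *s bs ! p')"
        using * by simp
      also have "\<dots> = det (M es) *s bs ! p"
        using p by (simp add: if_distrib[of "\<lambda>a. a *s _"] cong: if_cong)
      finally have "det (M es) *s bs ! p = (\<Sum>q<n. M es $$ (p, q) *s pluecker_vector scale Basis (pluecker scale Basis bs) es q)" ..
      also have "\<dots> \<in> span ?P"
        using es by (intro span_sum span_scale span_base) (auto simp: n_def)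
      finally have "inverse (det (M es)) *s det (M es) *s bs ! p \<in> span ?P" by (rule span_scale)
      then show ?thesis using det by simp
    qed
    then have "set bs \<subseteq> span ?P" using len by (auto simp: in_set_conv_nth)
    then show "L \<subseteq> span ?P" unfolding L by (intro span_minimal) auto
  qed
qed

end

section \<open>Multihomogeneous and one-variable polynomial functions\<close>

text \<open>The blocks may be infinitely many, hence the finite set \<open>S\<close> outside of which nothing is rescaled.\<close>

lemma multihomogeneous_scale:
  assumes "multihomogeneous blk e f" and "finite S" and "\<And>b. b \<notin> S \<Longrightarrow> l b = 1"
  shows "f (\<lambda>x. l (blk x) * z x) = (\<Prod>b\<in>S. l b ^ e b) * f z"
  using assms(1)
proof induction
  case (var x)
  show ?case
  proof (cases "blk x \<in> S")
    case True
    have "(\<Prod>b\<in>S. l b ^ (if b = blk x then 1 else 0)) = (\<Prod>b\<in>S. if b = blk x then l b else 1)"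
      by (rule prod.cong) auto
    then show ?thesis using True assms(2) by simp
  next
    case False
    then have "(\<Prod>b\<in>S. l b ^ (if b = blk x then 1 else 0)) = 1" by (intro prod.neutral) auto
    then show ?thesis using False assms(3) by simp
  qed
next
  case (mult e f e' g)
  then show ?case by (simp add: power_add prod.distrib mult_ac)
qed (simp_all add: algebra_simps)

lemma multihomogeneous_sum:
  "(\<And>i. i \<in> I \<Longrightarrow> multihomogeneous blk e (f i)) \<Longrightarrow> multihomogeneous blk e (\<lambda>z. \<Sum>i\<in>I. f i z)"
  by (induction I rule: infinite_finite_induct) (auto intro: multihomogeneous.intros)

lemma multihomogeneous_prod:
  assumes "finite I" "\<And>i. i \<in> I \<Longrightarrow> multihomogeneous blk (e i) (f i)"
  shows "multihomogeneous blk (\<lambda>b. \<Sum>i\<in>I. e i b) (\<lambda>z. \<Prod>i\<in>I. f i z)"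
  using assms
  by (induction I) (auto intro: multihomogeneous.intros)

lemma multihomogeneous_cmult:
  assumes "multihomogeneous blk e f"
  shows "multihomogeneous blk e (\<lambda>z. a * f z)"
  using multihomogeneous.mult[OF multihomogeneous.const assms] by simp

lemma multihomogeneous_det:
  assumes "\<And>p q. p < n \<Longrightarrow> q < n \<Longrightarrow> multihomogeneous blk (e p) (f p q)"
  shows "multihomogeneous blk (\<lambda>b. \<Sum>p<n. e p b) (\<lambda>z. Determinant.det (mat n n (\<lambda>(p, q). f p q z)))"
proof -
  have "Determinant.det (mat n n (\<lambda>(p, q). f p q z)) =
      (\<Sum>\<pi>\<in>{\<pi>. \<pi> permutes {0..<n}}. signof \<pi> * (\<Prod>p<n. f p (\<pi> p) z))" for z
    by (subst det_def') (auto intro!: sum.cong prod.cong simp: lessThan_atLeast0 permutes_in_image)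
  moreover have "multihomogeneous blk (\<lambda>b. \<Sum>p<n. e p b)
      (\<lambda>z. \<Sum>\<pi>\<in>{\<pi>. \<pi> permutes {0..<n}}. signof \<pi> * (\<Prod>p<n. f p (\<pi> p) z))"
    by (intro multihomogeneous_sum multihomogeneous_cmult multihomogeneous_prod assms)
      (auto dest: permutes_in_image[of _ "{0..<n}"])
  ultimately show ?thesis by simp
qed

definition univariate_polynomial :: "('a::comm_ring_1 \<Rightarrow> 'a) \<Rightarrow> bool" where
  "univariate_polynomial f \<longleftrightarrow> (\<exists>p. \<forall>t. f t = poly p t)"

lemma univariate_polynomial_const [intro, simp]: "univariate_polynomial (\<lambda>_. a)"
  unfolding univariate_polynomial_def by (rule exI[of _ "[:a:]"]) simp

lemma univariate_polynomial_ident [intro, simp]: "univariate_polynomial (\<lambda>t. t)"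
  unfolding univariate_polynomial_def by (rule exI[of _ "[:0, 1:]"]) simp

lemma univariate_polynomial_add [intro]:
  "univariate_polynomial f \<Longrightarrow> univariate_polynomial g \<Longrightarrow> univariate_polynomial (\<lambda>t. f t + g t)"
  unfolding univariate_polynomial_def by (metis poly_add)

lemma univariate_polynomial_mult [intro]:
  "univariate_polynomial f \<Longrightarrow> univariate_polynomial g \<Longrightarrow> univariate_polynomial (\<lambda>t. f t * g t)"
  unfolding univariate_polynomial_def by (metis poly_mult)

lemma univariate_polynomial_diff [intro]:
  "univariate_polynomial f \<Longrightarrow> univariate_polynomial g \<Longrightarrow> univariate_polynomial (\<lambda>t. f t - g t)"
  unfolding univariate_polynomial_def by (metis poly_diff)

lemma univariate_polynomial_sum [intro]:
  "(\<And>i. i \<in> I \<Longrightarrow> univariate_polynomial (f i)) \<Longrightarrow> univariate_polynomial (\<lambda>t. \<Sum>i\<in>I. f i t)"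
  by (induction I rule: infinite_finite_induct) auto

lemma univariate_polynomial_prod [intro]:
  "(\<And>i. i \<in> I \<Longrightarrow> univariate_polynomial (f i)) \<Longrightarrow> univariate_polynomial (\<lambda>t. \<Prod>i\<in>I. f i t)"
  by (induction I rule: infinite_finite_induct) auto

lemma univariate_polynomial_det:
  assumes "\<And>p q. p < n \<Longrightarrow> q < n \<Longrightarrow> univariate_polynomial (f p q)"
  shows "univariate_polynomial (\<lambda>t. Determinant.det (mat n n (\<lambda>(p, q). f p q t)))"
proof -
  have "Determinant.det (mat n n (\<lambda>(p, q). f p q t)) =
      (\<Sum>\<pi>\<in>{\<pi>. \<pi> permutes {0..<n}}. signof \<pi> * (\<Prod>p<n. f p (\<pi> p) t))" for t
    by (subst det_def') (auto intro!: sum.cong prod.cong simp: lessThan_atLeast0 permutes_in_image)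
  moreover have "univariate_polynomial
      (\<lambda>t. \<Sum>\<pi>\<in>{\<pi>. \<pi> permutes {0..<n}}. signof \<pi> * (\<Prod>p<n. f p (\<pi> p) t))"
    by (intro univariate_polynomial_sum univariate_polynomial_mult univariate_polynomial_prod assms
      univariate_polynomial_const) (auto dest: permutes_in_image[of _ "{0..<n}"])
  ultimately show ?thesis by simp
qed

lemma univariate_polynomial_multihomogeneous:
  assumes "multihomogeneous blk e f" and "\<And>x. univariate_polynomial (\<lambda>t. z t x)"
  shows "univariate_polynomial (\<lambda>t. f (z t))"
  using assms(1) by induction (auto intro: assms(2))

lemma finite_zeros_univariate_polynomial:
  fixes f :: "'a::idom \<Rightarrow> 'a"
  assumes "univariate_polynomial f" and "f t0 \<noteq> 0"
  shows "finite {t. f t = 0}"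
proof -
  obtain p where p: "\<And>t. f t = poly p t" using assms(1) by (auto simp: univariate_polynomial_def)
  then have "p \<noteq> 0" using assms(2) by auto
  then show ?thesis using poly_roots_finite p by simp
qed

text \<open>Otherwise \<open>\<Prod>a. (X - a) + 1\<close> would have no root.\<close>

lemma infinite_alg_closed_field: "infinite (UNIV :: 'a::alg_closed_field set)"
proof
  assume fin: "finite (UNIV :: 'a set)"
  define p :: "'a poly" where "p = (\<Prod>a\<in>UNIV. [:-a, 1:]) + 1"
  have "degree (\<Prod>a\<in>(UNIV::'a set). [:-a, 1:]) = card (UNIV :: 'a set)"
    by (subst degree_prod_eq_sum_degree) auto
  moreover have "card (UNIV :: 'a set) > 0" using fin by (simp add: card_gt_0_iff)
  ultimately have "degree p > 0"
    unfolding p_def by (subst degree_add_eq_left) auto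
  then obtain x where "poly p x = 0" using alg_closed_imp_poly_has_root by blast
  moreover have "(\<Prod>a\<in>(UNIV::'a set). x - a) = 0"
    using fin by (intro prod_zero) auto
  ultimately show False by (simp add: p_def poly_prod)
qed

section \<open>Irreducible sets and irreducible components\<close>

text \<open>This reduces irreducibility to connecting two points at a time: a cover by two closed sets of which
  neither suffices would separate a pair of points.\<close>

lemma irreducible_in_of_pairs:
  assumes "S \<subseteq> topspace X" "S \<noteq> {}"
    and "\<And>x y. x \<in> S \<Longrightarrow> y \<in> S \<Longrightarrow> \<exists>T\<subseteq>S. x \<in> T \<and> y \<in> T \<and> irreducible_in X T"
  shows "irreducible_in X S"
  unfolding irreducible_in_def
proof (intro conjI allI impI assms)
  fix C1 C2 assume C: "closedin X C1 \<and> closedin X C2 \<and> S \<subseteq> C1 \<union> C2"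
  show "S \<subseteq> C1 \<or> S \<subseteq> C2"
  proof (rule ccontr)
    assume "\<not> (S \<subseteq> C1 \<or> S \<subseteq> C2)"
    then obtain x y where xy: "x \<in> S" "x \<notin> C1" "y \<in> S" "y \<notin> C2" by blast
    then obtain T where T: "T \<subseteq> S" "x \<in> T" "y \<in> T" "irreducible_in X T" using assms(3) by metis
    have "T \<subseteq> C1 \<union> C2" using C T(1) by auto
    then have "T \<subseteq> C1 \<or> T \<subseteq> C2" using T(4) C unfolding irreducible_in_def by simp
    then show False using xy T by auto
  qed
qed

lemma irreducible_in_closure_of:
  assumes "irreducible_in X S"
  shows "irreducible_in X (X closure_of S)"
  unfolding irreducible_in_def
proof (intro conjI allI impI)
  have S: "S \<subseteq> topspace X" "S \<noteq> {}" using assms by (auto simp: irreducible_in_def)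
  show "X closure_of S \<subseteq> topspace X" by (rule closure_of_subset_topspace)
  have sub: "S \<subseteq> X closure_of S" using S by (intro closure_of_subset)
  then show "X closure_of S \<noteq> {}" using S by blast
  fix C1 C2 assume C: "closedin X C1 \<and> closedin X C2 \<and> X closure_of S \<subseteq> C1 \<union> C2"
  then have "S \<subseteq> C1 \<or> S \<subseteq> C2"
    using assms sub unfolding irreducible_in_def by (meson order_trans)
  then show "X closure_of S \<subseteq> C1 \<or> X closure_of S \<subseteq> C2"
    using C closure_of_minimal by metis
qed

lemma irreducible_in_subset_Union:
  assumes T: "irreducible_in X T" and "finite F" and "\<And>C. C \<in> F \<Longrightarrow> closedin X C" and "T \<subseteq> \<Union>F"
  shows "\<exists>C\<in>F. T \<subseteq> C"
  using assms(2-4)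
proof (induction F)
  case empty
  then show ?case using T by (auto simp: irreducible_in_def)
next
  case (insert C F)
  have "closedin X (\<Union>F)" using insert by (intro closedin_Union) auto
  then have "T \<subseteq> C \<or> T \<subseteq> \<Union>F"
    using T insert.prems unfolding irreducible_in_def by auto
  then show ?case using insert by blast
qed

text \<open>An irreducible set lies in one of finitely many closed sets that cover it, so the maximal irreducible sets
  are found among the closures.\<close>

lemma irreducible_components_eq_closures:
  assumes fin: "finite F" and irr: "\<And>S. S \<in> F \<Longrightarrow> irreducible_in X S" and cover: "topspace X = \<Union>F"
    and sep: "\<And>S S'. S \<in> F \<Longrightarrow> S' \<in> F \<Longrightarrow> S \<subseteq> X closure_of S' \<Longrightarrow> S = S'"
  shows "irreducible_components X = (closure_of) X ` F"
proof -
  have sub: "S \<subseteq> X closure_of S" if "S \<in> F" for S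
    using irr[OF that] by (auto simp: irreducible_in_def closure_of_subset)
  have ex: "\<exists>S\<in>F. T \<subseteq> X closure_of S" if T: "irreducible_in X T" for T
  proof -
    have "T \<subseteq> \<Union>F" using T cover by (simp add: irreducible_in_def)
    also have "\<dots> \<subseteq> \<Union>((closure_of) X ` F)" using sub by (intro Union_least) (meson UN_upper order_trans)
    finally have "T \<subseteq> \<Union>((closure_of) X ` F)" .
    then show ?thesis
      using irreducible_in_subset_Union[OF T, of "(closure_of) X ` F"] fin
      by (metis (no_types, lifting) closedin_closure_of finite_imageI imageE)
  qed
  show ?thesis
  proof (intro equalityI subsetI)
    fix T assume "T \<in> irreducible_components X"
    then have T: "irreducible_in X T" "\<And>T'. irreducible_in X T' \<Longrightarrow> T \<subseteq> T' \<Longrightarrow> T' = T"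
      by (auto simp: irreducible_components_def)
    obtain S where S: "S \<in> F" "T \<subseteq> X closure_of S" using ex[OF T(1)] by blast
    have "X closure_of S = T" by (rule T(2)[OF irreducible_in_closure_of[OF irr[OF S(1)]] S(2)])
    then show "T \<in> (closure_of) X ` F" using S(1) by blast
  next
    fix C assume "C \<in> (closure_of) X ` F"
    then obtain S where S: "S \<in> F" "C = X closure_of S" by blast
    have "T = C" if T: "irreducible_in X T" "C \<subseteq> T" for T
    proof -
      obtain S' where S': "S' \<in> F" "T \<subseteq> X closure_of S'" using ex[OF T(1)] by blast
      then have "S \<subseteq> X closure_of S'" using sub[OF S(1)] T S by blast
      then show ?thesis using sep[OF S(1) S'(1)] S S' T by blast
    qed
    then show "C \<in> irreducible_components X"
      using irreducible_in_closure_of[OF irr[OF S(1)]] S by (simp add: irreducible_components_def)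
  qed
qed

lemma irreducible_in_subtopology:
  assumes "irreducible_in X S" "S \<subseteq> Y"
  shows "irreducible_in (subtopology X Y) S"
  unfolding irreducible_in_def
proof (intro conjI allI impI)
  show "S \<subseteq> topspace (subtopology X Y)" "S \<noteq> {}"
    using assms by (auto simp: irreducible_in_def)
  fix C1 C2
  assume C: "closedin (subtopology X Y) C1 \<and> closedin (subtopology X Y) C2 \<and> S \<subseteq> C1 \<union> C2"
  then obtain D1 D2 where D: "closedin X D1" "C1 = D1 \<inter> Y" "closedin X D2" "C2 = D2 \<inter> Y"
    by (auto simp: closedin_subtopology)
  then have "S \<subseteq> D1 \<or> S \<subseteq> D2"
    using C assms(1) unfolding irreducible_in_def by (metis Int_Un_distrib2 le_inf_iff)
  then show "S \<subseteq> C1 \<or> S \<subseteq> C2"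
    using D assms(2) by auto
qed

text \<open>The sets whose preimage in \<open>T\<close> is empty or cofinite are stable under finite intersections and arbitrary
  unions, so it is enough to look at generators; two nonempty cofinite subsets of an infinite set meet.\<close>

lemma irreducible_in_generated_image:
  assumes T: "infinite T" and sub: "F ` T \<subseteq> \<Union>G"
    and G: "\<And>A. A \<in> G \<Longrightarrow> {t\<in>T. F t \<in> A} = {} \<or> finite {t\<in>T. F t \<notin> A}"
  shows "irreducible_in (topology_generated_by G) (F ` T)"
proof -
  have cof: "{t\<in>T. F t \<in> A} = {} \<or> finite {t\<in>T. F t \<notin> A}"
    if "generate_topology_on G A" for A
    using that
  proof induction
    case (Int a b)
    have "{t\<in>T. F t \<notin> a \<inter> b} = {t\<in>T. F t \<notin> a} \<union> {t\<in>T. F t \<notin> b}" by blast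
    then show ?case using Int.IH by auto
  next
    case (UN K)
    show ?case
    proof (cases "{t\<in>T. F t \<in> \<Union>K} = {}")
      case False
      then obtain k where k: "k \<in> K" "{t\<in>T. F t \<in> k} \<noteq> {}" by blast
      then have "finite {t\<in>T. F t \<notin> k}" using UN.IH by blast
      moreover have "{t\<in>T. F t \<notin> \<Union>K} \<subseteq> {t\<in>T. F t \<notin> k}" using k by blast
      ultimately show ?thesis by (meson finite_subset)
    qed simp
  qed (use G in auto)
  let ?X = "topology_generated_by G"
  show ?thesis
    unfolding irreducible_in_def
  proof (intro conjI allI impI)
    show "F ` T \<subseteq> topspace ?X" using sub by (simp add: topology_generated_by_topspace)
    show "F ` T \<noteq> {}" using T by auto
    fix C1 C2 assume C: "closedin ?X C1 \<and> closedin ?X C2 \<and> F ` T \<subseteq> C1 \<union> C2"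
    show "F ` T \<subseteq> C1 \<or> F ` T \<subseteq> C2"
    proof (rule ccontr)
      assume contr: "\<not> (F ` T \<subseteq> C1 \<or> F ` T \<subseteq> C2)"
      have *: "finite {t\<in>T. F t \<in> C}" if "closedin ?X C" "\<not> F ` T \<subseteq> C" for C
      proof -
        have "openin ?X (topspace ?X - C)" using that by blast
        then have "generate_topology_on G (topspace ?X - C)"
          by (simp only: openin_topology_generated_by_iff)
        from cof[OF this] have "finite {t\<in>T. F t \<notin> topspace ?X - C}"
          using that sub by (auto simp: topology_generated_by_topspace)
        then show ?thesis by (rule finite_subset[rotated]) auto
      qed
      have "T \<subseteq> {t\<in>T. F t \<in> C1} \<union> {t\<in>T. F t \<in> C2}" using C by auto
      then show False using * C contr T by (meson finite_UnI finite_subset)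
    qed
  qed
qed

section \<open>The Zariski topology on the product of Grassmannians\<close>

lemma image_Collect2: "h ` {g a b | a b. P a b} = {h (g a b) | a b. P a b}"
  by blast

locale doubled_space = finite_dimensional_vector_space scale Basis
  for scale :: "'a::field \<Rightarrow> 'v::ab_group_add \<Rightarrow> 'v" and Basis :: "'v set"
begin

sublocale dd: finite_dimensional_vector_space_prod scale scale Basis Basis
  by unfold_locales

lemma Gr_product_frame_exists:
  assumes "y \<in> Gr_product scale m \<nu>"
  obtains fr where "is_frame scale m y fr"
proof -
  obtain Ui Uk W where y: "y = (Ui, Uk, W)" by (cases y) auto
  obtain bi where bi: "ordered_basis scale Ui bi"
    using ordered_basis_exists assms y by (auto simp: Gr_product_def)
  obtain bk where bk: "ordered_basis scale Uk bk"
    using ordered_basis_exists assms y by (auto simp: Gr_product_def)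
  have "\<forall>\<beta>\<in>{1..m}. \<exists>b. ordered_basis dd.scale (W \<beta>) b"
  proof
    fix \<beta> assume "\<beta> \<in> {1..m}"
    then have "dd.p.subspace (W \<beta>)" using assms y by (auto simp: Gr_product_def)
    then show "\<exists>b. ordered_basis dd.scale (W \<beta>) b" by (rule dd.p.ordered_basis_exists) blast
  qed
  then obtain bj where "\<forall>\<beta>\<in>{1..m}. ordered_basis dd.scale (W \<beta>) (bj \<beta>)" by metis
  then have "is_frame scale m y (bi, bk, bj)" using y bi bk by simp
  then show thesis using that by blast
qed

text \<open>Each vertex contributes its own scalar; the vertices that index no subspace contribute \<open>1\<close>.\<close>

lemma hcoords_change_of_frame:
  assumes "is_frame scale m y fr" "is_frame scale m y fr'"
  obtains l S where "finite S" "\<And>v. l v \<noteq> 0" "\<And>v. v \<notin> S \<Longrightarrow> l v = 1"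
    "hcoords scale Basis m fr' = (\<lambda>x. l (coord_vertex x) * hcoords scale Basis m fr x)"
proof -
  obtain Ui Uk W where y: "y = (Ui, Uk, W)" by (cases y) auto
  obtain bi bk bj where fr: "fr = (bi, bk, bj)" by (cases fr) auto
  obtain bi' bk' bj' where fr': "fr' = (bi', bk', bj')" by (cases fr') auto
  obtain li where li: "li \<noteq> 0" "\<And>es. pluecker scale Basis bi' es = li * pluecker scale Basis bi es"
    using pluecker_change_of_basis assms y fr fr' by (metis is_frame.simps)
  obtain lk where lk: "lk \<noteq> 0" "\<And>es. pluecker scale Basis bk' es = lk * pluecker scale Basis bk es"
    using pluecker_change_of_basis assms y fr fr' by (metis is_frame.simps)
  have "\<exists>l. l \<noteq> 0 \<and> (\<forall>es. pluecker dd.scale dd.Basis_pair (bj' \<beta>) es = l * pluecker dd.scale dd.Basis_pair (bj \<beta>) es)"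
    if "\<beta> \<in> {1..m}" for \<beta>
    using dd.p.pluecker_change_of_basis[of "W \<beta>" "bj \<beta>" "bj' \<beta>"] assms y fr fr' that
    by (metis is_frame.simps)
  then obtain lj where lj: "\<And>\<beta>. \<beta> \<in> {1..m} \<Longrightarrow> lj \<beta> \<noteq> 0 \<and>
      (\<forall>es. pluecker dd.scale dd.Basis_pair (bj' \<beta>) es = lj \<beta> * pluecker dd.scale dd.Basis_pair (bj \<beta>) es)"
    by metis
  define l where "l v = (case v of Vi \<Rightarrow> li | Vk \<Rightarrow> lk | Vj \<beta> \<Rightarrow> if \<beta> \<in> {1..m} then lj \<beta> else 1)" for v
  show thesis
  proof
    show "finite ({Vi, Vk} \<union> Vj ` {1..m})" by simp
    show "l v \<noteq> 0" for v using li lk lj by (auto simp: l_def split: vertex.splits)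
    show "l v = 1" if "v \<notin> {Vi, Vk} \<union> Vj ` {1..m}" for v
      using that by (auto simp: l_def split: vertex.splits)
    show "hcoords scale Basis m fr' = (\<lambda>x. l (coord_vertex x) * hcoords scale Basis m fr x)"
    proof
      fix x show "hcoords scale Basis m fr' x = l (coord_vertex x) * hcoords scale Basis m fr x"
        by (cases x) (use li lk lj in \<open>auto simp: fr fr' l_def\<close>)
    qed
  qed
qed

lemma principal_open_iff_frame:
  assumes y: "y \<in> Gr_product scale m \<nu>" and fr: "is_frame scale m y fr"
    and f: "multihomogeneous coord_vertex e f"
  shows "y \<in> principal_open scale Basis m \<nu> f \<longleftrightarrow> f (hcoords scale Basis m fr) \<noteq> 0"
proof
  assume "y \<in> principal_open scale Basis m \<nu> f"
  then obtain fr' where fr': "is_frame scale m y fr'" "f (hcoords scale Basis m fr') \<noteq> 0"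
    by (auto simp: principal_open_def)
  obtain S l where l: "finite S" "\<And>v. l v \<noteq> 0" "\<And>v. v \<notin> S \<Longrightarrow> l v = 1"
    "hcoords scale Basis m fr' = (\<lambda>x. l (coord_vertex x) * hcoords scale Basis m fr x)"
    by (rule hcoords_change_of_frame[OF fr fr'(1)]) blast
  have "f (hcoords scale Basis m fr') = (\<Prod>b\<in>S. l b ^ e b) * f (hcoords scale Basis m fr)"
    unfolding l(4) by (rule multihomogeneous_scale[OF f l(1,3)])
  then show "f (hcoords scale Basis m fr) \<noteq> 0" using fr'(2) by auto
next
  assume "f (hcoords scale Basis m fr) \<noteq> 0"
  then show "y \<in> principal_open scale Basis m \<nu> f"
    unfolding principal_open_def by (intro CollectI conjI y exI[of _ fr] fr)
qed

lemma Gr_product_subset_Union_principal_open: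
  "Gr_product scale m \<nu> \<subseteq> \<Union>{principal_open scale Basis m \<nu> f | f e. multihomogeneous coord_vertex e f}"
proof
  fix y assume y: "y \<in> Gr_product scale m \<nu>"
  obtain fr where fr: "is_frame scale m y fr" using Gr_product_frame_exists[OF y] .
  have "y \<in> principal_open scale Basis m \<nu> (\<lambda>_. 1)"
    unfolding principal_open_def by (intro CollectI conjI y exI[of _ fr] fr) simp
  moreover have "multihomogeneous coord_vertex (\<lambda>_. 0) (\<lambda>_. 1 :: 'a)" by (rule multihomogeneous.const)
  ultimately show "y \<in> \<Union>{principal_open scale Basis m \<nu> f | f e. multihomogeneous coord_vertex e f}"
    by blast
qed

lemma topspace_Gr_zariski: "topspace (Gr_zariski scale Basis m \<nu>) = Gr_product scale m \<nu>"
  unfolding Gr_zariski_def topology_generated_by_topspace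
proof (rule equalityI[OF _ Gr_product_subset_Union_principal_open])
  show "\<Union>{principal_open scale Basis m \<nu> f | f e. multihomogeneous coord_vertex e f} \<subseteq> Gr_product scale m \<nu>"
    unfolding principal_open_def by blast
qed

lemma topspace_Y_zariski: "topspace (Y_zariski scale Basis m \<nu>) = Y_nu scale m \<nu>"
  unfolding Y_zariski_def topspace_subtopology topspace_Gr_zariski by (auto simp: Y_nu_def)

lemma openin_principal_open:
  "multihomogeneous coord_vertex e f \<Longrightarrow>
    openin (Gr_zariski scale Basis m \<nu>) (principal_open scale Basis m \<nu> f)"
  unfolding Gr_zariski_def by (rule topology_generated_by_Basis) auto

text \<open>Along the curve, a multihomogeneous function of the coordinates is a polynomial in \<open>t\<close>, so it vanishes
  everywhere or at finitely many \<open>t\<close>.\<close>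

lemma irreducible_in_polynomial_curve:
  assumes T: "infinite T" and F: "\<And>t. t \<in> T \<Longrightarrow> F t \<in> Gr_product scale m \<nu>"
    and fr: "\<And>t. t \<in> T \<Longrightarrow> is_frame scale m (F t) (fr t)"
    and poly: "\<And>x. univariate_polynomial (\<lambda>t. hcoords scale Basis m (fr t) x)"
  shows "irreducible_in (Gr_zariski scale Basis m \<nu>) (F ` T)"
  unfolding Gr_zariski_def
proof (rule irreducible_in_generated_image[OF T])
  show "F ` T \<subseteq> \<Union>{principal_open scale Basis m \<nu> f | f e. multihomogeneous coord_vertex e f}"
    using F Gr_product_subset_Union_principal_open by blast
  fix A assume "A \<in> {principal_open scale Basis m \<nu> f | f e. multihomogeneous coord_vertex e f}"
  then obtain e f where f: "multihomogeneous coord_vertex e f" and A: "A = principal_open scale Basis m \<nu> f"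
    by blast
  have iff: "F t \<in> A \<longleftrightarrow> f (hcoords scale Basis m (fr t)) \<noteq> 0" if "t \<in> T" for t
    unfolding A using principal_open_iff_frame[OF F[OF that] fr[OF that] f] .
  have pf: "univariate_polynomial (\<lambda>t. f (hcoords scale Basis m (fr t)))"
    by (rule univariate_polynomial_multihomogeneous[OF f poly])
  show "{t\<in>T. F t \<in> A} = {} \<or> finite {t\<in>T. F t \<notin> A}"
  proof (cases "{t\<in>T. F t \<in> A} = {}")
    case False
    then obtain t0 where "t0 \<in> T" "F t0 \<in> A" by blast
    then have "finite {t. f (hcoords scale Basis m (fr t)) = 0}"
      using finite_zeros_univariate_polynomial[OF pf] iff by blast
    then show ?thesis by (rule_tac disjI2, rule finite_subset[rotated]) (use iff in auto)
  qed simp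
qed

text \<open>The source of lower semicontinuity.  If the space attached to a point is spanned by vectors that depend
  multihomogeneously on the coordinates, then dimension at least \<open>R\<close> means that some \<open>R\<close>-minor of \<open>R\<close> of
  these vectors does not vanish.  The degree may differ from vector to vector.\<close>

lemma openin_dim_ge:
  assumes hom: "\<And>v. v \<in> \<V> \<Longrightarrow> \<exists>e. \<forall>b\<in>Basis. multihomogeneous coord_vertex e (\<lambda>z. representation Basis (v z) b)"
    and d: "\<And>y fr. y \<in> Gr_product scale m \<nu> \<Longrightarrow> is_frame scale m y fr \<Longrightarrow>
      dim ((\<lambda>v. v (hcoords scale Basis m fr)) ` \<V>) = d y"
  shows "openin (Gr_zariski scale Basis m \<nu>) {y \<in> Gr_product scale m \<nu>. R \<le> d y}" (is "openin ?X ?A")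
proof (subst openin_subopen, intro ballI)
  fix y assume "y \<in> ?A"
  then have y: "y \<in> Gr_product scale m \<nu>" "R \<le> d y" by auto
  obtain fr where fr: "is_frame scale m y fr" using Gr_product_frame_exists[OF y(1)] .
  define z where "z = hcoords scale Basis m fr"
  obtain C where C: "C \<subseteq> (\<lambda>v. v z) ` \<V>" "independent C" "card C = d y"
    using basis_exists[of "(\<lambda>v. v z) ` \<V>"] d[OF y(1) fr, folded z_def] by metis
  obtain C' where C': "C' \<subseteq> C" "card C' = R" "finite C'"
    using obtain_subset_with_card_n[of R C] y(2) C(3) by metis
  obtain ws where ws: "set ws = C'" "distinct ws" using finite_distinct_list[OF C'(3)] by blast
  then have "set ws \<subseteq> (\<lambda>v. v z) ` \<V>" using C C' by blast
  then have "\<exists>vs. set vs \<subseteq> \<V> \<and> ws = map (\<lambda>v. v z) vs"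
  proof (induction ws)
    case (Cons w ws)
    then obtain v vs where "v \<in> \<V>" "w = v z" "set vs \<subseteq> \<V>" "ws = map (\<lambda>v. v z) vs" by auto
    then show ?case by (intro exI[of _ "v # vs"]) auto
  qed simp
  then obtain vs where vs: "set vs \<subseteq> \<V>" "ws = map (\<lambda>v. v z) vs" by blast
  have len: "length vs = R"
    using ws C' vs distinct_card[of ws] by simp
  have "independent (set ws)" using C(2) C'(1) ws(1) independent_mono by blast
  then obtain es where es: "length es = length ws" "set es \<subseteq> Basis" "pluecker scale Basis ws es \<noteq> 0"
    using independent_imp_pluecker_nonzero ws(2) by blast
  define f where "f z = pluecker scale Basis (map (\<lambda>v. v z) vs) es" for z
  obtain e where e: "\<And>v b. v \<in> \<V> \<Longrightarrow> b \<in> Basis \<Longrightarrow> multihomogeneous coord_vertex (e v) (\<lambda>z. representation Basis (v z) b)"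
    using hom by metis
  have f_eq: "f = (\<lambda>z. Determinant.det (mat R R (\<lambda>(p, q). representation Basis ((vs ! p) z) (es ! q))))"
  proof
    fix z
    have "mat R R (\<lambda>(p, q). representation Basis (map (\<lambda>v. v z) vs ! p) (es ! q)) =
        mat R R (\<lambda>(p, q). representation Basis ((vs ! p) z) (es ! q))"
      by (rule eq_matI) (auto simp: len)
    then show "f z = Determinant.det (mat R R (\<lambda>(p, q). representation Basis ((vs ! p) z) (es ! q)))"
      using es len vs(2) by (simp add: f_def pluecker_def)
  qed
  have in_V: "vs ! p \<in> \<V>" if "p < R" for p using vs(1) len that nth_mem[of p vs] by blast
  have in_B: "es ! q \<in> Basis" if "q < R" for q using es(1,2) vs(2) len that nth_mem[of q es] by auto
  have f: "multihomogeneous coord_vertex (\<lambda>b. \<Sum>p<R. e (vs ! p) b) f"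
    unfolding f_eq using in_V in_B by (intro multihomogeneous_det e)
  show "\<exists>U. openin ?X U \<and> y \<in> U \<and> U \<subseteq> ?A"
  proof (intro exI conjI subsetI)
    show "openin ?X (principal_open scale Basis m \<nu> f)" by (rule openin_principal_open[OF f])
    show "y \<in> principal_open scale Basis m \<nu> f"
      using principal_open_iff_frame[OF y(1) fr f] es(3) vs(2) by (simp add: f_def z_def)
    fix y' assume "y' \<in> principal_open scale Basis m \<nu> f"
    then obtain fr' where y': "y' \<in> Gr_product scale m \<nu>" "is_frame scale m y' fr'"
      "f (hcoords scale Basis m fr') \<noteq> 0" by (auto simp: principal_open_def)
    define z' where "z' = hcoords scale Basis m fr'"
    have ind: "distinct (map (\<lambda>v. v z') vs) \<and> independent (set (map (\<lambda>v. v z') vs))"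
      using y'(3) pluecker_nonzero_imp_independent unfolding f_def z'_def by blast
    then have "card (set (map (\<lambda>v. v z') vs)) = R" using len distinct_card by (metis length_map)
    moreover have "card (set (map (\<lambda>v. v z') vs)) \<le> dim ((\<lambda>v. v z') ` \<V>)"
      using ind vs(1) by (intro independent_card_le_dim) auto
    ultimately show "y' \<in> ?A" using d[OF y'(1,2)] y'(1) by (simp add: z'_def)
  qed
qed

lemma openin_dim_image_ge:
  assumes L: "Vector_Spaces.linear dd.scale scale L" and \<beta>: "\<beta> \<in> {1..m}"
  shows "openin (Gr_zariski scale Basis m \<nu>) {y \<in> Gr_product scale m \<nu>. R \<le> dim (L ` snd (snd y) \<beta>)}"
proof -
  interpret L: Vector_Spaces.linear dd.scale scale L by (rule L)
  define n where "n = \<nu> (Vj \<beta>)"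
  define pv where "pv es q z = pluecker_vector dd.scale dd.Basis_pair (\<lambda>es. z (Cj \<beta> es)) es q"
    for es q and z :: "'v coord \<Rightarrow> 'a"
  define \<V> where "\<V> = {\<lambda>z. L (pv es q z) | es q. length es = n \<and> set es \<subseteq> dd.Basis_pair \<and> q < n}"
  show ?thesis
  proof (rule openin_dim_ge[of \<V>])
    fix v assume "v \<in> \<V>"
    then obtain es q where v: "v = (\<lambda>z. L (pv es q z))" by (auto simp: \<V>_def)
    have "multihomogeneous coord_vertex (\<lambda>b. if b = Vj \<beta> then 1 else 0) (\<lambda>z. representation Basis (v z) b)" for b
    proof -
      have "(\<lambda>z. representation Basis (v z) b) =
        (\<lambda>z. \<Sum>x\<in>dd.Basis_pair. representation Basis (L x) b * z (Cj \<beta> (es[q := x])))"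
        by (simp add: v pv_def pluecker_vector_def L.sum L.scale rep_lincomb mult.commute)
      moreover have "multihomogeneous coord_vertex (\<lambda>b. if b = Vj \<beta> then 1 else 0)
        (\<lambda>z. \<Sum>x\<in>dd.Basis_pair. representation Basis (L x) b * z (Cj \<beta> (es[q := x])))"
        using multihomogeneous.var[of coord_vertex "Cj \<beta> es" for es]
        by (intro multihomogeneous_sum multihomogeneous_cmult) simp
      ultimately show ?thesis by simp
    qed
    then show "\<exists>e. \<forall>b\<in>Basis. multihomogeneous coord_vertex e (\<lambda>z. representation Basis (v z) b)" by blast
  next
    fix y fr assume y: "y \<in> Gr_product scale m \<nu>" and fr: "is_frame scale m y fr"
    obtain Ui Uk W where y_eq: "y = (Ui, Uk, W)" by (cases y) auto
    obtain bi bk bj where fr_eq: "fr = (bi, bk, bj)" by (cases fr) auto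
    have ob: "ordered_basis dd.scale (W \<beta>) (bj \<beta>)" and dimW: "dd.p.dim (W \<beta>) = n"
      using y fr \<beta> by (auto simp: y_eq fr_eq Gr_product_def n_def)
    let ?P = "{pluecker_vector dd.scale dd.Basis_pair (pluecker dd.scale dd.Basis_pair (bj \<beta>)) es q | es q.
        length es = n \<and> set es \<subseteq> dd.Basis_pair \<and> q < n}"
    have "(\<lambda>v. v (hcoords scale Basis m fr)) ` \<V> = L ` ?P"
      unfolding \<V>_def pv_def image_Collect2 fr_eq using \<beta> by simp
    then have "dim ((\<lambda>v. v (hcoords scale Basis m fr)) ` \<V>) = dim (span (L ` ?P))" by simp
    also have "span (L ` ?P) = L ` dd.p.span ?P" by (rule L.span_image)
    also have "dd.p.span ?P = W \<beta>" using dd.p.span_pluecker_vectors[OF ob] by (simp add: dimW)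
    finally show "dim ((\<lambda>v. v (hcoords scale Basis m fr)) ` \<V>) = dim (L ` snd (snd y) \<beta>)"
      by (simp add: y_eq)
  qed
qed

text \<open>Here the vectors for \<open>U\<^sub>i\<close> and for \<open>U\<^sub>k\<close> are put together; their minors have mixed degree in the two blocks.\<close>

lemma openin_dim_Un_ge:
  "openin (Gr_zariski scale Basis m \<nu>) {y \<in> Gr_product scale m \<nu>. R \<le> dim (fst y \<union> fst (snd y))}"
proof -
  define Vec where "Vec C n = {\<lambda>z :: 'v coord \<Rightarrow> 'a. pluecker_vector scale Basis (\<lambda>es. z (C es)) es q | es q.
      length es = n \<and> set es \<subseteq> Basis \<and> q < n}" for C n
  have hom: "\<exists>e. \<forall>b\<in>Basis. multihomogeneous coord_vertex e (\<lambda>z. representation Basis (v z) b)"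
    if v_in: "v \<in> Vec C n" and C: "\<And>es. coord_vertex (C es) = w" for v C n w
  proof -
    obtain es q where v: "v = (\<lambda>z. pluecker_vector scale Basis (\<lambda>es. z (C es)) es q)"
      using v_in by (auto simp: Vec_def)
    have "multihomogeneous coord_vertex (\<lambda>b. if b = w then 1 else 0) (\<lambda>z. representation Basis (v z) b)" for b
    proof -
      have "(\<lambda>z. representation Basis (v z) b) =
        (\<lambda>z. \<Sum>x\<in>Basis. representation Basis x b * z (C (es[q := x])))"
        by (simp add: v pluecker_vector_def rep_lincomb mult.commute)
      moreover have "multihomogeneous coord_vertex (\<lambda>b. if b = w then 1 else 0)
        (\<lambda>z. \<Sum>x\<in>Basis. representation Basis x b * z (C (es[q := x])))"
        using multihomogeneous.var[of coord_vertex "C es" for es] C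
        by (intro multihomogeneous_sum multihomogeneous_cmult) simp
      ultimately show ?thesis by simp
    qed
    then show ?thesis by blast
  qed
  show ?thesis
  proof (rule openin_dim_ge[of "Vec Ci (\<nu> Vi) \<union> Vec Ck (\<nu> Vk)"])
    show "\<exists>e. \<forall>b\<in>Basis. multihomogeneous coord_vertex e (\<lambda>z. representation Basis (v z) b)"
      if "v \<in> Vec Ci (\<nu> Vi) \<union> Vec Ck (\<nu> Vk)" for v
      using that hom[of v Ci _ Vi] hom[of v Ck _ Vk] by auto
  next
    fix y fr assume y: "y \<in> Gr_product scale m \<nu>" and fr: "is_frame scale m y fr"
    obtain Ui Uk W where y_eq: "y = (Ui, Uk, W)" by (cases y) auto
    obtain bi bk bj where fr_eq: "fr = (bi, bk, bj)" by (cases fr) auto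
    have ob: "ordered_basis scale Ui bi" "ordered_basis scale Uk bk"
      and dims: "dim Ui = \<nu> Vi" "dim Uk = \<nu> Vk"
      using y fr by (auto simp: y_eq fr_eq Gr_product_def)
    let ?P = "\<lambda>bs n. {pluecker_vector scale Basis (pluecker scale Basis bs) es q | es q.
        length es = n \<and> set es \<subseteq> Basis \<and> q < n}"
    let ?h = "\<lambda>v. v (hcoords scale Basis m fr)"
    have img: "?h ` Vec Ci (\<nu> Vi) = ?P bi (\<nu> Vi)" "?h ` Vec Ck (\<nu> Vk) = ?P bk (\<nu> Vk)"
      unfolding Vec_def image_Collect2 fr_eq by simp_all
    have sp: "span (?P bi (\<nu> Vi)) = Ui" "span (?P bk (\<nu> Vk)) = Uk"
      using span_pluecker_vectors[OF ob(1)] span_pluecker_vectors[OF ob(2)] by (simp_all add: dims)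
    have sub: "span Ui = Ui" "span Uk = Uk"
      using y by (auto simp: y_eq Gr_product_def)
    have "span (?h ` (Vec Ci (\<nu> Vi) \<union> Vec Ck (\<nu> Vk))) = span (Ui \<union> Uk)"
      unfolding image_Un img span_Un sp sub ..
    then show "dim (?h ` (Vec Ci (\<nu> Vi) \<union> Vec Ck (\<nu> Vk))) = dim (fst y \<union> fst (snd y))"
      unfolding y_eq fst_conv snd_conv by (rule span_eq_dim)
  qed
qed

end

section \<open>Automorphisms moving flags, and polynomial paths\<close>

lemma (in finite_dimensional_vector_space_pair) dim_image_plus_dim_kernel:
  assumes f: "Vector_Spaces.linear s1 s2 f" and S: "vs1.subspace S"
  shows "vs2.dim (f ` S) + vs1.dim {x \<in> S. f x = 0} = vs1.dim S"
proof -
  interpret f: Vector_Spaces.linear s1 s2 f by (rule f)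
  define N where "N = {x \<in> S. f x = 0}"
  have N: "vs1.subspace N"
    using vs1.subspace_inter[OF S f.subspace_kernel] by (simp add: N_def Int_def)
  obtain BN where BN: "BN \<subseteq> N" "vs1.independent BN" "vs1.span BN = N"
    using vs1.extend_to_basis[OF vs1.independent_empty _ N] by auto
  have NS: "N \<subseteq> S" by (auto simp: N_def)
  obtain BS where BS: "BN \<subseteq> BS" "BS \<subseteq> S" "vs1.independent BS" "vs1.span BS = S"
    using vs1.extend_to_basis[OF BN(2) _ S] BN(1) NS by (metis order_trans)
  define C where "C = BS - BN"
  have C: "vs1.independent C" "BN \<union> C = BS" using BS vs1.independent_mono C_def by auto
  have inj: "inj_on f (vs1.span C)"
  proof (subst f.inj_on_iff_eq_0)
    show "\<forall>x\<in>vs1.span C. f x = 0 \<longrightarrow> x = 0"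
    proof (intro ballI impI)
      fix x assume x: "x \<in> vs1.span C" "f x = 0"
      have "x \<in> vs1.span BS" using x(1) vs1.span_mono[of C BS] C(2) by auto
      then have "x \<in> vs1.span BN" using BS(4) BN(3) x(2) by (auto simp: N_def)
      then show "x = 0"
        using vs1.independent_Un_disjoint_spans[of BN C x] x(1) C BS(3) C_def by auto
    qed
  qed simp
  have "f ` S = vs2.span (f ` BS)" using BS(4) f.span_image by metis
  also have "\<dots> = vs2.span (f ` C)"
  proof
    have "f ` BS \<subseteq> vs2.span (f ` C)"
    proof
      fix y assume "y \<in> f ` BS"
      then obtain b where b: "b \<in> BS" "y = f b" by blast
      show "y \<in> vs2.span (f ` C)"
      proof (cases "b \<in> C")
        case False
        then have "b \<in> N" using b C(2) BN(1) by auto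
        then show ?thesis using b by (simp add: N_def vs2.span_zero)
      qed (use b in \<open>auto intro: vs2.span_base\<close>)
    qed
    then show "vs2.span (f ` BS) \<subseteq> vs2.span (f ` C)" by (intro vs2.span_minimal) auto
    show "vs2.span (f ` C) \<subseteq> vs2.span (f ` BS)" using C(2) by (intro vs2.span_mono) auto
  qed
  finally have "vs2.dim (f ` S) = card (f ` C)"
    using f.independent_injective_image[OF C(1) inj] vs2.dim_span_eq_card_independent by simp
  also have "\<dots> = card C"
    using inj by (intro card_image inj_on_subset[OF inj]) (auto intro: vs1.span_base)
  finally have 1: "vs2.dim (f ` S) = card C" .
  have 2: "vs1.dim N = card BN" using BN vs1.dim_span_eq_card_independent by metis
  have 3: "vs1.dim S = card BS" using BS vs1.dim_span_eq_card_independent by metis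
  have "finite BS" using vs1.finiteI_independent BS(3) .
  then have "finite BN" "finite C" using BS(1) by (auto simp: C_def intro: finite_subset)
  then have "card BS = card BN + card C"
    using C(2) card_Un_disjoint[of BN C] by (auto simp: C_def)
  then show ?thesis using 1 2 3 by (simp add: N_def)
qed

context finite_dimensional_vector_space
begin

text \<open>Extend a basis of \<open>A\<close> to bases adapted to \<open>A \<subseteq> P \<subseteq> Q\<close> and to \<open>A \<subseteq> P' \<subseteq> Q\<close>, and match them layer by layer.\<close>

lemma automorphism_between_subspaces:
  assumes A: "subspace A" and P: "subspace P" "A \<subseteq> P" "P \<subseteq> Q" and P': "subspace P'" "A \<subseteq> P'" "P' \<subseteq> Q"
    and Q: "subspace Q" and dim: "dim P = dim P'"
  obtains k where "Vector_Spaces.linear scale scale k" "bij k" "\<And>x. x \<in> A \<Longrightarrow> k x = x" "k ` P = P'" "k ` Q = Q"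
proof -
  interpret vp: finite_dimensional_vector_space_pair scale Basis scale Basis by unfold_locales
  obtain a where a: "a \<subseteq> A" "independent a" "span a = A"
    using extend_to_basis[OF independent_empty _ A] by auto
  have flag: "\<exists>p q d. a \<subseteq> p \<and> p \<subseteq> q \<and> q \<subseteq> d \<and> independent p \<and> independent q \<and> independent d \<and>
      span p = R \<and> span q = Q \<and> span d = UNIV" if R: "subspace R" "A \<subseteq> R" "R \<subseteq> Q" for R
  proof -
    obtain p where p: "a \<subseteq> p" "p \<subseteq> R" "independent p" "span p = R"
      using extend_to_basis[OF a(2) _ R(1)] a(1) R(2) by (metis order_trans)
    obtain q where q: "p \<subseteq> q" "q \<subseteq> Q" "independent q" "span q = Q"
      using extend_to_basis[OF p(3) _ Q] p(2) R(3) by (metis order_trans)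
    obtain d where d: "q \<subseteq> d" "independent d" "span d = UNIV"
      by (rule extend_to_basis[OF q(3) subset_UNIV subspace_UNIV])
    show ?thesis using p q d by blast
  qed
  obtain p q d where B: "a \<subseteq> p" "p \<subseteq> q" "q \<subseteq> d" "independent p" "independent q" "independent d"
      "span p = P" "span q = Q" "span d = UNIV" using flag[OF P] by blast
  obtain p' q' d' where B': "a \<subseteq> p'" "p' \<subseteq> q'" "q' \<subseteq> d'" "independent p'" "independent q'" "independent d'"
      "span p' = P'" "span q' = Q" "span d' = UNIV" using flag[OF P'] by blast
  have fin: "finite a" "finite p" "finite q" "finite d" "finite p'" "finite q'" "finite d'"
    by (rule finiteI_independent, fact)+
  have card: "card p = card p'" "card q = card q'" "card d = card d'"
    using dim dim_span_eq_card_independent[OF B(4)] dim_span_eq_card_independent[OF B'(4)]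
      dim_span_eq_card_independent[OF B(5)] dim_span_eq_card_independent[OF B'(5)]
      dim_span_eq_card_independent[OF B(6)] dim_span_eq_card_independent[OF B'(6)] B(7-9) B'(7-9)
    by simp_all
  have "\<exists>f. bij_betw f (p - a) (p' - a)" "\<exists>f. bij_betw f (q - p) (q' - p')" "\<exists>f. bij_betw f (d - q) (d' - q')"
    using fin card B B' by (auto intro!: finite_same_card_bij simp: card_Diff_subset)
  then obtain f1 f2 f3 where f: "bij_betw f1 (p - a) (p' - a)" "bij_betw f2 (q - p) (q' - p')"
    "bij_betw f3 (d - q) (d' - q')" by blast
  define f where "f x = (if x \<in> a then x else if x \<in> p then f1 x else if x \<in> q then f2 x else f3 x)" for x
  define k where "k = vp.construct d f"
  have k: "Vector_Spaces.linear scale scale k" unfolding k_def by (rule vp.linear_construct[OF B(6)])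
  interpret k: Vector_Spaces.linear scale scale k by (rule k)
  have kf: "k x = f x" if "x \<in> d" for x
    unfolding k_def using vp.construct_basis[OF B(6) that] .
  have ka: "k x = x" if "x \<in> a" for x using kf[of x] that B by (auto simp: f_def)
  have kp: "k ` (p - a) = p' - a"
  proof -
    have "k ` (p - a) = f1 ` (p - a)"
    proof (rule image_cong[OF refl])
      fix x assume x: "x \<in> p - a"
      have "x \<in> d" using x B(2,3) by blast
      from kf[OF this] show "k x = f1 x" using x B(1-3) by (auto simp: f_def)
    qed
    then show ?thesis using f(1) by (simp add: bij_betw_def)
  qed
  have kq: "k ` (q - p) = q' - p'"
  proof -
    have "k ` (q - p) = f2 ` (q - p)"
    proof (rule image_cong[OF refl])
      fix x assume x: "x \<in> q - p"
      have "x \<in> d" using x B(2,3) by blast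
      from kf[OF this] show "k x = f2 x" using x B(1-3) by (auto simp: f_def)
    qed
    then show ?thesis using f(2) by (simp add: bij_betw_def)
  qed
  have kd: "k ` (d - q) = d' - q'"
  proof -
    have "k ` (d - q) = f3 ` (d - q)"
    proof (rule image_cong[OF refl])
      fix x assume x: "x \<in> d - q"
      have "x \<in> d" using x B(2,3) by blast
      from kf[OF this] show "k x = f3 x" using x B(1-3) by (auto simp: f_def)
    qed
    then show ?thesis using f(3) by (simp add: bij_betw_def)
  qed
  have "k ` a = a" using ka by auto
  then have p: "k ` p = p'" using kp B(1) B'(1) by (metis Un_Diff_cancel Un_absorb1 image_Un)
  then have q: "k ` q = q'" using kq B(2) B'(2) by (metis Un_Diff_cancel Un_absorb1 image_Un)
  then have d: "k ` d = d'" using kd B(3) B'(3) by (metis Un_Diff_cancel Un_absorb1 image_Un)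
  have "k ` UNIV = UNIV" using d k.span_image[of d] B(9) B'(9) by simp
  then have "bij k" using linear_surj_imp_inj[OF k] by (simp add: bij_def)
  moreover have "k ` P = P'" using p k.span_image[of p] B(7) B'(7) by simp
  moreover have "k ` Q = Q" using q k.span_image[of q] B(8) B'(8) by simp
  moreover have "k x = x" if "x \<in> A" for x
    using vp.linear_eq_on[OF k module_hom_ident[unfolded module_hom_iff_linear], of x a] ka that a(3) by simp
  ultimately show thesis using that k by blast
qed

text \<open>By induction on the length: an automorphism that is right up to step \<open>N\<close> is followed by one that fixes
  the \<open>N\<close>-th subspace and corrects the next one.\<close>

lemma automorphism_between_flags:
  assumes "\<And>n. n \<le> N \<Longrightarrow> subspace (S n) \<and> subspace (S' n) \<and> dim (S n) = dim (S' n)"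
    and "\<And>n. n < N \<Longrightarrow> S n \<subseteq> S (Suc n) \<and> S' n \<subseteq> S' (Suc n)"
  shows "\<exists>g. Vector_Spaces.linear scale scale g \<and> bij g \<and> (\<forall>n\<le>N. g ` S n = S' n)"
  using assms
proof (induction N)
  case 0
  have s: "subspace (S 0)" "subspace (S' 0)" "dim (S 0) = dim (S' 0)" using "0.prems"(1)[of 0] by auto
  have 0: "subspace {0}" "{0} \<subseteq> S 0" "{0} \<subseteq> S' 0"
    using 0(1)[of 0] subspace_0 by auto
  obtain k where "Vector_Spaces.linear scale scale k" "bij k" "k ` S 0 = S' 0"
    by (rule automorphism_between_subspaces[OF 0(1) s(1) 0(2) subset_UNIV s(2) 0(3) subset_UNIV
      subspace_UNIV s(3)]) blast
  then show ?case by auto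
next
  case (Suc N)
  then obtain g where g: "Vector_Spaces.linear scale scale g" "bij g" "\<And>n. n \<le> N \<Longrightarrow> g ` S n = S' n"
    by (metis le_Suc_eq less_Suc_eq)
  interpret g: Vector_Spaces.linear scale scale g by (rule g)
  interpret vp: finite_dimensional_vector_space_pair scale Basis scale Basis by unfold_locales
  have sub: "subspace (S' N)" "subspace (g ` S (Suc N))" "subspace (S' (Suc N))"
    using Suc.prems(1)[of N] Suc.prems(1)[of "Suc N"] g.subspace_image by auto
  have "g ` S N = S' N" using g(3) by simp
  then have incl: "S' N \<subseteq> g ` S (Suc N)" "S' N \<subseteq> S' (Suc N)" using Suc.prems(2)[of N] image_mono[of "S N" "S (Suc N)" g] by auto
  have "dim (g ` S (Suc N)) = dim (S (Suc N))"
    using g(2) by (intro vp.dim_image_eq[OF g(1)]) (meson bij_is_inj inj_on_subset subset_UNIV)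
  then have dim: "dim (g ` S (Suc N)) = dim (S' (Suc N))" using Suc.prems(1)[of "Suc N"] by simp
  obtain k where k: "Vector_Spaces.linear scale scale k" "bij k" "\<And>x. x \<in> S' N \<Longrightarrow> k x = x"
      "k ` g ` S (Suc N) = S' (Suc N)"
    by (rule automorphism_between_subspaces[OF sub(1,2) incl(1) subset_UNIV sub(3) incl(2) subset_UNIV
      subspace_UNIV dim]) blast
  have mono: "S' n \<subseteq> S' N" if "n \<le> N" for n
    using that
  proof (induction "N - n" arbitrary: n)
    case (Suc r)
    then have "S' n \<subseteq> S' (Suc n)" "S' (Suc n) \<subseteq> S' N" using \<open>\<And>n. n < Suc N \<Longrightarrow> S n \<subseteq> S (Suc n) \<and> S' n \<subseteq> S' (Suc n)\<close>[of n] by auto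
    then show ?case by blast
  qed simp
  have "(k \<circ> g) ` S n = S' n" if "n \<le> Suc N" for n
  proof (cases "n = Suc N")
    case False
    then have "n \<le> N" using that by simp
    then have "k ` S' n = (\<lambda>x. x) ` S' n" using mono k(3) by (intro image_cong) auto
    then show ?thesis using g(3)[OF \<open>n \<le> N\<close>] by (simp only: image_comp[symmetric]) simp
  qed (use k(4) in \<open>simp only: image_comp[symmetric]\<close>)
  moreover have "Vector_Spaces.linear scale scale (k \<circ> g)" using Vector_Spaces.linear_compose[OF g(1) k(1)] .
  moreover have "bij (k \<circ> g)" using g(2) k(2) by (rule bij_comp)
  ultimately show ?case by blast
qed

end

text \<open>The line \<open>(1 - t) id + t g\<close> in the space of endomorphisms, from the identity at \<open>0\<close> to \<open>g\<close> at \<open>1\<close>.\<close>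

definition interpolation :: "('a::field \<Rightarrow> 'w::ab_group_add \<Rightarrow> 'w) \<Rightarrow> ('w \<Rightarrow> 'w) \<Rightarrow> 'a \<Rightarrow> 'w \<Rightarrow> 'w" where
  "interpolation s g t x = s (1 - t) x + s t (g x)"

definition polynomial_path :: "('a::field \<Rightarrow> 'w::ab_group_add \<Rightarrow> 'w) \<Rightarrow> 'w set \<Rightarrow> ('a \<Rightarrow> 'w) \<Rightarrow> bool" where
  "polynomial_path s B v \<longleftrightarrow> (\<forall>b. univariate_polynomial (\<lambda>t. module.representation s B (v t) b))"

context finite_dimensional_vector_space
begin

lemma polynomial_path_const: "polynomial_path scale Basis (\<lambda>_. v)"
  by (simp add: polynomial_path_def)

lemma polynomial_path_add:
  "polynomial_path scale Basis u \<Longrightarrow> polynomial_path scale Basis v \<Longrightarrow> polynomial_path scale Basis (\<lambda>t. u t + v t)"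
  by (auto simp: polynomial_path_def rep_add)

lemma polynomial_path_scale:
  "univariate_polynomial f \<Longrightarrow> polynomial_path scale Basis v \<Longrightarrow> polynomial_path scale Basis (\<lambda>t. f t *s v t)"
  by (auto simp: polynomial_path_def rep_scale)

lemma polynomial_path_linear:
  assumes L: "Vector_Spaces.linear scale scale L" and v: "polynomial_path scale Basis v"
  shows "polynomial_path scale Basis (\<lambda>t. L (v t))"
proof -
  interpret L: Vector_Spaces.linear scale scale L by (rule L)
  have "representation Basis (L (v t)) b = (\<Sum>c\<in>Basis. representation Basis (v t) c * representation Basis (L c) b)"
    for t b by (subst rep_sum[of "v t", symmetric]) (simp only: L.sum L.scale rep_lincomb)
  then show ?thesis
    using v by (auto simp: polynomial_path_def intro!: univariate_polynomial_sum univariate_polynomial_mult)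
qed

lemma univariate_polynomial_pluecker:
  assumes "\<And>x. x \<in> set bs \<Longrightarrow> polynomial_path scale Basis (\<lambda>t. f t x)"
  shows "univariate_polynomial (\<lambda>t. pluecker scale Basis (map (f t) bs) es)"
proof (cases "length es = length bs \<and> set es \<subseteq> Basis")
  case True
  have "pluecker scale Basis (map (f t) bs) es =
      Determinant.det (mat (length bs) (length bs) (\<lambda>(p, q). representation Basis (f t (bs ! p)) (es ! q)))" for t
    using True by (auto simp: pluecker_def intro!: arg_cong[where f = Determinant.det] eq_matI)
  moreover have "univariate_polynomial (\<lambda>t. Determinant.det (mat (length bs) (length bs)
      (\<lambda>(p, q). representation Basis (f t (bs ! p)) (es ! q))))"
    using assms by (intro univariate_polynomial_det) (auto simp: polynomial_path_def)
  ultimately show ?thesis by simp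
next
  case False
  then have "pluecker scale Basis (map (f t) bs) es = 0" for t by (auto simp: pluecker_def)
  then show ?thesis by simp
qed

lemma ordered_basis_image:
  assumes f: "Vector_Spaces.linear scale scale f" "inj f" and bs: "ordered_basis scale L bs"
  shows "ordered_basis scale (f ` L) (map f bs)"
proof -
  interpret f: Vector_Spaces.linear scale scale f by (rule f)
  have "independent (f ` set bs)"
    using bs f(2) by (intro f.independent_injective_image) (auto simp: ordered_basis_def inj_def inj_on_def)
  then show ?thesis
    using bs f(2) f.span_image[of "set bs"]
    by (auto simp: ordered_basis_def distinct_map inj_def inj_on_def)
qed

lemma interpolation_0 [simp]: "interpolation scale g 0 = id"
  by (auto simp: interpolation_def)

lemma interpolation_1 [simp]: "interpolation scale g 1 = g"
  by (auto simp: interpolation_def)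

lemma linear_interpolation:
  assumes "Vector_Spaces.linear scale scale g"
  shows "Vector_Spaces.linear scale scale (interpolation scale g t)"
proof -
  interpret g: Vector_Spaces.linear scale scale g by (rule assms)
  show ?thesis
    unfolding interpolation_def
    by unfold_locales (simp_all only: g.add g.scale scale_right_distrib scale_scale mult.commute add_ac)
qed

lemma polynomial_path_interpolation:
  assumes "Vector_Spaces.linear scale scale g" "polynomial_path scale Basis v"
  shows "polynomial_path scale Basis (\<lambda>t. interpolation scale g t (v t))"
  unfolding interpolation_def
  by (intro polynomial_path_add polynomial_path_scale polynomial_path_linear[OF assms(1)] assms(2)
    univariate_polynomial_diff univariate_polynomial_const univariate_polynomial_ident)

text \<open>The image of a fixed basis has a Pluecker coordinate that is a polynomial in \<open>t\<close> and does not vanish at \<open>0\<close>.\<close>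

lemma finite_not_bij_interpolation:
  assumes g: "Vector_Spaces.linear scale scale g"
  shows "finite {t. \<not> bij (interpolation scale g t)}"
proof -
  obtain bs where bs: "ordered_basis scale UNIV bs"
    using ordered_basis_exists[OF subspace_UNIV] .
  obtain es where es: "pluecker scale Basis bs es \<noteq> 0"
    using independent_imp_pluecker_nonzero bs unfolding ordered_basis_def by metis
  define f where "f t = pluecker scale Basis (map (interpolation scale g t) bs) es" for t
  have "univariate_polynomial f"
    unfolding f_def
    by (intro univariate_polynomial_pluecker polynomial_path_interpolation[OF g] polynomial_path_const)
  moreover have "f 0 \<noteq> 0" using es by (simp add: f_def)
  ultimately have "finite {t. f t = 0}" by (rule finite_zeros_univariate_polynomial)
  moreover have "{t. \<not> bij (interpolation scale g t)} \<subseteq> {t. f t = 0}"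
  proof (clarify, rule ccontr)
    fix t assume nb: "\<not> bij (interpolation scale g t)" and "f t \<noteq> 0"
    then have ind: "distinct (map (interpolation scale g t) bs) \<and> independent (set (map (interpolation scale g t) bs))"
      unfolding f_def by (intro pluecker_nonzero_imp_independent)
    interpret G: Vector_Spaces.linear scale scale "interpolation scale g t" by (rule linear_interpolation[OF g])
    have "card (set (map (interpolation scale g t) bs)) = dim UNIV"
      using ind distinct_card ordered_basis_length[OF bs] by (metis length_map)
    then have "UNIV \<subseteq> span (set (map (interpolation scale g t) bs))"
      using ind by (intro card_ge_dim_independent) auto
    also have "\<dots> = interpolation scale g t ` span (set bs)" by (simp add: G.span_image)
    finally have "surj (interpolation scale g t)" by auto
    then show False using linear_surj_imp_inj[OF linear_interpolation[OF g]] nb by (auto simp: bij_def)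
  qed
  ultimately show ?thesis by (rule finite_subset[rotated])
qed

end

section \<open>Subspaces in general position and linear correspondences\<close>

text \<open>Two subspaces in general position between \<open>V\<close> and \<open>U\<close>: extend a basis of \<open>V\<close> by two subsets of a complementary
  basis that overlap as little as possible.\<close>

lemma (in finite_dimensional_vector_space) generic_subspace_pair:
  assumes V: "subspace V" and U: "subspace U" and VU: "V \<subseteq> U"
    and a: "dim V \<le> a" "a \<le> dim U" and b: "dim V \<le> b" "b \<le> dim U"
  obtains A B where "subspace A" "V \<subseteq> A" "A \<subseteq> U" "dim A = a" "subspace B" "V \<subseteq> B" "B \<subseteq> U" "dim B = b"
    "dim (A \<union> B) + dim V = min (a + b) (dim U + dim V)"
proof -
  obtain bv where bv: "bv \<subseteq> V" "independent bv" "span bv = V"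
    using extend_to_basis[OF independent_empty _ V] by auto
  have "bv \<subseteq> U" using bv VU by blast
  then obtain bu where bu: "bv \<subseteq> bu" "bu \<subseteq> U" "independent bu" "span bu = U"
    using extend_to_basis[OF bv(2) _ U] by metis
  define E where "E = bu - bv"
  have fin: "finite bu" "finite bv" "finite E"
    using finiteI_independent[OF bu(3)] finite_subset[OF bu(1)] by (auto simp: E_def)
  have dims: "dim V = card bv" "dim U = card bu"
    using dim_span_eq_card_independent[OF bv(2)] dim_span_eq_card_independent[OF bu(3)] bv bu by simp_all
  have cardE: "card E + card bv = card bu"
    using bu(1) fin card_mono[of bu bv] by (simp add: E_def card_Diff_subset)
  have "a - card bv \<le> card E" using a cardE dims by simp
  then obtain X where X: "X \<subseteq> E" "card X = a - card bv" by (meson obtain_subset_with_card_n)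
  have finX: "finite X" using X fin finite_subset by blast
  have cardEX: "card (E - X) + card X = card E"
    using X fin card_mono[of E X] by (simp add: card_Diff_subset finX)
  (* If the complement of X in E is too small for Y, then Y contains it and X \<union> Y is all of E. *)
  have "\<exists>Y\<subseteq>E. card Y = b - card bv \<and> card (X \<union> Y) = min (card X + (b - card bv)) (card E)"
  proof (cases "b - card bv \<le> card (E - X)")
    case True
    then obtain Y where Y: "Y \<subseteq> E - X" "card Y = b - card bv" by (meson obtain_subset_with_card_n)
    then have "card (X \<union> Y) = card X + card Y"
      using fin finX finite_subset by (intro card_Un_disjoint) auto
    then show ?thesis using Y True cardEX by (intro exI[of _ Y]) auto
  next
    case False
    have "b - card bv - card (E - X) \<le> card X" using b cardE cardEX dims by simp
    then obtain Z where Z: "Z \<subseteq> X" "card Z = b - card bv - card (E - X)"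
      by (meson obtain_subset_with_card_n)
    have "card (E - X \<union> Z) = card (E - X) + card Z"
      using fin finX Z finite_subset by (intro card_Un_disjoint) auto
    moreover have "X \<union> (E - X \<union> Z) = E" using X Z by blast
    ultimately show ?thesis
      using Z X False cardEX by (intro exI[of _ "E - X \<union> Z"]) auto
  qed
  then obtain Y where Y: "Y \<subseteq> E" "card Y = b - card bv" "card (X \<union> Y) = min (card X + (b - card bv)) (card E)"
    by blast
  have dim_extension: "dim (span (bv \<union> Z)) = card bv + card Z" if "Z \<subseteq> E" for Z
  proof -
    have "bv \<union> Z \<subseteq> bu" using bu(1) that by (auto simp: E_def)
    then have "independent (bv \<union> Z)" using bu(3) independent_mono by blast
    then have "dim (span (bv \<union> Z)) = card (bv \<union> Z)" by (rule dim_span_eq_card_independent)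
    also have "\<dots> = card bv + card Z"
      using that fin finite_subset by (intro card_Un_disjoint) (auto simp: E_def)
    finally show ?thesis .
  qed
  have incl: "V \<subseteq> span (bv \<union> Z) \<and> span (bv \<union> Z) \<subseteq> U" if "Z \<subseteq> E" for Z
    unfolding bv(3)[symmetric] bu(4)[symmetric] using that bu(1)
    by (intro conjI span_mono) (auto simp: E_def)
  have "span (span (bv \<union> X) \<union> span (bv \<union> Y)) = span (bv \<union> (X \<union> Y))"
  proof
    show "span (span (bv \<union> X) \<union> span (bv \<union> Y)) \<subseteq> span (bv \<union> (X \<union> Y))"
      by (rule span_minimal[OF _ subspace_span]) (intro Un_least span_mono, auto)
    show "span (bv \<union> (X \<union> Y)) \<subseteq> span (span (bv \<union> X) \<union> span (bv \<union> Y))"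
      using span_superset[of "bv \<union> X"] span_superset[of "bv \<union> Y"] by (intro span_mono) blast
  qed
  from span_eq_dim[OF this]
  have "dim (span (bv \<union> X) \<union> span (bv \<union> Y)) = dim (span (bv \<union> (X \<union> Y)))"
    by (simp only: local.dim_span)
  also have "\<dots> = card bv + card (X \<union> Y)" by (rule dim_extension) (use X Y in auto)
  finally have union: "dim (span (bv \<union> X) \<union> span (bv \<union> Y)) = card bv + card (X \<union> Y)" .
  show thesis
  proof (rule that[of "span (bv \<union> X)" "span (bv \<union> Y)"])
    show "dim (span (bv \<union> X)) = a" "dim (span (bv \<union> Y)) = b"
      using dim_extension[OF X(1)] dim_extension[OF Y(1)] X Y a b dims by auto
    show "dim (span (bv \<union> X) \<union> span (bv \<union> Y)) + dim V = min (a + b) (dim U + dim V)"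
      unfolding union using X(2) Y(3) a b dims cardE by simp
  qed (use incl[OF X(1)] incl[OF Y(1)] in auto)
qed

text \<open>The automorphism of \<open>D \<oplus> D\<close> that adds \<open>\<psi>\<close> to the linear map of which a correspondence is the graph.\<close>

definition shear :: "('v::plus \<Rightarrow> 'v) \<Rightarrow> 'v \<times> 'v \<Rightarrow> 'v \<times> 'v" where
  "shear \<psi> = (\<lambda>(x, y). (x + \<psi> y, y))"

context doubled_space
begin

lemma linear_snd: "Vector_Spaces.linear dd.scale scale snd"
  by (rule dd.linear_snd)

lemma linear_fst: "Vector_Spaces.linear dd.scale scale fst"
  by (rule dd.linear_fst)

lemma subspace_slice: "dd.p.subspace W \<Longrightarrow> subspace {x. (x, 0) \<in> W}"
  unfolding subspace_def dd.p.subspace_def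
  by (auto simp: zero_prod_def dd.scale_prod) (metis add.right_neutral add_Pair, metis dd.scale_prod scale_zero_right)

lemma subspace_coslice: "dd.p.subspace W \<Longrightarrow> subspace {y. (0, y) \<in> W}"
  unfolding subspace_def dd.p.subspace_def
  by (auto simp: zero_prod_def dd.scale_prod) (metis add.right_neutral add_Pair, metis dd.scale_prod scale_zero_right)

lemma dim_slice_plus_dim_snd:
  assumes W: "dd.p.subspace W"
  shows "dim {x. (x, 0) \<in> W} + dim (snd ` W) = dd.p.dim W"
proof -
  interpret pr: finite_dimensional_vector_space_pair dd.scale dd.Basis_pair scale Basis by unfold_locales
  have "{w \<in> W. snd w = 0} = {x. (x, 0) \<in> W} \<times> {0}" by auto
  then have "dd.p.dim {w \<in> W. snd w = 0} = dim {x. (x, 0) \<in> W} + dim {0}"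
    using dd.dim_Times[OF subspace_slice[OF W] subspace_single_0] by simp
  then show ?thesis using pr.dim_image_plus_dim_kernel[OF linear_snd W] by simp
qed

lemma dim_fst_plus_dim_coslice:
  assumes W: "dd.p.subspace W"
  shows "dim (fst ` W) + dim {y. (0, y) \<in> W} = dd.p.dim W"
proof -
  interpret pr: finite_dimensional_vector_space_pair dd.scale dd.Basis_pair scale Basis by unfold_locales
  have "{w \<in> W. fst w = 0} = {0} \<times> {y. (0, y) \<in> W}" by auto
  then have "dd.p.dim {w \<in> W. fst w = 0} = dim {0} + dim {y. (0, y) \<in> W}"
    using dd.dim_Times[OF subspace_single_0 subspace_coslice[OF W]] by simp
  then show ?thesis using pr.dim_image_plus_dim_kernel[OF linear_fst W] by simp
qed

text \<open>Such a \<open>W\<close> is the graph of a linear map \<open>V/V' \<rightarrow> U'/U\<close>, and \<open>fst ` W / U\<close> is its image.  A map of maximal rank,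
  matching basis vectors \<open>S\<close> of the source with basis vectors \<open>T\<close> of the target, gives the stated dimension.\<close>

lemma generic_correspondence:
  assumes V: "subspace V" "subspace V'" "V' \<subseteq> V" and U: "subspace U" "subspace U'" "U \<subseteq> U'"
  obtains W where "dd.p.subspace W" "{x. (x, 0) \<in> W} = U" "snd ` W = V" "{0} \<times> V' \<subseteq> W" "fst ` W \<subseteq> U'"
    "dim (fst ` W) + dim V' = min (dim U + dim V) (dim U' + dim V')"
proof -
  obtain bv' where bv': "bv' \<subseteq> V'" "independent bv'" "span bv' = V'"
    using extend_to_basis[OF independent_empty _ V(2)] by auto
  have "bv' \<subseteq> V" using bv' V by blast
  then obtain bv where bv: "bv' \<subseteq> bv" "bv \<subseteq> V" "independent bv" "span bv = V"
    using extend_to_basis[OF bv'(2) _ V(1)] by metis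
  obtain bu where bu: "bu \<subseteq> U" "independent bu" "span bu = U"
    using extend_to_basis[OF independent_empty _ U(1)] by auto
  have "bu \<subseteq> U'" using bu U by blast
  then obtain bu' where bu': "bu \<subseteq> bu'" "bu' \<subseteq> U'" "independent bu'" "span bu' = U'"
    using extend_to_basis[OF bu(2) _ U(2)] by metis
  have fin: "finite bv" "finite bv'" "finite bu" "finite bu'"
    by (rule finiteI_independent, fact)+
  have dims: "dim V = card bv" "dim V' = card bv'" "dim U = card bu" "dim U' = card bu'"
    using dim_span_eq_card_independent[OF bv(3)] dim_span_eq_card_independent[OF bv'(2)]
      dim_span_eq_card_independent[OF bu(2)] dim_span_eq_card_independent[OF bu'(3)] bv(4) bv'(3) bu(3) bu'(4)
    by simp_all
  have le: "card bv' \<le> card bv" "card bu \<le> card bu'" using bv bu' fin card_mono by auto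
  define k where "k = min (card (bv - bv')) (card (bu' - bu))"
  have "k \<le> card (bv - bv')" "k \<le> card (bu' - bu)" by (simp_all add: k_def)
  then obtain S T where S: "S \<subseteq> bv - bv'" "card S = k" and T: "T \<subseteq> bu' - bu" "card T = k"
    by (meson obtain_subset_with_card_n)
  have finST: "finite S" "finite T" using S T fin finite_subset by blast+
  then obtain h where h: "bij_betw h S T" using S T finite_same_card_bij by metis
  define lift where "lift v = (if v \<in> S then h v else 0, v)" for v
  define G where "G = bu \<times> {0} \<union> lift ` bv"
  define W where "W = dd.p.span G"
  have sndW: "snd ` W = V"
  proof -
    interpret s: Vector_Spaces.linear dd.scale scale snd by (rule linear_snd)
    have "snd ` W = span (snd ` G)" by (simp add: W_def s.span_image)
    moreover have "snd ` G - {0} = bv - {0}"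
    proof -
      have "snd ` lift ` bv = bv" by (simp add: lift_def image_image)
      moreover have "snd ` (bu \<times> {0}) \<subseteq> {0}" by auto
      ultimately show ?thesis by (auto simp: G_def image_Un)
    qed
    ultimately show ?thesis using span_delete_0 bv(4) by metis
  qed
  have fstW: "fst ` W = span (bu \<union> T)"
  proof -
    interpret f: Vector_Spaces.linear dd.scale scale fst by (rule linear_fst)
    have "fst ` W = span (fst ` G)" by (simp add: W_def f.span_image)
    moreover have "fst ` G - {0} = (bu \<union> T) - {0}"
    proof -
      have "fst ` lift ` bv - {0} = T - {0}"
      proof -
        have "fst ` lift ` bv = fst ` lift ` S \<union> fst ` lift ` (bv - S)" using S(1) by blast
        moreover have "fst ` lift ` S = T" using h by (auto simp: lift_def bij_betw_def image_image)
        moreover have "fst ` lift ` (bv - S) \<subseteq> {0}" by (auto simp: lift_def)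
        ultimately show ?thesis by blast
      qed
      moreover have "fst ` (bu \<times> {0}) = bu" by force
      ultimately show ?thesis by (auto simp: G_def image_Un)
    qed
    ultimately show ?thesis using span_delete_0 by metis
  qed
  have slice: "{x. (x, 0) \<in> W} = U"
  proof (rule subspace_dim_equal[symmetric])
    show "subspace U" by (rule U)
    show sub: "subspace {x. (x, 0) \<in> W}" unfolding W_def by (rule subspace_slice) simp
    have "bu \<subseteq> {x. (x, 0) \<in> W}" by (auto simp: W_def G_def intro: dd.p.span_base)
    then show "U \<subseteq> {x. (x, 0) \<in> W}" unfolding bu(3)[symmetric] using sub by (intro span_minimal)
    have "dd.p.dim W \<le> card G"
      unfolding W_def using fin by (intro dd.p.dim_le_card) (auto simp: G_def)
    also have "\<dots> \<le> card (bu \<times> {0::'v}) + card (lift ` bv)" unfolding G_def by (rule card_Un_le)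
    also have "\<dots> \<le> card bu + card bv" using card_image_le[OF fin(1)] by (simp add: card_cartesian_product)
    finally show "dim {x. (x, 0) \<in> W} \<le> dim U"
      using dim_slice_plus_dim_snd[of W] by (simp add: W_def[symmetric] sndW dims) (simp add: W_def dims)
  qed
  have "dim (fst ` W) = card bu + k"
  proof -
    have "bu \<union> T \<subseteq> bu'" using bu'(1) T(1) by auto
    then have "independent (bu \<union> T)" using bu'(3) independent_mono by blast
    then have "dim (fst ` W) = card (bu \<union> T)" unfolding fstW by (rule dim_span_eq_card_independent)
    also have "\<dots> = card bu + card T" using T(1) fin finST by (intro card_Un_disjoint) auto
    finally show ?thesis using T by simp
  qed
  moreover have "k = min (card bv - card bv') (card bu' - card bu)"
    using bv(1) bu'(1) fin by (simp add: k_def card_Diff_subset)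
  ultimately have "dim (fst ` W) + dim V' = min (dim U + dim V) (dim U' + dim V')"
    using le by (auto simp: dims min_def)
  moreover have "fst ` W \<subseteq> U'"
    unfolding fstW bu'(4)[symmetric] using T(1) bu'(1) by (intro span_mono) auto
  moreover have "{0} \<times> V' \<subseteq> W"
  proof -
    have "{0} \<times> bv' \<subseteq> G" using S(1) bv(1) by (force simp: G_def lift_def)
    then have "dd.p.span ({0} \<times> bv') \<subseteq> W" unfolding W_def by (rule dd.p.span_mono)
    then show ?thesis by (simp add: dd.span_Times_sing1 bv'(3))
  qed
  ultimately show thesis using slice sndW by (intro that[of W]) (auto simp: W_def)
qed

text \<open>Both correspondences are graphs of linear maps \<open>V \<rightarrow> U'/U\<close> that vanish on \<open>V'\<close>, and \<open>\<psi>\<close> lifts the difference of the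
  two maps to \<open>U'\<close>.\<close>

lemma shear_between_correspondences:
  assumes W: "dd.p.subspace W" and W': "dd.p.subspace W'"
    and slice: "{x. (x, 0) \<in> W} = {x. (x, 0) \<in> W'}" and snd: "snd ` W = snd ` W'"
    and V': "subspace V'" "{0} \<times> V' \<subseteq> W" "{0} \<times> V' \<subseteq> W'"
    and U': "subspace U'" "fst ` W \<subseteq> U'" "fst ` W' \<subseteq> U'"
  obtains \<psi> where "Vector_Spaces.linear scale scale \<psi>" "range \<psi> \<subseteq> U'" "\<And>y. y \<in> V' \<Longrightarrow> \<psi> y = 0"
    "shear \<psi> ` W = W'"
proof -
  interpret s: Vector_Spaces.linear dd.scale scale snd by (rule linear_snd)
  define V where "V = snd ` W"
  have V: "subspace V" unfolding V_def using s.subspace_image[OF W] .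
  have V'V: "V' \<subseteq> V" using V'(2) by (force simp: V_def)
  obtain bv' where bv': "bv' \<subseteq> V'" "independent bv'" "span bv' = V'"
    using extend_to_basis[OF independent_empty _ V'(1)] by auto
  have "bv' \<subseteq> V" using bv' V'V by blast
  then obtain bv where bv: "bv' \<subseteq> bv" "bv \<subseteq> V" "independent bv" "span bv = V"
    using extend_to_basis[OF bv'(2) _ V] by metis
  have "\<exists>x x'. (x, v) \<in> W \<and> (x', v) \<in> W' \<and> (v \<in> bv' \<longrightarrow> x = 0 \<and> x' = 0)" if "v \<in> bv" for v
  proof (cases "v \<in> bv'")
    case True
    then show ?thesis using V'(2,3) bv'(1) by blast
  next
    case False
    have "v \<in> snd ` W" "v \<in> snd ` W'" using that bv(2) snd V_def by auto
    then show ?thesis using False by force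
  qed
  then obtain x x' where x: "\<And>v. v \<in> bv \<Longrightarrow> (x v, v) \<in> W \<and> (x' v, v) \<in> W' \<and> (v \<in> bv' \<longrightarrow> x v = 0 \<and> x' v = 0)"
    by metis
  define \<psi> where "\<psi> = dd.construct bv (\<lambda>v. x' v - x v)"
  have lin: "Vector_Spaces.linear scale scale \<psi>" unfolding \<psi>_def by (rule dd.linear_construct[OF bv(3)])
  interpret psi: Vector_Spaces.linear scale scale \<psi> by (rule lin)
  have psi_bv: "\<psi> v = x' v - x v" if "v \<in> bv" for v
    unfolding \<psi>_def using dd.construct_basis[OF bv(3) that] .
  have range: "range \<psi> \<subseteq> U'"
  proof -
    have "range \<psi> = span ((\<lambda>v. x' v - x v) ` bv)"
      unfolding \<psi>_def by (rule dd.range_construct_eq_span[OF bv(3)])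
    also have "\<dots> \<subseteq> U'"
    proof (rule span_minimal[OF _ U'(1)])
      show "(\<lambda>v. x' v - x v) ` bv \<subseteq> U'"
        using x U'(2,3) by (force intro!: subspace_diff[OF U'(1)])
    qed
    finally show ?thesis .
  qed
  have zero: "\<psi> y = 0" if "y \<in> V'" for y
  proof -
    have "\<psi> v = 0" if "v \<in> bv'" for v using psi_bv[of v] x[of v] that bv(1) by auto
    then show ?thesis using psi.eq_0_on_span[of bv'] that bv'(3) by blast
  qed
  (* Stated with an existential quantifier, the claim is linear in y, so it spreads from the basis
     to V; the ambiguity of x lies in the common slice. *)
  have ex: "\<exists>x. (x, y) \<in> W \<and> (x + \<psi> y, y) \<in> W'" if "y \<in> V" for y
  proof -
    have "y \<in> span bv" using that bv(4) by simp
    then show ?thesis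
    proof (induction rule: span_induct_alt)
      case base
      show ?case using dd.p.subspace_0[OF W] dd.p.subspace_0[OF W'] psi.zero
        by (intro exI[of _ 0]) (simp add: zero_prod_def)
    next
      case (step c v y)
      then obtain z where z: "(z, y) \<in> W" "(z + \<psi> y, y) \<in> W'" by blast
      have 1: "dd.scale c (x v, v) + (z, y) \<in> W"
        using x[OF step(1)] z(1) by (intro dd.p.subspace_add[OF W] dd.p.subspace_scale[OF W]) auto
      have 2: "dd.scale c (x v + \<psi> v, v) + (z + \<psi> y, y) \<in> W'"
        using x[OF step(1)] psi_bv[OF step(1)] z(2)
        by (intro dd.p.subspace_add[OF W'] dd.p.subspace_scale[OF W']) auto
      show ?case
        using 1 2 by (intro exI[of _ "scale c (x v) + z"])
          (simp add: dd.scale_prod psi.add psi.scale scale_right_distrib add_ac)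
    qed
  qed
  have "shear \<psi> ` W = W'"
  proof (intro equalityI subsetI)
    fix w assume "w \<in> shear \<psi> ` W"
    then obtain x y where xy: "(x, y) \<in> W" "w = (x + \<psi> y, y)" by (auto simp: shear_def)
    then have "y \<in> V" by (force simp: V_def)
    then obtain z where z: "(z, y) \<in> W" "(z + \<psi> y, y) \<in> W'" using ex by blast
    have "(x, y) - (z, y) \<in> W" using xy z by (intro dd.p.subspace_diff[OF W])
    then have "(x - z, 0) \<in> W'" using slice by auto
    then have "(x - z, 0) + (z + \<psi> y, y) \<in> W'" using z by (intro dd.p.subspace_add[OF W'])
    then show "w \<in> W'" using xy by (simp add: algebra_simps)
  next
    fix w assume w: "w \<in> W'"
    obtain x y where xy: "w = (x, y)" by (cases w)
    have "y \<in> V" using w xy snd by (force simp: V_def)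
    then obtain z where z: "(z, y) \<in> W" "(z + \<psi> y, y) \<in> W'" using ex by blast
    have "(x, y) - (z + \<psi> y, y) \<in> W'" using xy z w by (intro dd.p.subspace_diff[OF W']) auto
    then have "(x - (z + \<psi> y), 0) \<in> W" using slice by auto
    then have "(x - (z + \<psi> y), 0) + (z, y) \<in> W" using z by (intro dd.p.subspace_add[OF W])
    then have "(x - \<psi> y, y) \<in> W" by (simp add: algebra_simps)
    then show "w \<in> shear \<psi> ` W" using xy by (intro image_eqI[of _ _ "(x - \<psi> y, y)"]) (auto simp: shear_def)
  qed
  then show thesis using that lin range zero by blast
qed

end

section \<open>The strata and their dimension invariants\<close>

lemma Y_stratum_cong:
  assumes "\<And>\<beta>. \<beta> \<in> {1..m} \<Longrightarrow> c \<beta> = c' \<beta>"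
  shows "Y_stratum s m \<nu> c = Y_stratum s m \<nu> c'"
proof -
  have "X_stratum s m \<nu> c = X_stratum s m \<nu> c'"
    unfolding X_stratum_def using assms by (auto 0 0)
  then show ?thesis by (simp add: Y_stratum_def)
qed

context doubled_space
begin

lemma subspace_snd: "dd.p.subspace W \<Longrightarrow> subspace (snd ` W)"
  by (rule module_hom.subspace_image[OF linear_snd[unfolded linear_iff_module_hom]])

text \<open>The remaining conditions on the flag \<open>Psi2 m (Ui, Uk, W)\<close> follow from those on \<open>W\<close>, for instance
  \<open>{x. (x, 0) \<in> W \<beta>} \<subseteq> fst ` W \<beta> \<subseteq> {x. (x, 0) \<in> W (\<beta> + 1)}\<close>.\<close>

lemma Y_stratum_iff:
  assumes m: "m \<ge> 1"
  shows "(Ui, Uk, W) \<in> Y_stratum scale m \<nu> c \<longleftrightarrow>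
    subspace Ui \<and> subspace Uk \<and> W \<in> extensional {1..m} \<and> dim Ui = \<nu> Vi \<and> dim Uk = \<nu> Vk \<and>
    (\<forall>\<beta>\<in>{1..m}. dd.p.subspace (W \<beta>) \<and> dim (snd ` W \<beta>) = c \<beta> \<and>
      dim {x. (x, 0) \<in> W \<beta>} + c \<beta> = \<nu> (Vj \<beta>)) \<and>
    snd ` W 1 \<subseteq> Ui \<and> snd ` W 1 \<subseteq> Uk \<and> Ui \<subseteq> {x. (x, 0) \<in> W 1} \<and> Uk \<subseteq> {x. (x, 0) \<in> W 1} \<and>
    (\<forall>\<beta>\<in>{1..<m}. fst ` W \<beta> \<subseteq> {x. (x, 0) \<in> W (\<beta> + 1)} \<and> snd ` W (\<beta> + 1) \<subseteq> {y. (0, y) \<in> W \<beta>})"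
    (is "?L \<longleftrightarrow> ?R")
proof -
  have Y: "(Ui, Uk, W) \<in> Y_variety scale m \<longleftrightarrow> subspace Ui \<and> subspace Uk \<and> W \<in> extensional {1..m} \<and>
     (\<forall>\<beta>\<in>{1..m}. dd.p.subspace (W \<beta>)) \<and>
     snd ` W 1 \<subseteq> Ui \<and> snd ` W 1 \<subseteq> Uk \<and> Ui \<subseteq> {x. (x, 0) \<in> W 1} \<and> Uk \<subseteq> {x. (x, 0) \<in> W 1} \<and>
    (\<forall>\<beta>\<in>{1..<m}. fst ` W \<beta> \<subseteq> {x. (x, 0) \<in> W (\<beta> + 1)} \<and> snd ` W (\<beta> + 1) \<subseteq> {y. (0, y) \<in> W \<beta>})"
    unfolding Y_variety_def by (simp add: subset_iff mem_Times_iff)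
  have flags: "Psi2 m (Ui, Uk, W) \<in> X_flags scale m" if y: "(Ui, Uk, W) \<in> Y_variety scale m"
  proof -
    note y = y[unfolded Y]
    have sub: "\<forall>\<beta>\<in>{1..m}. dd.p.subspace (W \<beta>)"
      and step: "\<forall>\<beta>\<in>{1..<m}. fst ` W \<beta> \<subseteq> {x. (x, 0) \<in> W (\<beta> + 1)} \<and> snd ` W (\<beta> + 1) \<subseteq> {y. (0, y) \<in> W \<beta>}"
      using y by - (elim conjE, assumption)+
    have "subspace {x. (x, 0) \<in> W \<beta>}" "subspace (snd ` W \<beta>)" if "\<beta> \<in> {1..m}" for \<beta>
      by (rule subspace_slice subspace_snd, rule bspec[OF sub that])+
    moreover have "{x. (x, 0) \<in> W \<beta>} \<subseteq> {x. (x, 0) \<in> W (\<beta> + 1)}" "snd ` W (\<beta> + 1) \<subseteq> snd ` W \<beta>"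
      if "\<beta> \<in> {1..<m}" for \<beta>
      using bspec[OF step that] by force+
    ultimately show ?thesis
      using y m by (simp add: X_flags_def)
  qed
  have "?L \<longleftrightarrow> (Ui, Uk, W) \<in> Y_variety scale m \<and> Psi2 m (Ui, Uk, W) \<in> X_flags scale m \<and>
      dim Ui = \<nu> Vi \<and> dim Uk = \<nu> Vk \<and>
      (\<forall>\<beta>\<in>{1..m}. dim (snd ` W \<beta>) = c \<beta> \<and> dim {x. (x, 0) \<in> W \<beta>} + c \<beta> = \<nu> (Vj \<beta>))"
    by (simp add: Y_stratum_def X_stratum_def)
  then have "?L \<longleftrightarrow> (Ui, Uk, W) \<in> Y_variety scale m \<and> dim Ui = \<nu> Vi \<and> dim Uk = \<nu> Vk \<and>
      (\<forall>\<beta>\<in>{1..m}. dim (snd ` W \<beta>) = c \<beta> \<and> dim {x. (x, 0) \<in> W \<beta>} + c \<beta> = \<nu> (Vj \<beta>))"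
    using flags by argo
  then show ?thesis unfolding Y ball_conj_distrib by argo
qed

lemma Y_stratumD:
  assumes m: "m \<ge> 1" and y: "(Ui, Uk, W) \<in> Y_stratum scale m \<nu> c"
  shows "subspace Ui" "subspace Uk" "W \<in> extensional {1..m}" "dim Ui = \<nu> Vi" "dim Uk = \<nu> Vk"
    and "snd ` W 1 \<subseteq> Ui" "snd ` W 1 \<subseteq> Uk" "Ui \<subseteq> {x. (x, 0) \<in> W 1}" "Uk \<subseteq> {x. (x, 0) \<in> W 1}"
    and "\<And>\<beta>. \<beta> \<in> {1..m} \<Longrightarrow> dd.p.subspace (W \<beta>)"
    and "\<And>\<beta>. \<beta> \<in> {1..m} \<Longrightarrow> dim (snd ` W \<beta>) = c \<beta>"
    and "\<And>\<beta>. \<beta> \<in> {1..m} \<Longrightarrow> dim {x. (x, 0) \<in> W \<beta>} + c \<beta> = \<nu> (Vj \<beta>)"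
    and "\<And>\<beta>. \<beta> \<in> {1..<m} \<Longrightarrow> fst ` W \<beta> \<subseteq> {x. (x, 0) \<in> W (\<beta> + 1)}"
    and "\<And>\<beta>. \<beta> \<in> {1..<m} \<Longrightarrow> snd ` W (\<beta> + 1) \<subseteq> {y. (0, y) \<in> W \<beta>}"
  using y unfolding Y_stratum_iff[OF m]
  by - ((elim conjE, assumption) | (elim conjE, drule (1) bspec, elim conjE, assumption))+

lemma Y_stratum_subset_Y_nu:
  assumes m: "m \<ge> 1"
  shows "Y_stratum scale m \<nu> c \<subseteq> Y_nu scale m \<nu>"
proof clarify
  fix Ui Uk W assume y: "(Ui, Uk, W) \<in> Y_stratum scale m \<nu> c"
  have "dd.p.dim (W \<beta>) = \<nu> (Vj \<beta>)" if "\<beta> \<in> {1..m}" for \<beta>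
    using y that dim_slice_plus_dim_snd[of "W \<beta>"] by (auto simp: Y_stratum_iff[OF m])
  then show "(Ui, Uk, W) \<in> Y_nu scale m \<nu>"
    using Y_stratumD[OF m y] y unfolding Y_nu_def Gr_product_def by (simp add: Y_stratum_def)
qed

lemma Y_nu_in_Y_stratum:
  assumes m: "m \<ge> 1" and y: "(Ui, Uk, W) \<in> Y_nu scale m \<nu>"
  defines "c \<equiv> \<lambda>\<beta>. dim (snd ` W \<beta>)"
  shows "(Ui, Uk, W) \<in> Y_stratum scale m \<nu> c"
    and "\<And>\<beta>. \<beta> \<in> {1..<m} \<Longrightarrow> c (\<beta> + 1) \<le> c \<beta>" and "c 1 \<le> min (\<nu> Vi) (\<nu> Vk)"
proof -
  have y': "subspace Ui" "subspace Uk" "W \<in> extensional {1..m}" "dim Ui = \<nu> Vi" "dim Uk = \<nu> Vk"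
    "\<And>\<beta>. \<beta> \<in> {1..m} \<Longrightarrow> dd.p.subspace (W \<beta>) \<and> dd.p.dim (W \<beta>) = \<nu> (Vj \<beta>)"
    "snd ` W 1 \<subseteq> Ui" "snd ` W 1 \<subseteq> Uk" "Ui \<times> {0} \<subseteq> W 1" "Uk \<times> {0} \<subseteq> W 1"
    "\<And>\<beta>. \<beta> \<in> {1..<m} \<Longrightarrow> (fst ` W \<beta>) \<times> {0} \<subseteq> W (\<beta> + 1) \<and> {0} \<times> (snd ` W (\<beta> + 1)) \<subseteq> W \<beta>"
    using y by (auto simp: Y_nu_def Y_variety_def Gr_product_def)
  have "dim {x. (x, 0) \<in> W \<beta>} + c \<beta> = \<nu> (Vj \<beta>)" if "\<beta> \<in> {1..m}" for \<beta>
    using dim_slice_plus_dim_snd[of "W \<beta>"] y'(6)[OF that] by (simp add: c_def)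
  then show "(Ui, Uk, W) \<in> Y_stratum scale m \<nu> c"
    unfolding Y_stratum_iff[OF m] using y' by (auto simp: c_def image_subset_iff subset_iff)
  show "c (\<beta> + 1) \<le> c \<beta>" if "\<beta> \<in> {1..<m}" for \<beta>
    unfolding c_def using y'(11)[OF that] by (intro dim_subset) force
  show "c 1 \<le> min (\<nu> Vi) (\<nu> Vk)"
    using dim_subset[OF y'(7)] dim_subset[OF y'(8)] y' by (simp add: c_def)
qed

text \<open>The neighbouring subspaces \<open>W \<beta>\<close> and \<open>W (\<beta> + 1)\<close> constrain each other only through the flag.  Hence the
  points over a fixed flag can be modified independently at each vertex.\<close>

lemma Y_stratum_replace:
  assumes m: "m \<ge> 1" and y: "(Ui, Uk, W) \<in> Y_stratum scale m \<nu> c"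
    and Ui': "subspace Ui'" "dim Ui' = \<nu> Vi" "snd ` W 1 \<subseteq> Ui'" "Ui' \<subseteq> {x. (x, 0) \<in> W 1}"
    and Uk': "subspace Uk'" "dim Uk' = \<nu> Vk" "snd ` W 1 \<subseteq> Uk'" "Uk' \<subseteq> {x. (x, 0) \<in> W 1}"
    and W': "W' \<in> extensional {1..m}"
    "\<And>\<beta>. \<beta> \<in> {1..m} \<Longrightarrow> dd.p.subspace (W' \<beta>) \<and> {x. (x, 0) \<in> W' \<beta>} = {x. (x, 0) \<in> W \<beta>} \<and> snd ` W' \<beta> = snd ` W \<beta>"
    "\<And>\<beta>. \<beta> \<in> {1..<m} \<Longrightarrow> fst ` W' \<beta> \<subseteq> {x. (x, 0) \<in> W (\<beta> + 1)} \<and> snd ` W (\<beta> + 1) \<subseteq> {y. (0, y) \<in> W' \<beta>}"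
  shows "(Ui', Uk', W') \<in> Y_stratum scale m \<nu> c"
proof -
  note D = Y_stratumD[OF m y]
  have 1: "1 \<in> {1..m}" and S: "\<And>\<beta>. \<beta> \<in> {1..<m} \<Longrightarrow> \<beta> + 1 \<in> {1..m}" using m by auto
  show ?thesis
    unfolding Y_stratum_iff[OF m]
  proof (intro conjI ballI Ui'(1,2) Uk'(1,2) W'(1))
    show "snd ` W' 1 \<subseteq> Ui'" "snd ` W' 1 \<subseteq> Uk'" "Ui' \<subseteq> {x. (x, 0) \<in> W' 1}" "Uk' \<subseteq> {x. (x, 0) \<in> W' 1}"
      using W'(2)[OF 1] Ui'(3,4) Uk'(3,4) by simp_all
    fix \<beta> assume \<beta>: "\<beta> \<in> {1..m}"
    show "dd.p.subspace (W' \<beta>)" "dim (snd ` W' \<beta>) = c \<beta>" "dim {x. (x, 0) \<in> W' \<beta>} + c \<beta> = \<nu> (Vj \<beta>)"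
      using W'(2)[OF \<beta>] D(11,12)[OF \<beta>] by simp_all
  next
    fix \<beta> assume \<beta>: "\<beta> \<in> {1..<m}"
    show "fst ` W' \<beta> \<subseteq> {x. (x, 0) \<in> W' (\<beta> + 1)}" "snd ` W' (\<beta> + 1) \<subseteq> {y. (0, y) \<in> W' \<beta>}"
      using W'(2)[OF S[OF \<beta>]] W'(3)[OF \<beta>] by simp_all
  qed
qed

text \<open>The kernel of \<open>fst\<close> on \<open>W \<beta>\<close> contains \<open>V\<^bsub>\<beta>+1\<^esub>\<close>, and its image lies in \<open>U\<^bsub>\<beta>+1\<^esub>\<close>, of dimension \<open>\<nu>\<^bsub>\<beta>+1\<^esub> - c (\<beta> + 1)\<close>.\<close>

lemma Y_stratum_dim_fst_le:
  assumes m: "m \<ge> 1" and y: "(Ui, Uk, W) \<in> Y_stratum scale m \<nu> c" and \<beta>: "\<beta> \<in> {1..<m}"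
  shows "dim (fst ` W \<beta>) + c (\<beta> + 1) \<le> min (\<nu> (Vj \<beta>)) (\<nu> (Vj (\<beta> + 1)))"
proof -
  note D = Y_stratumD[OF m y]
  have \<beta>': "\<beta> \<in> {1..m}" "\<beta> + 1 \<in> {1..m}" using \<beta> by auto
  have W: "dd.p.subspace (W \<beta>)" by (rule D(10)[OF \<beta>'(1)])
  have "dim (snd ` W (\<beta> + 1)) \<le> dim {y. (0, y) \<in> W \<beta>}" by (rule dim_subset[OF D(14)[OF \<beta>]])
  moreover have "dim (fst ` W \<beta>) \<le> dim {x. (x, 0) \<in> W (\<beta> + 1)}" by (rule dim_subset[OF D(13)[OF \<beta>]])
  moreover have "dim (snd ` W (\<beta> + 1)) = c (\<beta> + 1)" "dim {x. (x, 0) \<in> W (\<beta> + 1)} + c (\<beta> + 1) = \<nu> (Vj (\<beta> + 1))"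
    "dim (snd ` W \<beta>) = c \<beta>" "dim {x. (x, 0) \<in> W \<beta>} + c \<beta> = \<nu> (Vj \<beta>)"
    by (rule D(11,12)[OF \<beta>'(2)] D(11,12)[OF \<beta>'(1)])+
  ultimately show ?thesis
    using dim_slice_plus_dim_snd[OF W] dim_fst_plus_dim_coslice[OF W] by linarith
qed

lemma Y_stratum_dim_fst_generic:
  assumes m: "m \<ge> 1" and ne: "Y_stratum scale m \<nu> c \<noteq> {}" and \<beta>: "\<beta> \<in> {1..<m}"
  obtains Ui Uk W where "(Ui, Uk, W) \<in> Y_stratum scale m \<nu> c"
    "dim (fst ` W \<beta>) + c (\<beta> + 1) = min (\<nu> (Vj \<beta>)) (\<nu> (Vj (\<beta> + 1)))"
proof -
  obtain Ui Uk W where mem: "(Ui, Uk, W) \<in> Y_stratum scale m \<nu> c" using ne by auto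
  note D = Y_stratumD[OF m mem]
  have \<beta>': "\<beta> \<in> {1..m}" "\<beta> + 1 \<in> {1..m}" using \<beta> by auto
  note W = D(10)[OF \<beta>'(1)] D(10)[OF \<beta>'(2)]
  note sub = subspace_snd[OF W(1)] subspace_snd[OF W(2)]
  have step: "fst ` W \<beta> \<subseteq> {x. (x, 0) \<in> W (\<beta> + 1)}" "snd ` W (\<beta> + 1) \<subseteq> {y. (0, y) \<in> W \<beta>}"
    by (rule D(13,14)[OF \<beta>])+
  then have incl: "snd ` W (\<beta> + 1) \<subseteq> snd ` W \<beta>" "{x. (x, 0) \<in> W \<beta>} \<subseteq> {x. (x, 0) \<in> W (\<beta> + 1)}"
    by force+
  obtain Z where Z: "dd.p.subspace Z" "{x. (x, 0) \<in> Z} = {x. (x, 0) \<in> W \<beta>}" "snd ` Z = snd ` W \<beta>"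
    "{0} \<times> (snd ` W (\<beta> + 1)) \<subseteq> Z" "fst ` Z \<subseteq> {x. (x, 0) \<in> W (\<beta> + 1)}"
    "dim (fst ` Z) + dim (snd ` W (\<beta> + 1)) =
      min (dim {x. (x, 0) \<in> W \<beta>} + dim (snd ` W \<beta>)) (dim {x. (x, 0) \<in> W (\<beta> + 1)} + dim (snd ` W (\<beta> + 1)))"
    by (rule generic_correspondence[OF sub incl(1) subspace_slice[OF W(1)] subspace_slice[OF W(2)] incl(2)])
  have ext: "W(\<beta> := Z) \<in> extensional {1..m}" using D(3) \<beta>' by (auto simp: extensional_def)
  have "(Ui, Uk, W(\<beta> := Z)) \<in> Y_stratum scale m \<nu> c"
  proof (rule Y_stratum_replace[OF m mem _ _ _ _ _ _ _ _ ext])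
    show "dd.p.subspace ((W(\<beta> := Z)) \<gamma>) \<and> {x. (x, 0) \<in> (W(\<beta> := Z)) \<gamma>} = {x. (x, 0) \<in> W \<gamma>} \<and>
        snd ` (W(\<beta> := Z)) \<gamma> = snd ` W \<gamma>" if "\<gamma> \<in> {1..m}" for \<gamma>
      using D(10)[OF that] Z(1-3) by simp
    show "fst ` (W(\<beta> := Z)) \<gamma> \<subseteq> {x. (x, 0) \<in> W (\<gamma> + 1)} \<and> snd ` W (\<gamma> + 1) \<subseteq> {y. (0, y) \<in> (W(\<beta> := Z)) \<gamma>}"
      if "\<gamma> \<in> {1..<m}" for \<gamma>
    proof (cases "\<gamma> = \<beta>")
      case True
      then show ?thesis using Z(4,5) by auto
    next
      case False
      then show ?thesis using D(13,14)[OF that] by simp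
    qed
  qed (rule D)+
  moreover have "dim (fst ` (W(\<beta> := Z)) \<beta>) + c (\<beta> + 1) = min (\<nu> (Vj \<beta>)) (\<nu> (Vj (\<beta> + 1)))"
    using Z(6) D(11,12)[OF \<beta>'(1)] D(11,12)[OF \<beta>'(2)] by simp
  ultimately show thesis using that by blast
qed

text \<open>\<open>V\<^sub>1\<close> lies in the intersection of the two subspaces, and their sum lies in \<open>U\<^sub>1\<close>, of dimension \<open>\<nu>\<^sub>1 - c 1\<close>.\<close>

lemma Y_stratum_dim_Un_le:
  assumes m: "m \<ge> 1" and y: "(Ui, Uk, W) \<in> Y_stratum scale m \<nu> c"
  shows "dim (Ui \<union> Uk) + c 1 \<le> min (\<nu> Vi + \<nu> Vk) (\<nu> (Vj 1))"
proof -
  note D = Y_stratumD[OF m y]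
  have 1: "1 \<in> {1..m}" using m by simp
  note U = D(1,2)
  have "span (Ui \<union> Uk) = {x + y |x y. x \<in> Ui \<and> y \<in> Uk}"
    unfolding span_Un span_eq_iff[THEN iffD2, OF U(1)] span_eq_iff[THEN iffD2, OF U(2)] ..
  then have "dim (Ui \<union> Uk) + dim (Ui \<inter> Uk) = \<nu> Vi + \<nu> Vk"
    using dim_sums_Int[OF U] D(4,5) by (metis dim_span)
  moreover have "dim (snd ` W 1) \<le> dim (Ui \<inter> Uk)" by (rule dim_subset[OF Int_greatest[OF D(6,7)]])
  moreover have "dim (Ui \<union> Uk) \<le> dim {x. (x, 0) \<in> W 1}" by (rule dim_subset[OF Un_least[OF D(8,9)]])
  moreover have "dim (snd ` W 1) = c 1" "dim {x. (x, 0) \<in> W 1} + c 1 = \<nu> (Vj 1)" by (rule D(11,12)[OF 1])+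
  ultimately show ?thesis by linarith
qed

lemma Y_stratum_dim_Un_generic:
  assumes m: "m \<ge> 1" and ne: "Y_stratum scale m \<nu> c \<noteq> {}"
  obtains Ui Uk W where "(Ui, Uk, W) \<in> Y_stratum scale m \<nu> c"
    "dim (Ui \<union> Uk) + c 1 = min (\<nu> Vi + \<nu> Vk) (\<nu> (Vj 1))"
proof -
  obtain Ui Uk W where mem: "(Ui, Uk, W) \<in> Y_stratum scale m \<nu> c" using ne by auto
  note D = Y_stratumD[OF m mem]
  have 1: "1 \<in> {1..m}" using m by simp
  note W = D(10)[OF 1]
  note sub = subspace_snd[OF W]
  have incl: "snd ` W 1 \<subseteq> Ui" "snd ` W 1 \<subseteq> Uk" "Ui \<subseteq> {x. (x, 0) \<in> W 1}" "Uk \<subseteq> {x. (x, 0) \<in> W 1}"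
    by (rule D)+
  have dims: "dim Ui = \<nu> Vi" "dim Uk = \<nu> Vk" "dim (snd ` W 1) = c 1" "dim {x. (x, 0) \<in> W 1} + c 1 = \<nu> (Vj 1)"
    by (rule D D(11,12)[OF 1])+
  obtain A B where AB: "subspace A" "snd ` W 1 \<subseteq> A" "A \<subseteq> {x. (x, 0) \<in> W 1}" "dim A = \<nu> Vi"
    "subspace B" "snd ` W 1 \<subseteq> B" "B \<subseteq> {x. (x, 0) \<in> W 1}" "dim B = \<nu> Vk"
    "dim (A \<union> B) + dim (snd ` W 1) = min (\<nu> Vi + \<nu> Vk) (dim {x. (x, 0) \<in> W 1} + dim (snd ` W 1))"
  proof (rule generic_subspace_pair[OF sub subspace_slice[OF W]])
    show "snd ` W 1 \<subseteq> {x. (x, 0) \<in> W 1}" using incl by blast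
    show "dim (snd ` W 1) \<le> \<nu> Vi" "\<nu> Vi \<le> dim {x. (x, 0) \<in> W 1}"
      using dim_subset[OF incl(1)] dim_subset[OF incl(3)] dims by simp_all
    show "dim (snd ` W 1) \<le> \<nu> Vk" "\<nu> Vk \<le> dim {x. (x, 0) \<in> W 1}"
      using dim_subset[OF incl(2)] dim_subset[OF incl(4)] dims by simp_all
  qed
  have "(A, B, W) \<in> Y_stratum scale m \<nu> c"
    by (rule Y_stratum_replace[OF m mem AB(1,4,2,3,5,8,6,7) D(3)]) (use D(10,13,14) in blast)+
  moreover have "dim (A \<union> B) + c 1 = min (\<nu> Vi + \<nu> Vk) (\<nu> (Vj 1))" using AB(9) dims by simp
  ultimately show thesis using that by blast
qed

lemma closure_of_dim_le:
  assumes op: "\<And>R. openin (Gr_zariski scale Basis m \<nu>) {y \<in> Gr_product scale m \<nu>. R \<le> d y}"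
    and le: "\<And>y. y \<in> S \<Longrightarrow> d y \<le> r"
    and y: "y \<in> Y_zariski scale Basis m \<nu> closure_of S"
  shows "d y \<le> (r :: nat)"
proof (rule ccontr)
  assume "\<not> d y \<le> r"
  let ?A = "{y \<in> Gr_product scale m \<nu>. Suc r \<le> d y} \<inter> Y_nu scale m \<nu>"
  have "openin (Y_zariski scale Basis m \<nu>) ?A"
    unfolding Y_zariski_def using op by (auto simp: openin_subtopology)
  moreover have "y \<in> ?A"
    using y \<open>\<not> d y \<le> r\<close> by (auto simp: in_closure_of topspace_Y_zariski Y_nu_def)
  ultimately have "\<exists>z. z \<in> S \<and> z \<in> ?A"
    using y[unfolded in_closure_of, THEN conjunct2, rule_format, of ?A] by fast
  then obtain z where "z \<in> S" "z \<in> ?A" by (elim exE conjE)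
  then show False using le[of z] by auto
qed

text \<open>Semicontinuity of \<open>dim V\<^sub>\<beta>\<close> gives one inequality.  The other one comes from \<open>dim (U\<^sub>i + U\<^sub>k)\<close> if \<open>\<beta> = 1\<close>, and from
  \<open>dim (fst ` W (\<beta> - 1))\<close> otherwise, at a point where this dimension is maximal.\<close>

lemma Y_stratum_separated:
  assumes m: "m \<ge> 1" and ne: "Y_stratum scale m \<nu> c \<noteq> {}"
    and sub: "Y_stratum scale m \<nu> c \<subseteq> Y_zariski scale Basis m \<nu> closure_of Y_stratum scale m \<nu> c'"
    and \<beta>: "\<beta> \<in> {1..m}"
  shows "c \<beta> = c' \<beta>"
proof (rule antisym)
  obtain Ui Uk W where y: "(Ui, Uk, W) \<in> Y_stratum scale m \<nu> c" using ne by auto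
  have "dim (snd ` snd (snd (Ui, Uk, W)) \<beta>) \<le> c' \<beta>"
  proof (rule closure_of_dim_le[OF openin_dim_image_ge[OF linear_snd \<beta>]])
    show "(Ui, Uk, W) \<in> Y_zariski scale Basis m \<nu> closure_of Y_stratum scale m \<nu> c'" using y sub by blast
    show "dim (snd ` snd (snd y) \<beta>) \<le> c' \<beta>" if "y \<in> Y_stratum scale m \<nu> c'" for y
      using that \<beta> by (cases y) (simp add: Y_stratum_iff[OF m])
  qed
  then show "c \<beta> \<le> c' \<beta>" using y \<beta> by (simp add: Y_stratum_iff[OF m])
next
  have "\<beta> = 1 \<or> (\<beta> - 1 \<in> {1..<m} \<and> \<beta> = \<beta> - 1 + 1)" using \<beta> by auto
  then consider "\<beta> = 1" | \<gamma> where "\<gamma> \<in> {1..<m}" "\<beta> = \<gamma> + 1" by blast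
  then show "c' \<beta> \<le> c \<beta>"
  proof cases
    case 1
    let ?r = "min (\<nu> Vi + \<nu> Vk) (\<nu> (Vj 1))"
    obtain Ui Uk W where y: "(Ui, Uk, W) \<in> Y_stratum scale m \<nu> c" "dim (Ui \<union> Uk) + c 1 = ?r"
      using Y_stratum_dim_Un_generic[OF m ne] .
    have "dim (fst (Ui, Uk, W) \<union> fst (snd (Ui, Uk, W))) \<le> ?r - c' 1"
    proof (rule closure_of_dim_le[OF openin_dim_Un_ge])
      show "(Ui, Uk, W) \<in> Y_zariski scale Basis m \<nu> closure_of Y_stratum scale m \<nu> c'" using y sub by blast
      show "dim (fst y \<union> fst (snd y)) \<le> ?r - c' 1" if "y \<in> Y_stratum scale m \<nu> c'" for y
      proof -
        have "dim (fst y \<union> fst (snd y)) + c' 1 \<le> ?r"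
          by (rule Y_stratum_dim_Un_le[OF m, of _ _ "snd (snd y)"]) (use that in simp)
        then show ?thesis by linarith
      qed
    qed
    moreover have "c' 1 \<le> ?r"
    proof -
      obtain y where "y \<in> Y_stratum scale m \<nu> c'"
        using y(1) sub by (metis closure_of_empty empty_iff equals0I subsetD)
      then show ?thesis
        using Y_stratum_dim_Un_le[OF m, of "fst y" "fst (snd y)" "snd (snd y)" \<nu> c'] by simp
    qed
    ultimately show ?thesis using y(2) unfolding 1 fst_conv snd_conv by linarith
  next
    case 2
    let ?r = "min (\<nu> (Vj \<gamma>)) (\<nu> (Vj (\<gamma> + 1)))"
    have \<gamma>: "\<gamma> \<in> {1..m}" using 2 by simp
    obtain Ui Uk W where y: "(Ui, Uk, W) \<in> Y_stratum scale m \<nu> c" "dim (fst ` W \<gamma>) + c (\<gamma> + 1) = ?r"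
      using Y_stratum_dim_fst_generic[OF m ne 2(1)] .
    have "dim (fst ` snd (snd (Ui, Uk, W)) \<gamma>) \<le> ?r - c' (\<gamma> + 1)"
    proof (rule closure_of_dim_le[OF openin_dim_image_ge[OF linear_fst \<gamma>]])
      show "(Ui, Uk, W) \<in> Y_zariski scale Basis m \<nu> closure_of Y_stratum scale m \<nu> c'" using y sub by blast
      show "dim (fst ` snd (snd y) \<gamma>) \<le> ?r - c' (\<gamma> + 1)" if "y \<in> Y_stratum scale m \<nu> c'" for y
      proof -
        have "dim (fst ` snd (snd y) \<gamma>) + c' (\<gamma> + 1) \<le> ?r"
          by (rule Y_stratum_dim_fst_le[OF m _ 2(1), of "fst y" "fst (snd y)"]) (use that in simp)
        then show ?thesis by linarith
      qed
    qed
    moreover have "c' (\<gamma> + 1) \<le> ?r"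
    proof -
      obtain y where "y \<in> Y_stratum scale m \<nu> c'"
        using y(1) sub by (metis closure_of_empty empty_iff equals0I subsetD)
      then show ?thesis
        using Y_stratum_dim_fst_le[OF m _ 2(1), of "fst y" "fst (snd y)" "snd (snd y)" \<nu> c'] by simp
    qed
    ultimately show ?thesis using y(2) unfolding 2(2) fst_conv snd_conv by linarith
  qed
qed

end

section \<open>Irreducibility of the strata\<close>

context doubled_space
begin

lemma linear_map_prod:
  assumes "Vector_Spaces.linear scale scale g"
  shows "Vector_Spaces.linear dd.scale dd.scale (map_prod g g)"
proof -
  interpret g: Vector_Spaces.linear scale scale g by (rule assms)
  show ?thesis by unfold_locales (auto simp: g.add g.scale dd.scale_prod)
qed

lemma linear_shear:
  assumes "Vector_Spaces.linear scale scale \<psi>"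
  shows "Vector_Spaces.linear dd.scale dd.scale (shear \<psi>)"
proof -
  interpret psi: Vector_Spaces.linear scale scale \<psi> by (rule assms)
  show ?thesis
    by unfold_locales (auto simp: shear_def psi.add psi.scale dd.scale_prod scale_right_distrib add_ac)
qed

lemma inj_shear: "inj (shear \<psi> :: 'v \<times> 'v \<Rightarrow> _)"
  by (auto simp: inj_def shear_def)

lemma linear_multiple:
  assumes "Vector_Spaces.linear scale scale \<psi>"
  shows "Vector_Spaces.linear scale scale (\<lambda>y. scale t (\<psi> y))"
  by (rule dd.linear_compose_scale_right[OF assms])

lemma dim_image_inj:
  assumes "Vector_Spaces.linear scale scale g" "inj g"
  shows "dim (g ` S) = dim S"
proof -
  show ?thesis using assms(2) by (intro dd.dim_image_eq[OF assms(1)]) (auto intro: inj_on_subset)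
qed

lemma subspace_image_linear:
  "Vector_Spaces.linear scale scale g \<Longrightarrow> subspace S \<Longrightarrow> subspace (g ` S)"
  by (rule module_hom.subspace_image) (simp add: linear_iff_module_hom)

lemma subspace_image_linear_pair:
  "Vector_Spaces.linear dd.scale dd.scale g \<Longrightarrow> dd.p.subspace S \<Longrightarrow> dd.p.subspace (g ` S)"
  by (rule module_hom.subspace_image) (simp add: linear_iff_module_hom)

lemma map_prod_slices:
  assumes "inj g" "g 0 = 0"
  shows "{x. (x, 0) \<in> map_prod g g ` W} = g ` {x. (x, 0) \<in> W}"
    and "{y. (0, y) \<in> map_prod g g ` W} = g ` {y. (0, y) \<in> W}"
    and "snd ` map_prod g g ` W = g ` snd ` W" and "fst ` map_prod g g ` W = g ` fst ` W"
proof -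
  have [simp]: "g x = 0 \<longleftrightarrow> x = 0" "0 = g x \<longleftrightarrow> x = 0" for x using assms by (metis injD)+
  show "{x. (x, 0) \<in> map_prod g g ` W} = g ` {x. (x, 0) \<in> W}" by force
  show "{y. (0, y) \<in> map_prod g g ` W} = g ` {y. (0, y) \<in> W}" by force
  show "snd ` map_prod g g ` W = g ` snd ` W" "fst ` map_prod g g ` W = g ` fst ` W"
    by (simp_all add: image_image)
qed

lemma Y_stratum_automorphism:
  assumes m: "m \<ge> 1" and y: "(Ui, Uk, W) \<in> Y_stratum scale m \<nu> c"
    and g: "Vector_Spaces.linear scale scale g" "inj g"
  shows "(g ` Ui, g ` Uk, \<lambda>\<beta>\<in>{1..m}. map_prod g g ` W \<beta>) \<in> Y_stratum scale m \<nu> c"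
proof -
  interpret g: Vector_Spaces.linear scale scale g by (rule g(1))
  note D = Y_stratumD[OF m y]
  note sl = map_prod_slices[OF g(2) g.zero]
  have 1: "1 \<in> {1..m}" and S: "\<And>\<beta>. \<beta> \<in> {1..<m} \<Longrightarrow> \<beta> \<in> {1..m} \<and> \<beta> + 1 \<in> {1..m}" using m by auto
  show ?thesis
    unfolding Y_stratum_iff[OF m]
  proof (intro conjI ballI)
    show "subspace (g ` Ui)" "subspace (g ` Uk)" using subspace_image_linear[OF g(1)] D(1,2) by auto
    show "dim (g ` Ui) = \<nu> Vi" "dim (g ` Uk) = \<nu> Vk" using dim_image_inj[OF g] D(4,5) by auto
    let ?W = "\<lambda>\<beta>\<in>{1..m}. map_prod g g ` W \<beta>"
    show "?W \<in> extensional {1..m}" by simp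
    show "snd ` ?W 1 \<subseteq> g ` Ui" "snd ` ?W 1 \<subseteq> g ` Uk" "g ` Ui \<subseteq> {x. (x, 0) \<in> ?W 1}" "g ` Uk \<subseteq> {x. (x, 0) \<in> ?W 1}"
      unfolding restrict_apply'[OF 1] sl by (intro image_mono D)+
    fix \<beta> assume \<beta>: "\<beta> \<in> {1..m}"
    show "dd.p.subspace (?W \<beta>)"
      unfolding restrict_apply'[OF \<beta>] by (rule subspace_image_linear_pair[OF linear_map_prod[OF g(1)] D(10)[OF \<beta>]])
    show "dim (snd ` ?W \<beta>) = c \<beta>" "dim {x. (x, 0) \<in> ?W \<beta>} + c \<beta> = \<nu> (Vj \<beta>)"
      unfolding restrict_apply'[OF \<beta>] sl dim_image_inj[OF g] by (rule D(11,12)[OF \<beta>])+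
  next
    let ?W = "\<lambda>\<beta>\<in>{1..m}. map_prod g g ` W \<beta>"
    fix \<beta> assume \<beta>: "\<beta> \<in> {1..<m}"
    show "fst ` ?W \<beta> \<subseteq> {x. (x, 0) \<in> ?W (\<beta> + 1)}" "snd ` ?W (\<beta> + 1) \<subseteq> {y. (0, y) \<in> ?W \<beta>}"
      unfolding restrict_apply'[OF S[OF \<beta>, THEN conjunct1]] restrict_apply'[OF S[OF \<beta>, THEN conjunct2]] sl
      by (intro image_mono D(13,14)[OF \<beta>])+
  qed
qed

lemma polynomial_path_Pair:
  assumes u: "polynomial_path scale Basis u" and v: "polynomial_path scale Basis v"
  shows "polynomial_path dd.scale dd.Basis_pair (\<lambda>t. (u t, v t))"
proof -
  have sum: "polynomial_path dd.scale dd.Basis_pair (\<lambda>t. \<Sum>b\<in>B. w b t)"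
    if "\<And>b. b \<in> B \<Longrightarrow> polynomial_path dd.scale dd.Basis_pair (w b)" for B and w :: "'v \<Rightarrow> 'a \<Rightarrow> 'v \<times> 'v"
    using that by (induction B rule: infinite_finite_induct)
      (auto intro: dd.p.polynomial_path_const dd.p.polynomial_path_add)
  have "(u t, v t) = (\<Sum>b\<in>Basis. dd.scale (representation Basis (u t) b) (b, 0)) +
      (\<Sum>b\<in>Basis. dd.scale (representation Basis (v t) b) (0, b))" for t
    using rep_sum[of "u t"] rep_sum[of "v t"] by (simp add: dd.scale_prod sum_prod)
  then show ?thesis
    using u v unfolding polynomial_path_def[of scale]
    by (simp only:) (intro dd.p.polynomial_path_add sum dd.p.polynomial_path_scale
      dd.p.polynomial_path_const, auto)
qed

lemma Y_stratum_connecting_automorphism: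
  assumes m: "m \<ge> 1" and y: "(Ui, Uk, W) \<in> Y_stratum scale m \<nu> c" and y': "(Ui', Uk', W') \<in> Y_stratum scale m \<nu> c"
  obtains g where "Vector_Spaces.linear scale scale g" "bij g"
    "\<And>\<beta>. \<beta> \<in> {1..m} \<Longrightarrow> g ` {x. (x, 0) \<in> W \<beta>} = {x. (x, 0) \<in> W' \<beta>}"
    "\<And>\<beta>. \<beta> \<in> {1..m} \<Longrightarrow> g ` snd ` W \<beta> = snd ` W' \<beta>"
proof -
  \<comment> \<open>The flag \<open>V\<^sub>m \<subseteq> \<dots> \<subseteq> V\<^sub>1 \<subseteq> U\<^sub>1 \<subseteq> \<dots> \<subseteq> U\<^sub>m\<close>, numbered from \<open>0\<close>.\<close>
  define S where "S W n = (if n < m then snd ` W (m - n) else {x. (x, 0) \<in> W (n - m + 1)})"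
    for W :: "nat \<Rightarrow> ('v \<times> 'v) set" and n
  have step: "S Z n \<subseteq> S Z (Suc n)" if z: "(A, B, Z) \<in> Y_stratum scale m \<nu> c" and n: "n < 2 * m - 1" for A B Z n
  proof -
    note D = Y_stratumD[OF m z]
    consider "Suc n < m" | "Suc n = m" | "n \<ge> m" by linarith
    then show ?thesis
    proof cases
      case 1
      then have "m - Suc n \<in> {1..<m}" "m - n = m - Suc n + 1" by auto
      then have "snd ` W (m - n) \<subseteq> {y. (0, y) \<in> W (m - Suc n)}" if "W = Z" for W using D(14) that by simp
      then show ?thesis using 1 by (force simp: S_def)
    next
      case 2
      then have "m - n = 1" "Suc n - m + 1 = 1" by auto
      then show ?thesis using 2 order_trans[OF D(6,8)] by (simp add: S_def)
    next
      case 3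
      then have "n - m + 1 \<in> {1..<m}" "Suc n - m + 1 = (n - m + 1) + 1" using n by auto
      then have "fst ` Z (n - m + 1) \<subseteq> {x. (x, 0) \<in> Z (Suc n - m + 1)}" using D(13) by metis
      then show ?thesis using 3 by (force simp: S_def)
    qed
  qed
  have basic: "subspace (S Z n) \<and> dim (S Z n) = (if n < m then c (m - n) else \<nu> (Vj (n - m + 1)) - c (n - m + 1))"
    if z: "(A, B, Z) \<in> Y_stratum scale m \<nu> c" and n: "n \<le> 2 * m - 1" for A B Z n
  proof -
    note D = Y_stratumD[OF m z]
    show ?thesis
    proof (cases "n < m")
      case True
      then have "m - n \<in> {1..m}" by auto
      then show ?thesis using True D(11) subspace_snd[OF D(10)] by (simp add: S_def)
    next
      case False
      then have "n - m + 1 \<in> {1..m}" using n m by auto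
      then show ?thesis using False D(12)[of "n - m + 1"] subspace_slice[OF D(10)] by (simp add: S_def)
    qed
  qed
  have "\<exists>g. Vector_Spaces.linear scale scale g \<and> bij g \<and> (\<forall>n\<le>2 * m - 1. g ` S W n = S W' n)"
    by (rule automorphism_between_flags) (use basic[OF y] basic[OF y'] step[OF y] step[OF y'] in auto)
  then obtain g where g: "Vector_Spaces.linear scale scale g" "bij g" "\<And>n. n \<le> 2 * m - 1 \<Longrightarrow> g ` S W n = S W' n"
    by blast
  show thesis
  proof (rule that[OF g(1,2)])
    fix \<beta> assume \<beta>: "\<beta> \<in> {1..m}"
    then have "m + \<beta> - 1 \<le> 2 * m - 1" "\<not> m + \<beta> - 1 < m" "m + \<beta> - 1 - m + 1 = \<beta>" by auto
    then show "g ` {x. (x, 0) \<in> W \<beta>} = {x. (x, 0) \<in> W' \<beta>}"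
      using g(3)[of "m + \<beta> - 1"] by (simp add: S_def)
    have "m - \<beta> \<le> 2 * m - 1" "m - \<beta> < m" "m - (m - \<beta>) = \<beta>" using \<beta> by auto
    then show "g ` snd ` W \<beta> = snd ` W' \<beta>" using g(3)[of "m - \<beta>"] by (simp add: S_def)
  qed
qed

lemma interpolation_fixes: "interpolation scale h t x = x" if "h x = x"
  using that by (simp add: interpolation_def scale_left_distrib[symmetric])

lemma interpolation_image_subset:
  assumes "subspace U" "h ` U \<subseteq> U"
  shows "interpolation scale h t ` U \<subseteq> U"
  using assms by (auto simp: interpolation_def intro!: subspace_add subspace_scale)

lemma same_flag_connecting_data:
  assumes m: "m \<ge> 1" and y: "(Ui, Uk, W) \<in> Y_stratum scale m \<nu> c" and y': "(Ui', Uk', W') \<in> Y_stratum scale m \<nu> c"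
    and slice: "\<And>\<beta>. \<beta> \<in> {1..m} \<Longrightarrow> {x. (x, 0) \<in> W' \<beta>} = {x. (x, 0) \<in> W \<beta>}"
    and snd: "\<And>\<beta>. \<beta> \<in> {1..m} \<Longrightarrow> snd ` W' \<beta> = snd ` W \<beta>"
  obtains h k \<psi> where
    "Vector_Spaces.linear scale scale h" "bij h" "\<And>x. x \<in> snd ` W 1 \<Longrightarrow> h x = x" "h ` {x. (x, 0) \<in> W 1} = {x. (x, 0) \<in> W 1}" "h ` Ui = Ui'"
    "Vector_Spaces.linear scale scale k" "bij k" "\<And>x. x \<in> snd ` W 1 \<Longrightarrow> k x = x" "k ` {x. (x, 0) \<in> W 1} = {x. (x, 0) \<in> W 1}" "k ` Uk = Uk'"
    "\<And>\<beta>. \<beta> \<in> {1..m} \<Longrightarrow> Vector_Spaces.linear scale scale (\<psi> \<beta>)" "\<And>\<beta>. \<beta> \<in> {1..m} \<Longrightarrow> shear (\<psi> \<beta>) ` W \<beta> = W' \<beta>"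
    "\<And>\<beta>. \<beta> \<in> {1..<m} \<Longrightarrow> range (\<psi> \<beta>) \<subseteq> {x. (x, 0) \<in> W (\<beta> + 1)}"
    "\<And>\<beta> y. \<beta> \<in> {1..<m} \<Longrightarrow> y \<in> snd ` W (\<beta> + 1) \<Longrightarrow> \<psi> \<beta> y = 0"
proof -
  note D = Y_stratumD[OF m y]
  note D' = Y_stratumD[OF m y']
  have 1: "1 \<in> {1..m}" using m by simp
  note V1 = subspace_snd[OF D(10)[OF 1]]
  note U1 = subspace_slice[OF D(10)[OF 1]]
  obtain h where h: "Vector_Spaces.linear scale scale h" "bij h" "\<And>x. x \<in> snd ` W 1 \<Longrightarrow> h x = x"
    "h ` Ui = Ui'" "h ` {x. (x, 0) \<in> W 1} = {x. (x, 0) \<in> W 1}"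
    by (rule automorphism_between_subspaces[OF V1 D(1) D(6) D(8) D'(1) _ _ U1])
      (use D'(6,8,4) D(4) slice[OF 1] snd[OF 1] in auto)
  obtain k where k: "Vector_Spaces.linear scale scale k" "bij k" "\<And>x. x \<in> snd ` W 1 \<Longrightarrow> k x = x"
    "k ` Uk = Uk'" "k ` {x. (x, 0) \<in> W 1} = {x. (x, 0) \<in> W 1}"
    by (rule automorphism_between_subspaces[OF V1 D(2) D(7) D(9) D'(2) _ _ U1])
      (use D'(7,9,5) D(5) slice[OF 1] snd[OF 1] in auto)
  have "\<exists>\<psi>. Vector_Spaces.linear scale scale \<psi> \<and> shear \<psi> ` W \<beta> = W' \<beta> \<and>
      (\<beta> < m \<longrightarrow> range \<psi> \<subseteq> {x. (x, 0) \<in> W (\<beta> + 1)} \<and> (\<forall>y\<in>snd ` W (\<beta> + 1). \<psi> y = 0))"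
    if \<beta>: "\<beta> \<in> {1..m}" for \<beta>
  proof (cases "\<beta> < m")
    case True
    then have \<beta>1: "\<beta> \<in> {1..<m}" "\<beta> + 1 \<in> {1..m}" using \<beta> by auto
    have "snd ` W (\<beta> + 1) \<subseteq> {y. (0, y) \<in> W \<beta>}" "snd ` W (\<beta> + 1) \<subseteq> {y. (0, y) \<in> W' \<beta>}"
      using D(14)[OF \<beta>1(1)] D'(14)[OF \<beta>1(1)] snd[OF \<beta>1(2)] by simp_all
    then have co: "{0} \<times> snd ` W (\<beta> + 1) \<subseteq> W \<beta>" "{0} \<times> snd ` W (\<beta> + 1) \<subseteq> W' \<beta>" by auto
    have U': "fst ` W' \<beta> \<subseteq> {x. (x, 0) \<in> W (\<beta> + 1)}" using D'(13)[OF \<beta>1(1)] slice[OF \<beta>1(2)] by simp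
    obtain \<psi> where "Vector_Spaces.linear scale scale \<psi>" "range \<psi> \<subseteq> {x. (x, 0) \<in> W (\<beta> + 1)}"
      "\<And>y. y \<in> snd ` W (\<beta> + 1) \<Longrightarrow> \<psi> y = 0" "shear \<psi> ` W \<beta> = W' \<beta>"
      by (rule shear_between_correspondences[OF D(10)[OF \<beta>] D'(10)[OF \<beta>] slice[OF \<beta>, symmetric]
        snd[OF \<beta>, symmetric] subspace_snd[OF D(10)[OF \<beta>1(2)]] co subspace_slice[OF D(10)[OF \<beta>1(2)]]
        D(13)[OF \<beta>1(1)] U']) blast
    then show ?thesis by blast
  next
    case False
    (* At the end of the graph the conventions V = 0 and U = D for index m + 1 apply. *)
    have co: "{0} \<times> {0} \<subseteq> W \<beta>" "{0} \<times> {0} \<subseteq> W' \<beta>"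
      using dd.p.subspace_0[OF D(10)[OF \<beta>]] dd.p.subspace_0[OF D'(10)[OF \<beta>]] by (auto simp: zero_prod_def)
    obtain \<psi> where "Vector_Spaces.linear scale scale \<psi>" "shear \<psi> ` W \<beta> = W' \<beta>"
      by (rule shear_between_correspondences[OF D(10)[OF \<beta>] D'(10)[OF \<beta>] slice[OF \<beta>, symmetric]
        snd[OF \<beta>, symmetric] subspace_single_0 co subspace_UNIV subset_UNIV subset_UNIV]) blast
    then show ?thesis using False by blast
  qed
  then obtain \<psi> where \<psi>: "\<And>\<beta>. \<beta> \<in> {1..m} \<Longrightarrow> Vector_Spaces.linear scale scale (\<psi> \<beta>) \<and> shear (\<psi> \<beta>) ` W \<beta> = W' \<beta> \<and>
      (\<beta> < m \<longrightarrow> range (\<psi> \<beta>) \<subseteq> {x. (x, 0) \<in> W (\<beta> + 1)} \<and> (\<forall>y\<in>snd ` W (\<beta> + 1). \<psi> \<beta> y = 0))"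
    by metis
  have lt: "\<beta> \<in> {1..m} \<and> \<beta> < m" if "\<beta> \<in> {1..<m}" for \<beta> using that by simp
  show thesis
  proof (rule that[OF h(1,2,3,5,4) k(1,2,3,5,4)])
    show "Vector_Spaces.linear scale scale (\<psi> \<beta>)" "shear (\<psi> \<beta>) ` W \<beta> = W' \<beta>" if "\<beta> \<in> {1..m}" for \<beta>
      using \<psi>[OF that] by - (elim conjE, assumption)+
    show "range (\<psi> \<beta>) \<subseteq> {x. (x, 0) \<in> W (\<beta> + 1)}" if "\<beta> \<in> {1..<m}" for \<beta>
      using \<psi>[of \<beta>] lt[OF that] by simp
    show "\<psi> \<beta> y = 0" if "\<beta> \<in> {1..<m}" "y \<in> snd ` W (\<beta> + 1)" for \<beta> y
      using \<psi>[of \<beta>] lt[OF that(1)] that(2) by fast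
  qed
qed

text \<open>These moves preserve the flag, so the result satisfies the incidence conditions again.\<close>

lemma Y_stratum_move_in_fibre:
  assumes m: "m \<ge> 1" and y: "(Ui, Uk, W) \<in> Y_stratum scale m \<nu> c"
    and h: "Vector_Spaces.linear scale scale h" "inj h" "\<And>x. x \<in> snd ` W 1 \<Longrightarrow> h x = x" "h ` {x. (x, 0) \<in> W 1} \<subseteq> {x. (x, 0) \<in> W 1}"
    and k: "Vector_Spaces.linear scale scale k" "inj k" "\<And>x. x \<in> snd ` W 1 \<Longrightarrow> k x = x" "k ` {x. (x, 0) \<in> W 1} \<subseteq> {x. (x, 0) \<in> W 1}"
    and \<psi>: "\<And>\<beta>. \<beta> \<in> {1..m} \<Longrightarrow> Vector_Spaces.linear scale scale (\<psi> \<beta>)"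
    "\<And>\<beta>. \<beta> \<in> {1..<m} \<Longrightarrow> range (\<psi> \<beta>) \<subseteq> {x. (x, 0) \<in> W (\<beta> + 1)}"
    "\<And>\<beta> y. \<beta> \<in> {1..<m} \<Longrightarrow> y \<in> snd ` W (\<beta> + 1) \<Longrightarrow> \<psi> \<beta> y = 0"
  shows "(h ` Ui, k ` Uk, \<lambda>\<beta>\<in>{1..m}. shear (\<psi> \<beta>) ` W \<beta>) \<in> Y_stratum scale m \<nu> c"
proof -
  note D = Y_stratumD[OF m y]
  let ?W = "\<lambda>\<beta>\<in>{1..m}. shear (\<psi> \<beta>) ` W \<beta>"
  have fix_V1: "snd ` W 1 \<subseteq> h ` Ui" "snd ` W 1 \<subseteq> k ` Uk"
    by (rule subsetI, rule image_eqI, rule h(3)[symmetric] k(3)[symmetric], assumption,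
      erule subsetD[OF D(6)] subsetD[OF D(7)])+
  have in_U1: "h ` Ui \<subseteq> {x. (x, 0) \<in> W 1}" "k ` Uk \<subseteq> {x. (x, 0) \<in> W 1}"
    by (rule order_trans[OF image_mono[OF D(8)] h(4)] order_trans[OF image_mono[OF D(9)] k(4)])+
  show ?thesis
  proof (rule Y_stratum_replace[OF m y _ _ fix_V1(1) in_U1(1) _ _ fix_V1(2) in_U1(2)])
    show "subspace (h ` Ui)" "subspace (k ` Uk)"
      by (rule subspace_image_linear, fact, rule D)+
    show "dim (h ` Ui) = \<nu> Vi" "dim (k ` Uk) = \<nu> Vk"
      using dim_image_inj[OF h(1,2)] dim_image_inj[OF k(1,2)] D(4,5) by simp_all
    show "?W \<in> extensional {1..m}" by simp
  next
    fix \<beta> assume \<beta>: "\<beta> \<in> {1..m}"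
    have "\<psi> \<beta> 0 = 0" using \<psi>(1)[OF \<beta>] by (simp add: linear_iff_module_hom module_hom.zero)
    then have "{x. (x, 0) \<in> shear (\<psi> \<beta>) ` W \<beta>} = {x. (x, 0) \<in> W \<beta>}" by (force simp: shear_def)
    moreover have "snd ` shear (\<psi> \<beta>) ` W \<beta> = snd ` W \<beta>" by (force simp: shear_def)
    ultimately show "dd.p.subspace (?W \<beta>) \<and> {x. (x, 0) \<in> ?W \<beta>} = {x. (x, 0) \<in> W \<beta>} \<and> snd ` ?W \<beta> = snd ` W \<beta>"
      unfolding restrict_apply'[OF \<beta>]
      using subspace_image_linear_pair[OF linear_shear[OF \<psi>(1)[OF \<beta>]] D(10)[OF \<beta>]] by blast
  next
    fix \<beta> assume \<beta>: "\<beta> \<in> {1..<m}"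
    then have \<beta>': "\<beta> \<in> {1..m}" "\<beta> + 1 \<in> {1..m}" by auto
    have "fst ` shear (\<psi> \<beta>) ` W \<beta> \<subseteq> {x. (x, 0) \<in> W (\<beta> + 1)}"
    proof (clarsimp simp: shear_def)
      fix x y assume "(x, y) \<in> W \<beta>"
      then have "x \<in> {x. (x, 0) \<in> W (\<beta> + 1)}" using D(13)[OF \<beta>] by force
      moreover have "\<psi> \<beta> y \<in> {x. (x, 0) \<in> W (\<beta> + 1)}" using \<psi>(2)[OF \<beta>] by blast
      ultimately show "(x + \<psi> \<beta> y, 0) \<in> W (Suc \<beta>)"
        using subspace_add[OF subspace_slice[OF D(10)[OF \<beta>'(2)]]] by simp
    qed
    moreover have "snd ` W (\<beta> + 1) \<subseteq> {y. (0, y) \<in> shear (\<psi> \<beta>) ` W \<beta>}"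
    proof
      fix y assume y: "y \<in> snd ` W (\<beta> + 1)"
      then have "(0, y) \<in> W \<beta>" using D(14)[OF \<beta>] by blast
      then have "shear (\<psi> \<beta>) (0, y) \<in> shear (\<psi> \<beta>) ` W \<beta>" by blast
      then show "y \<in> {y. (0, y) \<in> shear (\<psi> \<beta>) ` W \<beta>}" using \<psi>(3)[OF \<beta> y] by (simp add: shear_def)
    qed
    ultimately show "fst ` ?W \<beta> \<subseteq> {x. (x, 0) \<in> W (\<beta> + 1)} \<and> snd ` W (\<beta> + 1) \<subseteq> {y. (0, y) \<in> ?W \<beta>}"
      unfolding restrict_apply'[OF \<beta>'(1)] by blast
  qed
qed

text \<open>The flag is moved by \<open>g\<close>; what remains is to connect two points over the same flag, which \<open>h\<close>, \<open>k\<close> and the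
  shears \<open>\<psi>\<close> do.  All of them are interpolated at the same time.\<close>

lemma irreducible_in_Y_stratum:
  assumes inf: "infinite (UNIV :: 'a set)" and m: "m \<ge> 1" and ne: "Y_stratum scale m \<nu> c \<noteq> {}"
  shows "irreducible_in (Gr_zariski scale Basis m \<nu>) (Y_stratum scale m \<nu> c)"
proof (rule irreducible_in_of_pairs[OF _ ne])
  have Gr: "Y_stratum scale m \<nu> c \<subseteq> Gr_product scale m \<nu>"
    using Y_stratum_subset_Y_nu[OF m] by (auto simp: Y_nu_def)
  then show "Y_stratum scale m \<nu> c \<subseteq> topspace (Gr_zariski scale Basis m \<nu>)"
    by (simp add: topspace_Gr_zariski)
  fix y y' assume mem: "y \<in> Y_stratum scale m \<nu> c" "y' \<in> Y_stratum scale m \<nu> c"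
  obtain Ui Uk W where y_eq: "y = (Ui, Uk, W)" by (cases y) auto
  obtain Ui' Uk' W' where y'_eq: "y' = (Ui', Uk', W')" by (cases y') auto
  note y = mem(1)[unfolded y_eq]
  note y' = mem(2)[unfolded y'_eq]
  note D = Y_stratumD[OF m y]
  note D' = Y_stratumD[OF m y']
  obtain g where g: "Vector_Spaces.linear scale scale g" "bij g"
    "\<And>\<beta>. \<beta> \<in> {1..m} \<Longrightarrow> g ` {x. (x, 0) \<in> W \<beta>} = {x. (x, 0) \<in> W' \<beta>}"
    "\<And>\<beta>. \<beta> \<in> {1..m} \<Longrightarrow> g ` snd ` W \<beta> = snd ` W' \<beta>"
    using Y_stratum_connecting_automorphism[OF m y y'] by metis
  define g' where "g' = inv_into UNIV g"
  have g': "Vector_Spaces.linear scale scale g'" "inj g'" and g'g: "\<And>x. g' (g x) = x" and gg': "\<And>x. g (g' x) = x"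
    using inj_linear_imp_inv_linear[OF g(1)] g(2) bij_imp_bij_inv[OF g(2)]
    by (auto simp: g'_def bij_def surj_f_inv_f)
  interpret g': Vector_Spaces.linear scale scale g' by (rule g'(1))
  (* The second point, pulled back by g to lie over the flag of the first one. *)
  define Wg where "Wg = (\<lambda>\<beta>\<in>{1..m}. map_prod g' g' ` W' \<beta>)"
  have Wg: "Wg \<beta> = map_prod g' g' ` W' \<beta>" if "\<beta> \<in> {1..m}" for \<beta>
    unfolding Wg_def by (rule restrict_apply'[OF that])
  have yg: "(g' ` Ui', g' ` Uk', Wg) \<in> Y_stratum scale m \<nu> c"
    unfolding Wg_def by (rule Y_stratum_automorphism[OF m y' g'])
  have slice: "{x. (x, 0) \<in> Wg \<beta>} = {x. (x, 0) \<in> W \<beta>}" and snd: "snd ` Wg \<beta> = snd ` W \<beta>" if "\<beta> \<in> {1..m}" for \<beta>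
    unfolding Wg[OF that] map_prod_slices[OF g'(2) g'.zero] g(3,4)[OF that, symmetric]
    unfolding image_image g'g image_ident by (rule refl)+
  obtain h k \<psi> where h: "Vector_Spaces.linear scale scale h" "bij h" "\<And>x. x \<in> snd ` W 1 \<Longrightarrow> h x = x"
      "h ` {x. (x, 0) \<in> W 1} = {x. (x, 0) \<in> W 1}" "h ` Ui = g' ` Ui'"
    and k: "Vector_Spaces.linear scale scale k" "bij k" "\<And>x. x \<in> snd ` W 1 \<Longrightarrow> k x = x"
      "k ` {x. (x, 0) \<in> W 1} = {x. (x, 0) \<in> W 1}" "k ` Uk = g' ` Uk'"
    and \<psi>: "\<And>\<beta>. \<beta> \<in> {1..m} \<Longrightarrow> Vector_Spaces.linear scale scale (\<psi> \<beta>)"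
      "\<And>\<beta>. \<beta> \<in> {1..m} \<Longrightarrow> shear (\<psi> \<beta>) ` W \<beta> = Wg \<beta>"
      "\<And>\<beta>. \<beta> \<in> {1..<m} \<Longrightarrow> range (\<psi> \<beta>) \<subseteq> {x. (x, 0) \<in> W (\<beta> + 1)}"
      "\<And>\<beta> y. \<beta> \<in> {1..<m} \<Longrightarrow> y \<in> snd ` W (\<beta> + 1) \<Longrightarrow> \<psi> \<beta> y = 0"
    by (rule same_flag_connecting_data[OF m y yg slice snd]) (assumption+, blast)
  define G where "G = interpolation scale g"
  define H where "H = interpolation scale h"
  define K where "K = interpolation scale k"
  define T where "T = {t :: 'a. bij (G t) \<and> bij (H t) \<and> bij (K t)}"
  define sh where "sh t \<beta> = shear (\<lambda>y. scale t (\<psi> \<beta> y))" for t \<beta>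
  define F where "F t = (G t ` H t ` Ui, G t ` K t ` Uk,
    \<lambda>\<beta>\<in>{1..m}. map_prod (G t) (G t) ` (\<lambda>\<beta>\<in>{1..m}. sh t \<beta> ` W \<beta>) \<beta>)" for t
  have lin: "Vector_Spaces.linear scale scale (G t)" "Vector_Spaces.linear scale scale (H t)"
    "Vector_Spaces.linear scale scale (K t)" for t
    unfolding G_def H_def K_def by (rule linear_interpolation, fact)+
  have inj: "inj (G t)" "inj (H t)" "inj (K t)" if "t \<in> T" for t
    using that by (auto simp: T_def bij_def)
  have "finite (- T)"
  proof (rule finite_subset)
    show "- T \<subseteq> {t. \<not> bij (G t)} \<union> {t. \<not> bij (H t)} \<union> {t. \<not> bij (K t)}" by (auto simp: T_def)
    show "finite ({t. \<not> bij (G t)} \<union> {t. \<not> bij (H t)} \<union> {t. \<not> bij (K t)})"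
      unfolding G_def H_def K_def
      by (intro finite_UnI finite_not_bij_interpolation g(1) h(1) k(1))
  qed
  then have infT: "infinite T" using inf by (metis Compl_partition finite_UnI)
  have T01: "0 \<in> T" "1 \<in> T" using g(2) h(2) k(2) by (auto simp: T_def G_def H_def K_def)
  have F_mem: "F t \<in> Y_stratum scale m \<nu> c" if t: "t \<in> T" for t
    unfolding F_def
  proof (rule Y_stratum_automorphism[OF m _ lin(1) inj(1)[OF t]])
    show "(H t ` Ui, K t ` Uk, \<lambda>\<beta>\<in>{1..m}. sh t \<beta> ` W \<beta>) \<in> Y_stratum scale m \<nu> c"
      unfolding sh_def
    proof (rule Y_stratum_move_in_fibre[OF m y lin(2) inj(2)[OF t] _ _ lin(3) inj(3)[OF t]])
      have U1: "subspace {x. (x, 0) \<in> W 1}" using D(10)[of 1] m by (intro subspace_slice) simp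
      show "H t x = x" "K t x = x" if "x \<in> snd ` W 1" for x
        unfolding H_def K_def by (rule interpolation_fixes, rule h(3)[OF that] k(3)[OF that])+
      show "H t ` {x. (x, 0) \<in> W 1} \<subseteq> {x. (x, 0) \<in> W 1}" "K t ` {x. (x, 0) \<in> W 1} \<subseteq> {x. (x, 0) \<in> W 1}"
        unfolding H_def K_def
        by (rule interpolation_image_subset[OF U1], rule equalityD1[OF h(4)] equalityD1[OF k(4)])+
    next
      fix \<beta> assume "\<beta> \<in> {1..m}"
      then show "Vector_Spaces.linear scale scale (\<lambda>y. scale t (\<psi> \<beta> y))"
        by (intro linear_multiple \<psi>(1))
    next
      fix \<beta> assume \<beta>: "\<beta> \<in> {1..<m}"
      then have "\<beta> + 1 \<in> {1..m}" by simp
      then have "subspace {x. (x, 0) \<in> W (\<beta> + 1)}" using D(10) by (intro subspace_slice)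
      then show "range (\<lambda>y. scale t (\<psi> \<beta> y)) \<subseteq> {x. (x, 0) \<in> W (\<beta> + 1)}"
        using \<psi>(3)[OF \<beta>] by (intro image_subsetI subspace_scale) auto
    next
      fix \<beta> y assume "\<beta> \<in> {1..<m}" "y \<in> snd ` W (\<beta> + 1)"
      then show "scale t (\<psi> \<beta> y) = 0" using \<psi>(4) by simp
    qed
  qed
  have F0: "F 0 = y"
  proof -
    have "(\<lambda>\<beta>\<in>{1..m}. map_prod (G 0) (G 0) ` (\<lambda>\<beta>\<in>{1..m}. sh 0 \<beta> ` W \<beta>) \<beta>) = restrict W {1..m}"
      by (intro restrict_ext) (simp add: G_def sh_def shear_def map_prod.id)
    also have "\<dots> = W" using D(3) by (rule extensional_restrict)
    finally show ?thesis by (simp add: F_def y_eq) (simp add: G_def H_def K_def)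
  qed
  have F1: "F 1 = y'"
  proof -
    have "map_prod g g ` map_prod g' g' ` A = A" for A by (force simp: gg')
    then have "(\<lambda>\<beta>\<in>{1..m}. map_prod (G 1) (G 1) ` (\<lambda>\<beta>\<in>{1..m}. sh 1 \<beta> ` W \<beta>) \<beta>) = restrict W' {1..m}"
      using \<psi>(2) Wg by (intro restrict_ext) (simp add: G_def sh_def)
    also have "\<dots> = W'" using D'(3) by (rule extensional_restrict)
    finally show ?thesis
      by (simp add: F_def y'_eq) (simp add: G_def H_def K_def h(5) k(5) image_image gg')
  qed
  obtain bi bk bj where fr: "is_frame scale m y (bi, bk, bj)"
    using Gr_product_frame_exists Gr mem(1) by (metis prod_cases3 subsetD)
  define fr where "fr t = (map (\<lambda>x. G t (H t x)) bi, map (\<lambda>x. G t (K t x)) bk,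
    \<lambda>\<beta>. map (\<lambda>w. map_prod (G t) (G t) (sh t \<beta> w)) (bj \<beta>))" for t
  have frame: "is_frame scale m (F t) (fr t)" if t: "t \<in> T" for t
  proof -
    have "ordered_basis scale (G t ` H t ` Ui) (map (G t) (map (H t) bi))"
      "ordered_basis scale (G t ` K t ` Uk) (map (G t) (map (K t) bk))"
      using fr unfolding y_eq is_frame.simps
      by - (intro ordered_basis_image lin inj[OF t], elim conjE, assumption)+
    moreover have "ordered_basis dd.scale (map_prod (G t) (G t) ` sh t \<beta> ` W \<beta>)
        (map (map_prod (G t) (G t)) (map (sh t \<beta>) (bj \<beta>)))" if \<beta>: "\<beta> \<in> {1..m}" for \<beta>
    proof (intro dd.p.ordered_basis_image linear_map_prod lin)
      show "inj (map_prod (G t) (G t))" using inj(1)[OF t] by (intro prod.inj_map)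
      show "Vector_Spaces.linear dd.scale dd.scale (sh t \<beta>)"
        unfolding sh_def by (intro linear_shear linear_multiple \<psi>(1) \<beta>)
      show "inj (sh t \<beta>)" unfolding sh_def by (rule inj_shear)
      show "ordered_basis dd.scale (W \<beta>) (bj \<beta>)" using fr \<beta> by (simp add: y_eq)
    qed
    ultimately show ?thesis by (simp add: F_def fr_def o_def)
  qed
  have pathG: "polynomial_path scale Basis (\<lambda>t. G t (v t))" if "polynomial_path scale Basis v" for v
    unfolding G_def by (rule polynomial_path_interpolation[OF g(1) that])
  have pathH: "polynomial_path scale Basis (\<lambda>t. H t x)" and pathK: "polynomial_path scale Basis (\<lambda>t. K t x)" for x
    unfolding H_def K_def by (rule polynomial_path_interpolation polynomial_path_const, fact?)+
  have coords: "univariate_polynomial (\<lambda>t. hcoords scale Basis m (fr t) x)" for x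
  proof (cases x)
    case (Ci es)
    then show ?thesis by (simp add: fr_def) (intro univariate_polynomial_pluecker pathG pathH)
  next
    case (Ck es)
    then show ?thesis by (simp add: fr_def) (intro univariate_polynomial_pluecker pathG pathK)
  next
    case (Cj \<beta> es)
    have path: "polynomial_path dd.scale dd.Basis_pair (\<lambda>t. map_prod (G t) (G t) (sh t \<beta> w))" for w
    proof -
      have "(\<lambda>t. map_prod (G t) (G t) (sh t \<beta> w)) = (\<lambda>t. (G t (fst w + scale t (\<psi> \<beta> (snd w))), G t (snd w)))"
        by (auto simp: sh_def shear_def split: prod.splits)
      then show ?thesis
        by (simp only:) (intro polynomial_path_Pair pathG polynomial_path_add polynomial_path_scale
          polynomial_path_const univariate_polynomial_ident)
    qed
    show ?thesis
    proof (cases "\<beta> \<in> {1..m}")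
      case True
      then have "hcoords scale Basis m (fr t) x = pluecker dd.scale dd.Basis_pair
          (map (\<lambda>w. map_prod (G t) (G t) (sh t \<beta> w)) (bj \<beta>)) es" for t
        by (simp add: fr_def Cj)
      then show ?thesis by (simp only:) (intro dd.p.univariate_polynomial_pluecker path)
    next
      case False
      then have "hcoords scale Basis m (fr t) x = 0" for t by (auto simp: fr_def Cj)
      then show ?thesis by simp
    qed
  qed
  have "irreducible_in (Gr_zariski scale Basis m \<nu>) (F ` T)"
    by (rule irreducible_in_polynomial_curve[OF infT _ frame coords]) (use F_mem Gr in blast)
  moreover have "F ` T \<subseteq> Y_stratum scale m \<nu> c" using F_mem by blast
  moreover have "y \<in> F ` T" "y' \<in> F ` T" using F0 F1 T01 by (metis image_eqI)+
  ultimately show "\<exists>T\<subseteq>Y_stratum scale m \<nu> c. y \<in> T \<and> y' \<in> T \<and> irreducible_in (Gr_zariski scale Basis m \<nu>) T"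
    by blast
qed

end

section \<open>The irreducible components\<close>

theorem proposition3p4:
  fixes scale :: "'a::alg_closed_field \<Rightarrow> 'v::ab_group_add \<Rightarrow> 'v"
    and Basis :: "'v set"
    and m :: nat
    and \<nu> :: "vertex \<Rightarrow> nat"
  assumes "algebraic_over_finite_subfield TYPE('a)"
    and "finite_dimensional_vector_space scale Basis"
    and "m \<ge> 1"
  shows "irreducible_components (Y_zariski scale Basis m \<nu>) =
    {Y_zariski scale Basis m \<nu> closure_of Y_stratum scale m \<nu> c | c :: nat \<Rightarrow> nat.
       (\<forall>\<beta>\<in>{1..<m}. c (\<beta> + 1) \<le> c \<beta>) \<and> c 1 \<le> min (\<nu> Vi) (\<nu> Vk) \<and>
       Y_stratum scale m \<nu> c \<noteq> {}}"
proof -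
  interpret doubled_space scale Basis using assms(2) by (simp add: doubled_space_def)
  note m = assms(3)
  define adm where "adm c \<longleftrightarrow> (\<forall>\<beta>\<in>{1..<m}. c (\<beta> + 1) \<le> c \<beta>) \<and> c 1 \<le> min (\<nu> Vi) (\<nu> Vk) \<and>
       Y_stratum scale m \<nu> c \<noteq> {}" for c :: "nat \<Rightarrow> nat"
  define \<F> where "\<F> = {Y_stratum scale m \<nu> c | c. adm c}"
  let ?X = "Y_zariski scale Basis m \<nu>"
  have "irreducible_components ?X = (closure_of) ?X ` \<F>"
  proof (rule irreducible_components_eq_closures)
    (* Finiteness of the family: only the values of c on {1..m} matter, and they are bounded. *)
    have "\<F> \<subseteq> Y_stratum scale m \<nu> ` ({1..m} \<rightarrow>\<^sub>E {0..card Basis})"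
    proof
      fix S assume "S \<in> \<F>"
      then obtain c where c: "adm c" "S = Y_stratum scale m \<nu> c" by (auto simp: \<F>_def)
      then obtain Ui Uk W where y: "(Ui, Uk, W) \<in> Y_stratum scale m \<nu> c" by (auto simp: adm_def)
      have "c \<beta> \<le> card Basis" if "\<beta> \<in> {1..m}" for \<beta>
        using Y_stratumD(11)[OF m y that] dim_subset_UNIV[of "snd ` W \<beta>"] by (simp add: dimension_def)
      then have "restrict c {1..m} \<in> {1..m} \<rightarrow>\<^sub>E {0..card Basis}" by auto
      moreover have "S = Y_stratum scale m \<nu> (restrict c {1..m})"
        unfolding c(2) by (rule Y_stratum_cong) simp
      ultimately show "S \<in> Y_stratum scale m \<nu> ` ({1..m} \<rightarrow>\<^sub>E {0..card Basis})" by blast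
    qed
    then show "finite \<F>" by (rule finite_subset) (intro finite_imageI finite_PiE, auto)
    show "irreducible_in ?X S" if "S \<in> \<F>" for S
    proof -
      obtain c where "adm c" "S = Y_stratum scale m \<nu> c" using \<open>S \<in> \<F>\<close> by (auto simp: \<F>_def)
      then show ?thesis
        unfolding Y_zariski_def
        using irreducible_in_Y_stratum[OF infinite_alg_closed_field m] Y_stratum_subset_Y_nu[OF m]
        by (simp add: adm_def irreducible_in_subtopology)
    qed
    show "topspace ?X = \<Union>\<F>"
      unfolding topspace_Y_zariski
    proof (intro equalityI subsetI)
      fix y assume "y \<in> Y_nu scale m \<nu>"
      moreover obtain Ui Uk W where y_eq: "y = (Ui, Uk, W)" by (cases y) auto
      ultimately have y: "(Ui, Uk, W) \<in> Y_nu scale m \<nu>" by simp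
      let ?c = "\<lambda>\<beta>. dim (snd ` W \<beta>)"
      have "adm ?c" using Y_nu_in_Y_stratum[OF m y] unfolding adm_def by blast
      then show "y \<in> \<Union>\<F>" using Y_nu_in_Y_stratum(1)[OF m y] by (auto simp: \<F>_def y_eq)
    qed (use Y_stratum_subset_Y_nu[OF m] in \<open>auto simp: \<F>_def\<close>)
    fix S S' assume "S \<in> \<F>" "S' \<in> \<F>" "S \<subseteq> ?X closure_of S'"
    then obtain c c' where c: "adm c" "S = Y_stratum scale m \<nu> c" "S' = Y_stratum scale m \<nu> c'"
      by (auto simp: \<F>_def)
    have ne: "Y_stratum scale m \<nu> c \<noteq> {}" using c(1) by (simp add: adm_def)
    have "c \<beta> = c' \<beta>" if "\<beta> \<in> {1..m}" for \<beta>
      by (rule Y_stratum_separated[OF m ne \<open>S \<subseteq> ?X closure_of S'\<close>[unfolded c(2,3)] that])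
    then show "S = S'" unfolding c by (rule Y_stratum_cong)
  qed
  then show ?thesis unfolding \<F>_def adm_def by auto
qed

end
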